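(* Let $0<p<\infty$, $k\in\mathbb{N}$ and $\omega\in\mathcal{B}_\infty(\mathcal{D})$. Then $$\|f\|_{A^p_\omega}^p\asymp\int_{\mathbb{D}}|f^{(k)}(z)|^p(1-|z|)^{kp}\omega(z)\,dA(z)+\sum_{j=0}^{k-1}|f^{(j)}(0)|^p,\quad f\in\mathcal{H}(\mathbb{D}).$$
   Context: $\mathbb{D}$ is the open unit disc in $\mathbb{C}$, $\mathcal{H}(\mathbb{D})$ the space of analytic functions in $\mathbb{D}$, $dA=\frac{dx\,dy}{\pi}$, and $\mathbb{N}=\{1,2,\dots\}$. A weight is a nonnegative function on $\mathbb{D}$ integrable with respect to $dA$; it is radial if $\omega(z)=\omega(|z|)$ for all $z\in\mathbb{D}$ and $\int_0^1\omega(s)\,ds<\infty$. Write $\omega(E)=\int_E\omega\,dA$. For a weight $\omega$, $\|f\|_{A^p_\omega}^p=\int_{\mathbb{D}}|f|^p\omega\,dA$ and $A^p_\omega=\{f\in\mathcal{H}(\mathbb{D}):\|f\|_{A^p_\omega}<\infty\}$. For $a\in\mathbb{D}\setminus\{0\}$ let $I_a=\{e^{i\theta}:|\arg(ae^{-i\theta})|\le\frac{1-|a|}{2}\}$; the Carleson square induced by $a$ is $S(a)=\{re^{it}\in\mathbb{D}:r\ge|a|,\ e^{it}\in I_a\}$. All weights are assumed to satisfy $\omega(S(a))>0$ for all $a\in\mathbb{D}\setminus\{0\}$. For a radial weight $\nu$ put $\widehat{\nu}(r)=\int_r^1\nu(s)\,ds$. Then $\nu\in\widehat{\mathcal{D}}$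 if there is $C>1$ with $\widehat{\nu}(r)\le C\widehat{\nu}(\frac{1+r}{2})$ for all $0\le r<1$; $\nu\in\check{\mathcal{D}}$ if there are $K>1$ and $C>1$ with $\widehat{\nu}(r)\ge C\widehat{\nu}(1-\frac{1-r}{K})$ for all $0\le r<1$; and $\mathcal{D}=\widehat{\mathcal{D}}\cap\check{\mathcal{D}}$. For $1<q<\infty$, $q'=\frac{q}{q-1}$, and a weight $\nu$, a function $W\ge0$ with $W\nu$ integrable belongs to $B_q(\nu)$ if $$\sup_S\frac{\left(\int_S W\nu\,dA\right)^{1/q}\left(\int_S W^{-q'/q}\nu\,dA\right)^{1/q'}}{\int_S\nu\,dA}<\infty,$$ the supremum being over all Carleson squares $S$. Thus, for a weight $\omega$, $\frac{\omega}{\nu}\in B_q(\nu)$ means $\left(\int_S\omega\,dA\right)^{1/q}\left(\int_S(\nu\,\omega^{-1/q})^{q'}dA\right)^{1/q'}\le C\nu(S)$ for all $S$, where the integrand in the second integral is taken to be $0$ where $\nu=0$ and $+\infty$ where $\omega=0<\nu$. Set $\mathcal{B}_\infty(\nu)=\bigcup_{1<q<\infty}\{\omega:\frac{\omega}{\nu}\in B_q(\nu)\}$ and $\mathcal{B}_\infty(\mathcal{D})=\bigcup_{\nu\in\mathcal{D}}\mathcal{B}_\infty(\nu)$. $X\asymp Y$ means $C^{-1}Y\le X\le CY$ with a constant $C>0$ independent of $f$ (depending only on $\omega,p,k$); both sides may be $+\infty$. *)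

theory Defs
  imports "HOL-Analysis.Analysis"
begin

text \<open>
  Functions on the unit disc are represented as total functions on \<^typ>\<open>complex\<close>;
  their values outside the disc are never used.
\<close>

abbreviation unit_disc :: "complex set" where
  "unit_disc \<equiv> ball 0 1"

definition dA :: "complex measure" where
  "dA = density (lebesgue_on unit_disc) (\<lambda>_. ennreal (1 / pi))"

definition carleson_arc :: "complex \<Rightarrow> complex set" where
  "carleson_arc a = {cis \<theta> | \<theta>. \<bar>Arg (a * cis (- \<theta>))\<bar> \<le> (1 - cmod a) / 2}"

definition carleson_square :: "complex \<Rightarrow> complex set" where
  "carleson_square a =
     {of_real r * cis t | r t. of_real r * cis t \<in> unit_disc \<and> cmod a \<le> r \<and> cis t \<in> carleson_arc a}"

definition weighted_area :: "(complex \<Rightarrow> real) \<Rightarrow> complex set \<Rightarrow> ennreal" where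
  "weighted_area \<omega> E = (\<integral>\<^sup>+ z \<in> E. ennreal (\<omega> z) \<partial>dA)"

text \<open>The requirement that all Carleson squares are charged is part of the notion of a weight.\<close>

definition weight :: "(complex \<Rightarrow> real) \<Rightarrow> bool" where
  "weight \<omega> \<longleftrightarrow>
     (\<forall>z \<in> unit_disc. 0 \<le> \<omega> z) \<and> integrable dA \<omega> \<and>
     (\<forall>a \<in> unit_disc - {0}. weighted_area \<omega> (carleson_square a) > 0)"

definition radial_weight :: "(complex \<Rightarrow> real) \<Rightarrow> bool" where
  "radial_weight \<omega> \<longleftrightarrow>
     weight \<omega> \<and> (\<forall>z \<in> unit_disc. \<omega> z = \<omega> (of_real (cmod z))) \<and>
     set_integrable lebesgue {0..<1} (\<lambda>s::real. \<omega> (of_real s))"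

definition tail :: "(complex \<Rightarrow> real) \<Rightarrow> real \<Rightarrow> real" where
  "tail \<nu> r = (LINT s:{r..<1}|lebesgue. \<nu> (of_real s))"

definition D_hat :: "(complex \<Rightarrow> real) set" where
  "D_hat = {\<nu>. radial_weight \<nu> \<and>
     (\<exists>C>1. \<forall>r. 0 \<le> r \<and> r < 1 \<longrightarrow> tail \<nu> r \<le> C * tail \<nu> ((1 + r) / 2))}"

definition D_check :: "(complex \<Rightarrow> real) set" where
  "D_check = {\<nu>. radial_weight \<nu> \<and>
     (\<exists>K>1. \<exists>C>1. \<forall>r. 0 \<le> r \<and> r < 1 \<longrightarrow> tail \<nu> r \<ge> C * tail \<nu> (1 - (1 - r) / K))}"

definition D_class :: "(complex \<Rightarrow> real) set" where
  "D_class = D_hat \<inter> D_check"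

text \<open>Real powers of extended nonnegative numbers, used with positive exponents only.\<close>

definition epow :: "ennreal \<Rightarrow> real \<Rightarrow> ennreal" where
  "epow x e = (if x = \<infinity> then \<infinity> else ennreal (enn2real x powr e))"

text \<open>
  The function \<open>(\<nu> \<omega>\<^sup>-\<^sup>1\<^sup>/\<^sup>q)\<^sup>q\<^sup>'\<close> with \<open>q' = q / (q - 1)\<close>. The cases are
  spelled out because real powers of \<open>0\<close> are \<open>0\<close> in HOL, even for negative exponents.
\<close>

definition dual_integrand ::
    "real \<Rightarrow> (complex \<Rightarrow> real) \<Rightarrow> (complex \<Rightarrow> real) \<Rightarrow> complex \<Rightarrow> ennreal" where
  "dual_integrand q \<omega> \<nu> z =
     (if \<nu> z = 0 then 0
      else if \<omega> z = 0 then \<infinity>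
      else ennreal ((\<nu> z * \<omega> z powr (- 1 / q)) powr (q / (q - 1))))"

text \<open>
  The condition \<open>\<omega>/\<nu> \<in> B\<^sub>q(\<nu>)\<close>. The numerator is the product of the powers \<open>1/q\<close> of
  \<open>\<integral>\<^sub>S \<omega> dA\<close> and \<open>1/q' = (q - 1)/q\<close> of \<open>\<integral>\<^sub>S (\<nu> \<omega>\<^sup>-\<^sup>1\<^sup>/\<^sup>q)\<^sup>q\<^sup>' dA\<close>; as
  \<open>\<integral>\<^sub>S \<omega> dA > 0\<close> for weights, it is infinite whenever the second integral is.
\<close>

definition quotient_in_B :: "real \<Rightarrow> (complex \<Rightarrow> real) \<Rightarrow> (complex \<Rightarrow> real) \<Rightarrow> bool" where
  "quotient_in_B q \<nu> \<omega> \<longleftrightarrow>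
     (\<exists>C::real. \<forall>a \<in> unit_disc - {0}.
        epow (weighted_area \<omega> (carleson_square a)) (1 / q) *
        epow (\<integral>\<^sup>+ z \<in> carleson_square a. dual_integrand q \<omega> \<nu> z \<partial>dA) ((q - 1) / q)
        \<le> ennreal C * weighted_area \<nu> (carleson_square a))"

definition B_infinity :: "(complex \<Rightarrow> real) \<Rightarrow> (complex \<Rightarrow> real) set" where
  "B_infinity \<nu> = (\<Union>q \<in> {1<..}. {\<omega>. weight \<omega> \<and> quotient_in_B q \<nu> \<omega>})"

definition B_infinity_D :: "(complex \<Rightarrow> real) set" where
  "B_infinity_D = (\<Union>\<nu> \<in> D_class. B_infinity \<nu>)"

text \<open>The \<open>p\<close>-th power of the norm of \<open>A\<^sup>p\<^sub>\<omega>\<close>, possibly infinite.\<close>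

definition bergman_norm_pow :: "real \<Rightarrow> (complex \<Rightarrow> real) \<Rightarrow> (complex \<Rightarrow> complex) \<Rightarrow> ennreal" where
  "bergman_norm_pow p \<omega> f = (\<integral>\<^sup>+ z. ennreal (cmod (f z) powr p * \<omega> z) \<partial>dA)"

end

theory Submission
  imports Defs "HOL-Complex_Analysis.Complex_Analysis"
begin

text \<open>
  Let \<open>\<nu>\<close> be a radial weight in \<open>\<D>\<close> with \<open>\<omega>/\<nu> \<in> B\<^sub>q(\<nu>)\<close>, and put \<open>\<mu> = \<omega> dA\<close>, \<open>\<eta> = \<nu> dA\<close>. Such an \<open>\<omega>\<close>
  need not be comparable to a constant on hyperbolic discs and may even vanish on some of them, so
  \<open>|g(z)|\<^sup>p\<close> cannot be estimated by an average of \<open>|g|\<^sup>p\<close> over a hyperbolic disc against \<open>\<mu>\<close>. The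
  proof replaces that average by one over a whole annulus at height comparable to \<open>1 - |z|\<close>, damped
  by a kernel that decays fast away from \<open>z\<close>. All estimates are carried by the operator \<open>Phi\<close>,
  \<open>\<Phi> g(z) = \<integral> ((1 - |z|) / (1 - |z| + |z - \<zeta>|))\<^sup>N |g(\<zeta>)|\<^sup>p / W(\<zeta>) d\<mu>(\<zeta>)\<close>, integrated over the
  annulus \<open>near z\<close>, where \<open>W(\<zeta>)\<close> is the integral of essentially the same kernel, based at \<open>\<zeta>\<close>,
  against \<open>\<mu>\<close>. Two properties of \<open>\<Phi>\<close> are needed.

  First, it controls \<open>g\<close> locally: \<open>|g(w)|\<^sup>p \<le> C \<Phi> g(z)\<close> whenever \<open>|w - z| \<le> (1 - |z|)/2\<close>
  (\<open>local_bound\<close>). For every \<open>s > 0\<close> the value \<open>|g(w)|\<^sup>s\<close> is at most a mean of \<open>|g|\<^sup>s\<close> over any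
  larger circle against a kernel with arbitrary polynomial decay (\<open>circle_power_mean\<close>). As \<open>\<eta>\<close> is
  rotation invariant, such means may be averaged against \<open>\<eta>\<close> over an annulus (\<open>annulus_mean\<close>). With
  \<open>s = p/q\<close>, the \<open>B\<^sub>q\<close> condition turns the \<open>\<eta>\<close>-mean of \<open>|g|\<^sup>p\<^sup>/\<^sup>q\<close> over one Carleson square into a
  \<open>\<mu>\<close>-mean of \<open>|g|\<^sup>p\<close> (\<open>box_Hoelder\<close>), and integration over all rotations of that square gives the
  annulus (\<open>annulus_bound\<close>). Integrating over rotated squares takes the place of tilings of the disc
  throughout.

  What arises here in place of \<open>1/W\<close> is the reciprocal of \<open>\<mu>(S)\<close>, where \<open>S\<close> is the square at \<open>\<zeta>\<close>; so
  one needs \<open>W(\<zeta>) \<le> C \<mu>(S)\<close> (\<open>W_box_bound\<close>). This holds for large \<open>N\<close> because \<open>\<mu>\<close> doubles: applied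
  to indicators, the \<open>B\<^sub>q\<close> condition says that a subset of a square with a definite share of \<open>\<eta>\<close> has
  a definite share of \<open>\<mu>\<close> (\<open>mu_le_of_eta_le\<close>), so the doubling of the tails of \<open>\<nu>\<close>, which is what
  \<open>\<D>\<close>-hat means, passes to \<open>\<mu>\<close> (\<open>mu_ball_le\<close>).

  Secondly, \<open>\<Phi>\<close> is bounded from \<open>L\<^sup>p\<close> to \<open>L\<^sup>1\<close> in the sense that \<open>\<integral> \<Phi> g d\<mu> \<le> C \<integral> |g|\<^sup>p d\<mu>\<close>
  (\<open>integral_Phi_le\<close>). This is Tonelli's theorem: the kernel is almost symmetric for \<open>\<zeta>\<close> in
  \<open>near z\<close>, hence its integral in \<open>z\<close> is at most \<open>C W(\<zeta>)\<close>, which cancels the denominator.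

  One half of the theorem is now short. Cauchy's inequality on the disc of radius \<open>(1 - |z|)/2\<close>
  gives \<open>|f\<^sup>(\<^sup>k\<^sup>)(z)|\<^sup>p (1 - |z|)\<^sup>k\<^sup>p \<le> C \<Phi> f(z)\<close> (\<open>Cauchy_local\<close>); integrate this for the
  derivative term, and take \<open>z = 0\<close> for the Taylor coefficients.

  For the other half it suffices to pass from a function to its first derivative with an additional
  weight \<open>(1 - |z|)\<^sup>s\<close> and to iterate. Along the radius of \<open>z\<close> put \<open>z\<^sub>n = (1 - 2\<^sup>-\<^sup>n) z\<close>;
  telescoping bounds \<open>|f(z) - f(0)|\<close> by the sum of \<open>2\<^sup>-\<^sup>n (C \<Phi> f'(z\<^sub>n))\<^sup>1\<^sup>/\<^sup>p\<close> over the \<open>n\<close> with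
  \<open>2\<^sup>-\<^sup>n\<close> at least about \<open>1 - |z|\<close>. Its \<open>p\<close>-th power is at most a constant times the sum of
  \<open>(2\<^sup>-\<^sup>n / (1 - |z|))\<^sup>\<epsilon> 2\<^sup>-\<^sup>n\<^sup>p \<Phi> f'(z\<^sub>n)\<close> (\<open>pointwise_by_derivative\<close>). The growing factor is a
  price that has to be paid back by \<open>\<mu>\<close>, and here \<open>\<D>\<close>-check is decisive: a fixed share of the
  \<open>\<mu>\<close>-mass of a square lies in its upper part, hence the mass near the boundary decays
  geometrically, and \<open>W\<close> keeps its size when the integrand that defines it is multiplied by a small
  negative power of \<open>1 - |\<xi>|\<close> (\<open>kmeas_strip_decay\<close>, \<open>W_le_kmeas\<close>). For this reason the factor with
  exponent \<open>\<epsilon>\<close> is built into the definition of \<open>W\<close>, and Tonelli applies as before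
  (\<open>Phi_integral_le\<close>).
\<close>

section \<open>Power means of holomorphic functions on circles\<close>

text \<open>
  The Poisson kernel for \<open>M = 1\<close>. Each further power of \<open>(1 - |x|\<^sup>2) / |e\<^sup>i\<^sup>\<theta> - x|\<close> adds decay away
  from \<open>x\<close>.
\<close>

definition circle_kernel :: "nat \<Rightarrow> complex \<Rightarrow> real \<Rightarrow> real" where
  "circle_kernel M x \<theta> = (1 - (cmod x)\<^sup>2) ^ M / cmod (cis \<theta> - x) ^ Suc M"

lemma cis_neq_disc: "cmod x < 1 \<Longrightarrow> cis \<theta> - x \<noteq> 0"
  by (metis norm_cis less_irrefl right_minus_eq)

lemma one_minus_cnj_neq_0:
  assumes "cmod x < 1" "cmod \<zeta> \<le> 1" shows "1 - cnj x * \<zeta> \<noteq> 0"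
proof
  assume "1 - cnj x * \<zeta> = 0"
  then have "cmod (cnj x * \<zeta>) = 1" by (metis norm_one right_minus_eq)
  moreover have "cmod (cnj x * \<zeta>) \<le> cmod x * 1"
    unfolding norm_mult using assms by (intro mult_mono) auto
  ultimately show False using assms by simp
qed

lemma cmod_one_minus_cnj_cis: "cmod (1 - cnj x * cis \<theta>) = cmod (cis \<theta> - x)"
proof -
  have "cis \<theta> - x = cis \<theta> * cnj (1 - cnj x * cis \<theta>)"
    by (simp add: algebra_simps cis_cnj cis_mult)
  then show ?thesis by (metis complex_mod_cnj mult_1 norm_cis norm_mult)
qed

lemma circle_kernel_nonneg: "cmod x < 1 \<Longrightarrow> 0 \<le> circle_kernel M x \<theta>"
  unfolding circle_kernel_def by (simp add: power_le_one)

lemma continuous_on_circle_kernel: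
  "cmod x < 1 \<Longrightarrow> continuous_on S (circle_kernel M x)"
  unfolding circle_kernel_def using cis_neq_disc
  by (intro continuous_intros) auto

lemma Cauchy_on_unit_circle:
  fixes F :: "complex \<Rightarrow> complex"
  assumes "continuous_on (cball 0 1) F" "F holomorphic_on ball 0 1" "cmod x < 1"
  shows "((\<lambda>t. F (cis t) / (cis t - x) * cis t) has_integral (of_real (2 * pi) * F x)) {0..2*pi}"
proof -
  have "((\<lambda>u. F u / (u - x)) has_contour_integral 2 * of_real pi * \<i> * F x) (circlepath 0 1)"
    by (rule Cauchy_integral_circlepath) (use assms in auto)
  then have "((\<lambda>t. F (cis t) / (cis t - x) * \<i> * cis t) has_integral (2 * pi * \<i> * F x)) {0..2*pi}"
    unfolding circlepath_def by (subst (asm) has_contour_integral_part_circlepath_iff) (auto simp: mult_ac)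
  from has_integral_mult_right[OF this, of "-\<i>"] show ?thesis
    by (simp add: algebra_simps)
qed

text \<open>
  Without zeros, \<open>h\<^sup>s\<close> has a holomorphic branch. Cauchy's formula is applied to its product with
  \<open>((1 - |x|\<^sup>2) / (1 - cnj x \<zeta>))\<^sup>M\<close>, a factor that equals \<open>1\<close> at \<open>\<zeta> = x\<close> and decays away from \<open>x\<close> on
  the circle.
\<close>

lemma circle_power_mean_zero_free:
  fixes s :: real
  assumes h: "h holomorphic_on ball 0 R" "R > 1" and nz: "\<And>z. z \<in> ball 0 R \<Longrightarrow> h z \<noteq> 0"
    and x: "cmod x < 1"
  shows "2 * pi * cmod (h x) powr s
    \<le> integral {0..2*pi} (\<lambda>\<theta>. cmod (h (cis \<theta>)) powr s * circle_kernel M x \<theta>)"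
proof -
  obtain l where l: "l holomorphic_on ball 0 R" and hl: "\<And>z. z \<in> ball 0 R \<Longrightarrow> h z = exp (l z)"
    using holomorphic_logarithm_exists[OF convex_ball open_ball h(1) nz, of 0] h(2)
    by (metis centre_in_ball dual_order.strict_trans zero_less_one)
  have sub: "ball 0 1 \<subseteq> ball (0::complex) R" "cball 0 1 \<subseteq> ball (0::complex) R" using h(2) by auto
  define c where "c = complex_of_real (1 - (cmod x)\<^sup>2)"
  define F where "F \<zeta> = exp (of_real s * l \<zeta>) * (c / (1 - cnj x * \<zeta>)) ^ M" for \<zeta>
  have hpow: "cmod (exp (of_real s * l z)) = cmod (h z) powr s" if "z \<in> ball 0 R" for z
    using that by (simp add: hl powr_def)
  have nz1: "1 - cnj x * \<zeta> \<noteq> 0" if "\<zeta> \<in> cball 0 1" for \<zeta>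
    using one_minus_cnj_neq_0 x that by auto
  have lc: "l holomorphic_on cball 0 1" "l holomorphic_on ball 0 1"
    using l sub holomorphic_on_subset by blast+
  have F1: "F holomorphic_on ball 0 1"
    unfolding F_def using lc(2) nz1 by (intro holomorphic_intros) auto
  have F2: "continuous_on (cball 0 1) F"
    unfolding F_def using lc(1) nz1 holomorphic_on_imp_continuous_on
    by (intro continuous_intros) auto
  have Fx: "cmod (F x) = cmod (h x) powr s"
  proof -
    have "cnj x * x = of_real ((cmod x)\<^sup>2)"
      by (metis complex_norm_square mult.commute)
    then have "c / (1 - cnj x * x) = 1"
      unfolding c_def using nz1[of x] x by simp
    then show ?thesis
      unfolding F_def norm_mult using hpow[of x] x h(2) by simp
  qed
  have nF: "cmod (F (cis t) / (cis t - x) * cis t) = cmod (h (cis t)) powr s * circle_kernel M x t" for t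
  proof -
    have c: "cmod c = 1 - (cmod x)\<^sup>2"
      unfolding c_def norm_of_real using x by (simp add: power_le_one)
    have "cis t \<in> ball 0 R" using h(2) by simp
    then show ?thesis
      unfolding F_def norm_mult norm_divide norm_power c cmod_one_minus_cnj_cis circle_kernel_def
        hpow[OF \<open>cis t \<in> ball 0 R\<close>]
      by (simp add: power_divide)
  qed
  have int: "((\<lambda>t. F (cis t) / (cis t - x) * cis t) has_integral (of_real (2 * pi) * F x)) {0..2*pi}"
    by (rule Cauchy_on_unit_circle[OF F2 F1 x])
  have cont: "continuous_on {0..2*pi} (\<lambda>t. cmod (h (cis t)) powr s * circle_kernel M x t)"
    unfolding nF[symmetric]
    using cis_neq_disc[OF x] by (intro continuous_intros continuous_on_compose2[OF F2]) auto
  have "cmod (integral {0..2*pi} (\<lambda>t. F (cis t) / (cis t - x) * cis t))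
      \<le> integral {0..2*pi} (\<lambda>t. cmod (h (cis t)) powr s * circle_kernel M x t)"
    by (rule integral_norm_bound_integral)
       (use int cont nF in \<open>auto intro: integrable_continuous_real has_integral_integrable\<close>)
  then show ?thesis
    using integral_unique[OF int] by (simp add: norm_mult Fx)
qed

text \<open>
  Cauchy's formula at \<open>x\<close> for \<open>(1 - |x|\<^sup>2) / (1 - cnj x \<zeta>)\<close>, whose Cauchy integrand on the circle is
  real.
\<close>

lemma Poisson_kernel_integral:
  assumes x: "cmod x < 1"
  shows "((\<lambda>t. (1 - (cmod x)\<^sup>2) / (cmod (cis t - x))\<^sup>2) has_integral (2 * pi)) {0..2*pi}"
proof -
  have nz1: "1 - cnj x * \<zeta> \<noteq> 0" if "\<zeta> \<in> cball 0 1" for \<zeta>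
    using one_minus_cnj_neq_0 x that by auto
  define F where "F \<zeta> = complex_of_real (1 - (cmod x)\<^sup>2) / (1 - cnj x * \<zeta>)" for \<zeta>
  have F1: "F holomorphic_on ball 0 1"
    unfolding F_def using nz1 by (intro holomorphic_intros) auto
  have F2: "continuous_on (cball 0 1) F"
    unfolding F_def using nz1 by (intro continuous_intros) auto
  have "cnj x * x = of_real ((cmod x)\<^sup>2)"
    by (metis complex_norm_square mult.commute)
  then have Fx: "F x = 1" unfolding F_def using nz1[of x] x by simp
  have eq: "F (cis t) / (cis t - x) * cis t = of_real ((1 - (cmod x)\<^sup>2) / (cmod (cis t - x))\<^sup>2)" for t
  proof -
    have "cis t - x = cis t * cnj (1 - cnj x * cis t)"
      by (simp add: algebra_simps cis_cnj cis_mult)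
    then have "F (cis t) / (cis t - x) * cis t
        = of_real (1 - (cmod x)\<^sup>2) / ((1 - cnj x * cis t) * cnj (1 - cnj x * cis t))"
      unfolding F_def by simp
    also have "(1 - cnj x * cis t) * cnj (1 - cnj x * cis t) = of_real ((cmod (cis t - x))\<^sup>2)"
      by (metis complex_norm_square cmod_one_minus_cnj_cis)
    finally show ?thesis by simp
  qed
  have "((\<lambda>t. complex_of_real ((1 - (cmod x)\<^sup>2) / (cmod (cis t - x))\<^sup>2)) has_integral (of_real (2 * pi))) {0..2*pi}"
    using Cauchy_on_unit_circle[OF F2 F1 x] unfolding eq Fx by simp
  from has_integral_linear[OF this bounded_linear_Re] show ?thesis by (simp add: o_def)
qed

text \<open>
  Carries the mean value inequality from dilates to a polynomial and from Taylor polynomials to a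
  general function.
\<close>

lemma circle_power_mean_limit:
  fixes s :: real
  assumes s: "0 < s" and x: "cmod x < 1"
    and cont: "\<And>n. continuous_on UNIV (\<lambda>\<theta>. g n (cis \<theta>))"
    and bdd: "\<And>n \<theta>. cmod (g n (cis \<theta>)) \<le> B"
    and lim: "\<And>\<theta>. (\<lambda>n. g n (cis \<theta>)) \<longlonglongrightarrow> h (cis \<theta>)" "(\<lambda>n. g n x) \<longlonglongrightarrow> h x"
    and le: "\<And>n. 2 * pi * cmod (g n x) powr s
      \<le> integral {0..2*pi} (\<lambda>\<theta>. cmod (g n (cis \<theta>)) powr s * circle_kernel M x \<theta>)"
  shows "2 * pi * cmod (h x) powr s
      \<le> integral {0..2*pi} (\<lambda>\<theta>. cmod (h (cis \<theta>)) powr s * circle_kernel M x \<theta>)"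
proof -
  have ck: "continuous_on UNIV (circle_kernel M x)" by (rule continuous_on_circle_kernel[OF x])
  have "(\<lambda>n. integral {0..2*pi} (\<lambda>\<theta>. cmod (g n (cis \<theta>)) powr s * circle_kernel M x \<theta>))
    \<longlonglongrightarrow> integral {0..2*pi} (\<lambda>\<theta>. cmod (h (cis \<theta>)) powr s * circle_kernel M x \<theta>)"
  proof (rule dominated_convergence(2)[where h="\<lambda>\<theta>. B powr s * circle_kernel M x \<theta>"])
    show "(\<lambda>\<theta>. cmod (g n (cis \<theta>)) powr s * circle_kernel M x \<theta>) integrable_on {0..2*pi}" for n
      by (rule integrable_continuous_real, rule continuous_on_subset[where s=UNIV],
          intro continuous_intros cont ck continuous_on_powr') (use s in auto)
    show "(\<lambda>\<theta>. B powr s * circle_kernel M x \<theta>) integrable_on {0..2*pi}"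
      by (rule integrable_continuous_real, rule continuous_on_subset[where s=UNIV],
          intro continuous_intros ck) auto
    show "norm (cmod (g n (cis \<theta>)) powr s * circle_kernel M x \<theta>) \<le> B powr s * circle_kernel M x \<theta>" for n \<theta>
      using circle_kernel_nonneg[OF x] bdd s
      by (auto simp: abs_mult intro!: mult_right_mono powr_mono2)
    show "(\<lambda>n. cmod (g n (cis \<theta>)) powr s * circle_kernel M x \<theta>)
        \<longlonglongrightarrow> cmod (h (cis \<theta>)) powr s * circle_kernel M x \<theta>" for \<theta>
      by (intro tendsto_intros tendsto_powr' lim) (use s in auto)
  qed
  moreover have "(\<lambda>n. 2 * pi * cmod (g n x) powr s) \<longlonglongrightarrow> 2 * pi * cmod (h x) powr s"
    by (intro tendsto_intros tendsto_powr' lim) (use s in auto)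
  ultimately show ?thesis using le by (meson LIMSEQ_le)
qed

text \<open>
  Each root \<open>a\<close> in the disc is reflected in the circle: replacing \<open>z - a\<close> by \<open>1 - cnj a z\<close> keeps the
  modulus on the circle and increases it inside. This plays the part of dividing out a Blaschke
  product.
\<close>

lemma poly_reflect_roots:
  fixes p :: "complex poly"
  assumes "p \<noteq> 0"
  shows "\<exists>q. (\<forall>z. cmod z < 1 \<longrightarrow> poly q z \<noteq> 0) \<and> (\<forall>\<theta>. cmod (poly q (cis \<theta>)) = cmod (poly p (cis \<theta>)))
           \<and> (\<forall>z. cmod z < 1 \<longrightarrow> cmod (poly p z) \<le> cmod (poly q z))"
  using assms
proof (induction "degree p" arbitrary: p rule: less_induct)
  case less
  show ?case
  proof (cases "\<exists>a. cmod a < 1 \<and> poly p a = 0")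
    case False
    then show ?thesis by blast
  next
    case True
    then obtain a where a: "cmod a < 1" "poly p a = 0" by blast
    then obtain r where r: "p = [:-a, 1:] * r" by (metis dvdE poly_eq_0_iff_dvd)
    have "r \<noteq> 0" using less.prems r by auto
    then have "degree r < degree p" unfolding r by (subst degree_mult_eq) auto
    from less.hyps[OF this \<open>r \<noteq> 0\<close>] obtain q where
      q: "\<And>z. cmod z < 1 \<Longrightarrow> poly q z \<noteq> 0" "\<And>\<theta>. cmod (poly q (cis \<theta>)) = cmod (poly r (cis \<theta>))"
         "\<And>z. cmod z < 1 \<Longrightarrow> cmod (poly r z) \<le> cmod (poly q z)" by blast
    have eval: "poly ([:1, - cnj a:] * q) z = (1 - cnj a * z) * poly q z"
      "poly p z = (z - a) * poly r z" for z
      unfolding r by (simp_all add: algebra_simps)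
    have le: "cmod (z - a) \<le> cmod (1 - cnj a * z)" if z: "cmod z < 1" for z
    proof -
      have "(cmod (1 - cnj a * z))\<^sup>2 - (cmod (z - a))\<^sup>2 = (1 - (cmod a)\<^sup>2) * (1 - (cmod z)\<^sup>2)"
        by (simp add: cmod_power2) (simp add: algebra_simps power2_eq_square)
      also have "\<dots> \<ge> 0" using a z by (intro mult_nonneg_nonneg) (auto simp: power_le_one)
      finally show ?thesis by (simp add: power2_le_iff_abs_le)
    qed
    show ?thesis
    proof (intro exI[of _ "[:1, - cnj a:] * q"] conjI allI impI)
      fix z assume z: "cmod z < 1"
      show "poly ([:1, - cnj a:] * q) z \<noteq> 0"
        unfolding eval using one_minus_cnj_neq_0[OF a(1), of z] z q(1) by auto
      show "cmod (poly p z) \<le> cmod (poly ([:1, - cnj a:] * q) z)"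
        unfolding eval norm_mult using le q(3) z by (intro mult_mono) auto
    next
      show "cmod (poly ([:1, - cnj a:] * q) (cis \<theta>)) = cmod (poly p (cis \<theta>))" for \<theta>
        unfolding eval norm_mult cmod_one_minus_cnj_cis q(2) by simp
    qed
  qed
qed

text \<open>
  After reflection of its roots the polynomial may still vanish on the circle itself. Its dilates
  \<open>q(rz)\<close> with \<open>r < 1\<close> have no zeros in a neighbourhood of the closed disc.
\<close>

lemma circle_power_mean_poly:
  fixes s :: real
  assumes s: "0 < s" and x: "cmod x < 1"
  shows "2 * pi * cmod (poly p x) powr s
    \<le> integral {0..2*pi} (\<lambda>\<theta>. cmod (poly p (cis \<theta>)) powr s * circle_kernel M x \<theta>)"
proof (cases "p = 0")
  case True
  then show ?thesis using s by simp
next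
  case False
  then obtain q where q: "\<And>z. cmod z < 1 \<Longrightarrow> poly q z \<noteq> 0"
      "\<And>\<theta>. cmod (poly q (cis \<theta>)) = cmod (poly p (cis \<theta>))"
      "\<And>z. cmod z < 1 \<Longrightarrow> cmod (poly p z) \<le> cmod (poly q z)"
    using poly_reflect_roots by metis
  (* The offset 2 keeps all factors strictly between 0 and 1. *)
  define r where "r n = complex_of_real (1 - 1 / (real n + 2))" for n
  have r: "0 < cmod (r n)" "cmod (r n) < 1" for n
    unfolding r_def norm_of_real by (auto simp: field_simps)
  have rlim: "r \<longlonglongrightarrow> 1"
  proof -
    have "(\<lambda>n. 1 - 1 / (real n + 2)) \<longlonglongrightarrow> 1" by real_asymp
    from tendsto_of_real[OF this, where 'a=complex] show ?thesis unfolding r_def by simp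
  qed
  have "compact ((poly q) ` cball 0 1)" by (intro compact_continuous_image continuous_intros) auto
  then obtain B where B: "\<And>z. z \<in> cball 0 1 \<Longrightarrow> cmod (poly q z) \<le> B"
    using bounded_iff compact_imp_bounded by (metis imageI)
  have "2 * pi * cmod (poly q x) powr s
    \<le> integral {0..2*pi} (\<lambda>\<theta>. cmod (poly q (cis \<theta>)) powr s * circle_kernel M x \<theta>)"
  proof (rule circle_power_mean_limit[OF s x, where g="\<lambda>n z. poly q (r n * z)"])
    fix n
    show "2 * pi * cmod (poly q (r n * x)) powr s
      \<le> integral {0..2*pi} (\<lambda>\<theta>. cmod (poly q (r n * cis \<theta>)) powr s * circle_kernel M x \<theta>)"
    proof (rule circle_power_mean_zero_free[where R="1 / cmod (r n)"])
      show "1 < 1 / cmod (r n)" using r[of n] by (auto simp: field_simps)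
      fix z :: complex assume "z \<in> ball 0 (1 / cmod (r n))"
      then show "poly q (r n * z) \<noteq> 0"
        using r[of n] by (intro q(1)) (auto simp: norm_mult field_simps)
    qed (use x in \<open>auto intro!: holomorphic_intros\<close>)
    show "cmod (poly q (r n * cis \<theta>)) \<le> B" for \<theta> using r[of n] by (intro B) (auto simp: norm_mult)
    show "continuous_on UNIV (\<lambda>\<theta>. poly q (r n * cis \<theta>))" by (intro continuous_intros)
  next
    have "(\<lambda>n. poly q (r n * z)) \<longlonglongrightarrow> poly q (1 * z)" for z
      by (intro tendsto_intros rlim)
    then show "(\<lambda>n. poly q (r n * cis \<theta>)) \<longlonglongrightarrow> poly q (cis \<theta>)" "(\<lambda>n. poly q (r n * x)) \<longlonglongrightarrow> poly q x" for \<theta>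
      by simp_all
  qed
  moreover have "cmod (poly p x) powr s \<le> cmod (poly q x) powr s"
    using q(3)[OF x] s by (intro powr_mono2) auto
  ultimately show ?thesis unfolding q(2) by (smt (verit, best) mult_left_mono pi_gt_zero)
qed

text \<open>
  The sub-mean value property of \<open>|g|\<^sup>s\<close> against kernels that for \<open>M > 1\<close> are far smaller than the
  Poisson kernel away from \<open>x\<close>. Subharmonicity of \<open>|g|\<^sup>s\<close> alone does not give this; it rests on the
  freedom to multiply \<open>g\<close> by a holomorphic factor.
\<close>

lemma circle_power_mean:
  fixes s :: real
  assumes g: "g holomorphic_on ball 0 R" "R > 1" and s: "0 < s" and x: "cmod x < 1"
  shows "2 * pi * cmod (g x) powr s
    \<le> integral {0..2*pi} (\<lambda>\<theta>. cmod (g (cis \<theta>)) powr s * circle_kernel M x \<theta>)"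
proof -
  define a where "a n = (deriv ^^ n) g 0 / fact n" for n
  have ser: "(\<lambda>n. a n * z ^ n) sums g z" if "cmod z < R" for z
    using holomorphic_power_series[OF g(1), of z] that unfolding a_def by simp
  define P where "P N = (\<Sum>n<N. monom (a n) n)" for N
  have P: "poly (P N) z = (\<Sum>n<N. a n * z ^ n)" for N z
    unfolding P_def by (simp add: poly_sum poly_monom)
  have lim: "(\<lambda>N. poly (P N) z) \<longlonglongrightarrow> g z" if "cmod z \<le> 1" for z
    using ser[of z] that g(2) unfolding P sums_def by auto
  (* Convergence at a radius beyond 1 makes the coefficients absolutely summable, hence a majorant. *)
  obtain R' where R': "1 < R'" "R' < R" using g(2) dense by blast
  have "summable (\<lambda>n. a n * of_real R' ^ n)" using ser[of "of_real R'"] R' sums_summable by auto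
  then have sum1: "summable (\<lambda>n. norm (a n * 1 ^ n))"
    by (rule powser_insidea) (use R' in auto)
  have bd: "cmod (poly (P N) (cis \<theta>)) \<le> (\<Sum>n. norm (a n))" for N \<theta>
  proof -
    have "cmod (poly (P N) (cis \<theta>)) \<le> (\<Sum>n<N. norm (a n))"
      unfolding P by (rule order_trans[OF norm_sum]) (simp add: norm_mult norm_power)
    also have "\<dots> \<le> (\<Sum>n. norm (a n))" using sum1 by (intro sum_le_suminf) auto
    finally show ?thesis .
  qed
  show ?thesis
    by (rule circle_power_mean_limit[OF s x, where g="\<lambda>n. poly (P n)" and B="\<Sum>n. norm (a n)"])
       (use bd lim x circle_power_mean_poly[OF s x] in \<open>auto intro!: continuous_intros\<close>)
qed

section \<open>Rotations and radial functions in area integrals\<close>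

text \<open>
  Orthogonal maps are known to preserve Lebesgue measure on \<open>real^'n\<close>; this identification brings
  that fact to the complex plane.
\<close>

lemma lborel_complex_eq_distr_vec2:
  "distr lborel borel (\<lambda>v::real^2. Complex (vec_nth v 1) (vec_nth v 2)) = lborel"
proof (rule lborel_eqI[symmetric])
  fix l u :: complex
  assume lu: "\<And>b. b \<in> Basis \<Longrightarrow> l \<bullet> b \<le> u \<bullet> b"
  have m[measurable]: "(\<lambda>v::real^2. Complex (vec_nth v 1) (vec_nth v 2)) \<in> borel \<rightarrow>\<^sub>M borel"
    unfolding Complex_eq by measurable
  define L U where "L = (vector [Re l, Im l] :: real^2)" "U = (vector [Re u, Im u] :: real^2)"
  have "(\<lambda>v::real^2. Complex (vec_nth v 1) (vec_nth v 2)) -` box l u = box L U"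
    by (auto simp: L_U_def box_def Basis_complex_def Basis_vec_def inner_axis exhaust_2 
       forall_2 inner_complex_def) 
  then have "emeasure (distr lborel borel (\<lambda>v::real^2. Complex (vec_nth v 1) (vec_nth v 2))) (box l u)
     = emeasure lborel (box L U)"
    by (simp add: emeasure_distr)
  also have "\<dots> = (\<Prod>b\<in>Basis. (u - l) \<bullet> b)"
    using lu[of 1] lu[of \<i>]
    by (simp add: emeasure_lborel_box_eq Basis_complex_def Basis_vec_def L_U_def inner_axis prod.reindex
         prod.UNION_disjoint axis_eq_axis UNIV_2 insert_commute)
  finally show "emeasure (distr lborel borel (\<lambda>v::real^2. Complex (vec_nth v 1) (vec_nth v 2))) (box l u)
     = (\<Prod>b\<in>Basis. (u - l) \<bullet> b)" .
qed simp


lemma lborel_complex_distr_rotate: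
  "distr lborel borel (\<lambda>z::complex. cis \<theta> * z) = lborel"
proof (rule lborel_eqI[symmetric])
  fix l u :: complex
  assume lu: "\<And>b. b \<in> Basis \<Longrightarrow> l \<bullet> b \<le> u \<bullet> b"
  define \<psi> where "\<psi> v = Complex (vec_nth v 1) (vec_nth v 2)" for v :: "real^2"
  define rot where "rot v = (vector [cos \<theta> * vec_nth v 1 + sin \<theta> * vec_nth v 2,
      cos \<theta> * vec_nth v 2 - sin \<theta> * vec_nth v 1] :: real^2)" for v :: "real^2"
  have psi_meas[measurable]: "\<psi> \<in> borel \<rightarrow>\<^sub>M borel"
    unfolding \<psi>_def Complex_eq by measurable
  have psi: "emeasure lborel A = emeasure lborel (\<psi> -` A)" if "A \<in> sets borel" for A
    using that emeasure_distr[of \<psi> lborel borel A] lborel_complex_eq_distr_vec2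
    unfolding \<psi>_def[symmetric] by simp
  have linrot: "linear rot"
    by (rule linearI) (auto simp: rot_def vec_eq_iff forall_2 algebra_simps)
  have "rot v \<bullet> rot w = v \<bullet> w" for v w
  proof -
    have "rot v \<bullet> rot w = ((sin \<theta>)\<^sup>2 + (cos \<theta>)\<^sup>2) * (v \<bullet> w)"
      unfolding rot_def inner_vec_def sum_2
      by (simp add: algebra_simps power2_eq_square del: sin_cos_squared_add sin_cos_squared_add2 sin_cos_squared_add3)
    then show ?thesis by simp
  qed
  then have orth: "orthogonal_transformation rot"
    unfolding orthogonal_transformation_def using linrot by blast
  have rot: "cis \<theta> * \<psi> (rot v) = \<psi> v" for v
  proof -
    have "cos \<theta> * (cos \<theta> * a) + sin \<theta> * (sin \<theta> * a) = a" for a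
    proof -
      have "cos \<theta> * (cos \<theta> * a) + sin \<theta> * (sin \<theta> * a) = ((sin \<theta>)\<^sup>2 + (cos \<theta>)\<^sup>2) * a"
        by (simp add: algebra_simps power2_eq_square del: sin_cos_squared_add sin_cos_squared_add2 sin_cos_squared_add3)
      then show ?thesis by simp
    qed
    from this[of "vec_nth v 1"] this[of "vec_nth v 2"] show ?thesis
      unfolding \<psi>_def rot_def complex_eq_iff by (simp add: algebra_simps)
  qed
  have boxR: "(\<lambda>z. cis \<theta> * z) -` box l u \<in> sets borel"
    using measurable_sets[of "\<lambda>z::complex. cis \<theta> * z" borel borel "box l u"] by simp
  have preimage: "\<psi> -` ((\<lambda>z. cis \<theta> * z) -` box l u) = rot ` (\<psi> -` box l u)"
  proof (intro set_eqI iffI)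
    fix v assume v: "v \<in> \<psi> -` ((\<lambda>z. cis \<theta> * z) -` box l u)"
    obtain w where "v = rot w"
      using orthogonal_transformation_surj[OF orth] by blast
    with v rot show "v \<in> rot ` (\<psi> -` box l u)" by auto
  qed (auto simp: rot)
  have "emeasure lborel (rot ` (\<psi> -` box l u)) = emeasure lborel (\<psi> -` box l u)"
  proof -
    have B: "\<psi> -` box l u \<in> sets lborel"
      using measurable_sets[OF psi_meas, of "box l u"] by simp
    have "emeasure lborel (\<psi> -` box l u) < \<infinity>"
      using psi[of "box l u"] by (metis borel_open emeasure_lborel_box_finite open_box)
    then have L: "\<psi> -` box l u \<in> lmeasurable"
      using B by (intro fmeasurableI) auto
    have "rot ` (\<psi> -` box l u) \<in> sets lborel"
      unfolding preimage[symmetric] using measurable_sets[OF psi_meas, of "(\<lambda>z. cis \<theta> * z) -` box l u"] boxR by simp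
    then have "emeasure lborel (rot ` (\<psi> -` box l u)) = emeasure lebesgue (rot ` (\<psi> -` box l u))"
      by simp
    also have "\<dots> = emeasure lebesgue (\<psi> -` box l u)"
      using measure_orthogonal_image[OF orth L] measurable_orthogonal_image[OF orth L] L
      by (simp add: emeasure_eq_measure2)
    finally show ?thesis using B by simp
  qed
  then have "emeasure lborel ((\<lambda>z. cis \<theta> * z) -` box l u) = emeasure lborel (box l u)"
    using psi[OF boxR] preimage psi[of "box l u"] by simp
  then show "emeasure (distr lborel borel (\<lambda>z. cis \<theta> * z)) (box l u) = (\<Prod>b\<in>Basis. (u - l) \<bullet> b)"
    using lu by (simp add: emeasure_distr emeasure_lborel_box_eq)
qed simp

text \<open>
  Polar coordinates for radial integrands. Comparing the two measures on half-lines takes nothing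
  but the area of a disc.
\<close>

lemma distr_cmod_unit_disc:
  "distr (density lborel (indicator (ball (0::complex) 1))) borel cmod
    = density lborel (\<lambda>r. ennreal (2 * pi * r) * indicator {0..<1} r)"
proof (rule measure_eqI_lessThan)
  define M where "M = distr (density lborel (indicator (ball (0::complex) 1))) borel cmod"
  define N where "N = density lborel (\<lambda>r::real. ennreal (2 * pi * r) * indicator {0..<1} r)"
  have vol: "emeasure lborel (cball (0::complex) x) = ennreal (pi * x\<^sup>2)" "emeasure lborel (ball (0::complex) x) = ennreal (pi * x\<^sup>2)"
    if "0 \<le> x" for x
    using emeasure_ball[of x "0::complex"] emeasure_cball[of x "0::complex"] that by (simp_all add: unit_ball_vol_2)
  have M: "emeasure M {x<..} = emeasure lborel (ball (0::complex) 1 - {z. cmod z \<le> x})" for x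
  proof -
    have "emeasure M {x<..} = emeasure (density lborel (indicator (ball (0::complex) 1))) (cmod -` {x<..})"
      unfolding M_def by (subst emeasure_distr) auto
    also have "\<dots> = (\<integral>\<^sup>+z. indicator (ball (0::complex) 1 - {z. cmod z \<le> x}) z \<partial>lborel)"
    proof (subst emeasure_density)
      show "(\<integral>\<^sup>+z. indicator (ball (0::complex) 1) z * indicator (cmod -` {x<..}) z \<partial>lborel)
          = (\<integral>\<^sup>+z. indicator (ball (0::complex) 1 - {z. cmod z \<le> x}) z \<partial>lborel)"
        by (rule nn_integral_cong) (auto simp: indicator_def)
    qed (use measurable_sets[of cmod borel borel "{x<..}"] in \<open>auto intro!: borel_measurable_indicator\<close>)
    also have "\<dots> = emeasure lborel (ball (0::complex) 1 - {z. cmod z \<le> x})"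
      by (rule nn_integral_indicator) measurable
    finally show ?thesis .
  qed
  have N: "emeasure N {x<..} = (\<integral>\<^sup>+r. ennreal (2 * pi * r) * indicator {max 0 x..1} r \<partial>lborel)" for x
  proof -
    have "AE r in lborel. r \<noteq> x \<and> r \<noteq> 1" by (simp add: AE_lborel_singleton)
    then have "AE r in lborel. ennreal (2 * pi * r) * indicator {0..<1} r * indicator {x<..} r
        = ennreal (2 * pi * r) * indicator {max 0 x..1} r"
      by eventually_elim (auto simp: indicator_def max_def)
    then show ?thesis
      unfolding N_def by (subst emeasure_density) (auto intro!: nn_integral_cong_AE)
  qed
  have N1: "emeasure N {x<..} = ennreal (pi - pi * (max 0 x)\<^sup>2)" if "x \<le> 1" for x
    unfolding N using that
    by (subst nn_integral_FTC_Icc[where F="\<lambda>r. pi * r\<^sup>2"]) (auto intro!: derivative_eq_intros)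
  have N2: "emeasure N {x<..} = 0" if "x > 1" for x
    unfolding N using that by (simp add: indicator_def)
  have M1: "emeasure M {x<..} = ennreal (pi - pi * (max 0 x)\<^sup>2)" if "x \<le> 1" for x
  proof (cases "x < 1")
    case True
    have "emeasure M {x<..} = emeasure lborel (ball (0::complex) 1 - cball 0 (max 0 x))"
    proof (cases "0 \<le> x")
      case True
      then have "{z. cmod z \<le> x} = cball 0 (max 0 x)" by auto
      then show ?thesis unfolding M by simp
    next
      case False
      then have e: "{z::complex. cmod z \<le> x} = {}" using norm_ge_zero order_trans by (auto simp: not_le)  (smt (verit, best) norm_ge_zero)
      show ?thesis unfolding M e using False by (subst emeasure_Diff_null_set) (auto simp: max_def)
    qed
    also have "\<dots> = ennreal (pi - pi * (max 0 x)\<^sup>2)"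
      using True by (subst emeasure_Diff) (auto simp: vol ennreal_minus)
    finally show ?thesis .
  next
    case False
    then have "x = 1" using that by simp
    moreover have e: "ball (0::complex) 1 - {z. cmod z \<le> 1} = {}" by auto
    ultimately show ?thesis unfolding M by (simp only: e) simp
  qed
  have M2: "emeasure M {x<..} = 0" if "x > 1" for x
  proof -
    have e: "ball (0::complex) 1 - {z. cmod z \<le> x} = {}" using that by auto
    show ?thesis unfolding M e by simp
  qed
  show "emeasure (distr (density lborel (indicator (ball (0::complex) 1))) borel cmod) {x<..}
     = emeasure (density lborel (\<lambda>r. ennreal (2 * pi * r) * indicator {0..<1} r)) {x<..}" for x
    using M1[of x] M2[of x] N1[of x] N2[of x] unfolding M_def N_def by (cases "x \<le> 1") auto
  show "emeasure (distr (density lborel (indicator (ball (0::complex) 1))) borel cmod) {x<..} < \<infinity>" for x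
    using M1[of x] M2[of x] unfolding M_def by (cases "x \<le> 1") auto
qed auto

lemma nn_integral_radial_unit_disc:
  assumes [measurable]: "F \<in> borel_measurable borel"
  shows "(\<integral>\<^sup>+z. F (cmod z) * indicator (ball 0 1) z \<partial>lborel)
    = (\<integral>\<^sup>+r. F r * ennreal (2 * pi * r) * indicator {0..<1} r \<partial>lborel)"
proof -
  have "(\<integral>\<^sup>+r. F r \<partial>distr (density lborel (indicator (ball (0::complex) 1))) borel cmod)
     = (\<integral>\<^sup>+z. F (cmod z) * indicator (ball 0 1) z \<partial>lborel)"
    by (subst nn_integral_distr) (auto simp: nn_integral_density borel_measurable_indicator mult_ac)
  moreover have "(\<integral>\<^sup>+r. F r \<partial>density lborel (\<lambda>r. ennreal (2 * pi * r) * indicator {0..<1} r))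
     = (\<integral>\<^sup>+r. F r * ennreal (2 * pi * r) * indicator {0..<1} r \<partial>lborel)"
    by (subst nn_integral_density) (auto simp: mult_ac)
  ultimately show ?thesis unfolding distr_cmod_unit_disc by simp
qed

section \<open>Geometry of Carleson squares\<close>

lemma borel_measurable_cis[measurable]: "cis \<in> borel_measurable borel"
  by (intro borel_measurable_continuous_onI continuous_intros)

lemma one_minus_cos_le: "1 - cos x \<le> x\<^sup>2 / 2" for x :: real
proof -
  have "1 - cos x = 2 * (sin (x / 2))\<^sup>2" using cos_double_sin[of "x / 2"] by simp
  also have "(sin (x / 2))\<^sup>2 \<le> (x / 2)\<^sup>2"
    using abs_sin_x_le_abs_x[of "x / 2"] unfolding abs_le_square_iff .
  finally show ?thesis by (simp add: power2_eq_square)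
qed

lemma one_minus_cos_ge: "x\<^sup>2 / 8 \<le> 1 - cos x" if "0 \<le> x" "x \<le> 1" for x :: real
proof -
  define y where "y = x / 2"
  have y: "0 \<le> y" "y \<le> 1" using that unfolding y_def by auto
  have "sin 0 - 0 / 2 \<le> sin y - y / 2"
  proof (rule DERIV_nonneg_imp_nondecreasing[OF y(1)])
    fix t assume t: "0 \<le> t" "t \<le> y"
    have "cos (pi / 3) \<le> cos t" using t y pi_gt3 by (subst cos_mono_le_eq) auto
    then show "\<exists>D. ((\<lambda>t. sin t - t / 2) has_real_derivative D) (at t) \<and> 0 \<le> D"
      by (intro exI[of _ "cos t - 1 / 2"]) (auto intro!: derivative_eq_intros simp: cos_60)
  qed
  then have "(y / 2)\<^sup>2 \<le> (sin y)\<^sup>2" using y by (intro power_mono) auto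
  moreover have "1 - cos x = 2 * (sin y)\<^sup>2" unfolding y_def using cos_double_sin[of "x / 2"] by simp
  ultimately show ?thesis unfolding y_def by (simp add: power2_eq_square)
qed

text \<open>
  A description without polar coordinates, from which measurability, also jointly with the rotation
  angle, can be read off. The arc \<open>|Arg w| \<le> h\<close> is the sector \<open>|w| cos h \<le> Re w\<close>.
\<close>

lemma carleson_square_iff:
  assumes a: "a \<noteq> 0" "cmod a < 1"
  shows "\<xi> \<in> carleson_square a \<longleftrightarrow> cmod a \<le> cmod \<xi> \<and> cmod \<xi> < 1 \<and>
    cmod a * cmod \<xi> * cos ((1 - cmod a) / 2) \<le> Re (a * cnj \<xi>)"
proof -
  define h where "h = (1 - cmod a) / 2"
  have h: "0 < h" "h < 1" using a unfolding h_def by (simp, insert norm_ge_zero[of a], argo)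
  have Arg_iff: "\<bar>Arg w\<bar> \<le> h \<longleftrightarrow> cmod w * cos h \<le> Re w" if w: "w \<noteq> 0" for w
  proof -
    have "Re w = cmod w * cos (Arg w)" using cos_Arg[OF w] w by simp
    then have "cmod w * cos h \<le> Re w \<longleftrightarrow> cos h \<le> cos \<bar>Arg w\<bar>" using w by simp
    also have "\<dots> \<longleftrightarrow> \<bar>Arg w\<bar> \<le> h"
      using cos_mono_le_eq[of h "\<bar>Arg w\<bar>"] h pi_gt3 Arg_bounded[of w] by (simp add: abs_le_iff)
    finally show ?thesis by simp
  qed
  have sc: "\<bar>Arg (a * cnj \<xi>)\<bar> \<le> h \<longleftrightarrow> cmod a * cmod \<xi> * cos h \<le> Re (a * cnj \<xi>)" if "\<xi> \<noteq> 0" for \<xi>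
    using Arg_iff[of "a * cnj \<xi>"] that a by (simp add: norm_mult)
  have arc: "cis t \<in> carleson_arc a \<longleftrightarrow> \<bar>Arg (a * cnj (cis t))\<bar> \<le> h" for t
  proof -
    have "cis t = cis \<theta> \<Longrightarrow> a * cis (- \<theta>) = a * cnj (cis t)" for \<theta>
      by (simp add: cis_cnj)
    then show ?thesis unfolding carleson_arc_def h_def by (smt (verit, best) mem_Collect_eq)
  qed
  show ?thesis
  proof
    assume "\<xi> \<in> carleson_square a"
    then obtain r t where r: "\<xi> = of_real r * cis t" "cmod \<xi> < 1" "cmod a \<le> r" "cis t \<in> carleson_arc a"
      unfolding carleson_square_def by auto
    have r0: "0 < r" using r(3) a by (meson less_le_trans zero_less_norm_iff)
    have "Arg (a * cnj \<xi>) = Arg (of_real r * (a * cnj (cis t)))"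
      unfolding r(1) by (simp add: mult_ac)
    then have "Arg (a * cnj \<xi>) = Arg (a * cnj (cis t))" using r0 by (simp add: Arg_times_of_real)
    with r r0 arc sc[of \<xi>] show "cmod a \<le> cmod \<xi> \<and> cmod \<xi> < 1 \<and>
      cmod a * cmod \<xi> * cos ((1 - cmod a) / 2) \<le> Re (a * cnj \<xi>)"
      unfolding h_def by (auto simp: norm_mult)
  next
    assume *: "cmod a \<le> cmod \<xi> \<and> cmod \<xi> < 1 \<and>
      cmod a * cmod \<xi> * cos ((1 - cmod a) / 2) \<le> Re (a * cnj \<xi>)"
    then have "\<xi> \<noteq> 0" using a by auto
    then have polar: "\<xi> = of_real (cmod \<xi>) * cis (Arg \<xi>)" by (metis rcis_cmod_Arg rcis_def)
    have "a * cnj \<xi> = of_real (cmod \<xi>) * (a * cnj (cis (Arg \<xi>)))"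
      using arg_cong[OF polar, of "\<lambda>x. a * cnj x"] by (simp add: mult_ac)
    then have "Arg (a * cnj \<xi>) = Arg (of_real (cmod \<xi>) * (a * cnj (cis (Arg \<xi>))))"
      by (rule arg_cong)
    also have "\<dots> = Arg (a * cnj (cis (Arg \<xi>)))"
      using \<open>\<xi> \<noteq> 0\<close> by (simp add: Arg_times_of_real)
    finally have "cis (Arg \<xi>) \<in> carleson_arc a"
      unfolding arc using * sc[OF \<open>\<xi> \<noteq> 0\<close>] by (simp add: h_def)
    then show "\<xi> \<in> carleson_square a"
      unfolding carleson_square_def mem_Collect_eq using *
      by (intro exI[of _ "cmod \<xi>"] exI[of _ "Arg \<xi>"]) (simp flip: polar)
  qed
qed

text \<open>
  Carleson squares are indexed by their height \<open>h\<close> and the angle \<open>\<phi>\<close> of their base point, so that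
  one can integrate over \<open>\<phi>\<close> with \<open>h\<close> fixed.
\<close>

definition box_pt :: "real \<Rightarrow> real \<Rightarrow> complex" where
  "box_pt h \<phi> = of_real (1 - h) * cis \<phi>"

abbreviation carleson_box :: "real \<Rightarrow> real \<Rightarrow> complex set" where
  "carleson_box h \<phi> \<equiv> carleson_square (box_pt h \<phi>)"

lemma cmod_box_pt: "h \<le> 1 \<Longrightarrow> cmod (box_pt h \<phi>) = 1 - h"
  unfolding box_pt_def norm_mult norm_of_real by simp

lemma box_pt_in: "0 < h \<Longrightarrow> h < 1 \<Longrightarrow> box_pt h \<phi> \<in> unit_disc - {0}"
  using cmod_box_pt[of h \<phi>] norm_eq_zero[of "box_pt h \<phi>"] by simp

lemma box_pt_cases:
  assumes "a \<in> unit_disc - {0}"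
  obtains \<phi> where "a = box_pt (1 - cmod a) \<phi>" "-pi < \<phi>" "\<phi> \<le> pi"
proof
  show "a = box_pt (1 - cmod a) (Arg a)"
    unfolding box_pt_def by (metis rcis_cmod_Arg rcis_def diff_diff_eq2 add_diff_cancel_left')
  show "-pi < Arg a" "Arg a \<le> pi" using Arg_bounded by auto
qed

lemma carleson_box_iff:
  assumes "0 < h" "h < 1"
  shows "\<xi> \<in> carleson_box h \<phi> \<longleftrightarrow> 1 - h \<le> cmod \<xi> \<and> cmod \<xi> < 1 \<and>
    cmod \<xi> * cos (h / 2) \<le> Re (cis \<phi> * cnj \<xi>)"
proof -
  have "Re (box_pt h \<phi> * cnj \<xi>) = (1 - h) * Re (cis \<phi> * cnj \<xi>)"
    unfolding box_pt_def by (simp add: algebra_simps)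
  then have "(1 - h) * cmod \<xi> * cos (h / 2) \<le> Re (box_pt h \<phi> * cnj \<xi>)
      \<longleftrightarrow> cmod \<xi> * cos (h / 2) \<le> Re (cis \<phi> * cnj \<xi>)"
    using assms by (simp only: mult.assoc mult_le_cancel_left_pos[of "1 - h"] diff_gt_0_iff_gt)
  then show ?thesis
    using carleson_square_iff[of "box_pt h \<phi>" \<xi>] box_pt_in[OF assms, of \<phi>] cmod_box_pt[of h \<phi>] assms
    by auto
qed

lemma carleson_box_polar:
  assumes "0 < h" "h < 1" "0 < r"
  shows "of_real r * cis \<psi> \<in> carleson_box h \<phi> \<longleftrightarrow> 1 - h \<le> r \<and> r < 1 \<and> cos (h / 2) \<le> cos (\<phi> - \<psi>)"
proof -
  have "Re (cis \<phi> * cnj (of_real r * cis \<psi>)) = r * cos (\<phi> - \<psi>)"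
    by (simp add: cos_diff algebra_simps)
  then show ?thesis
    using assms by (simp add: carleson_box_iff norm_mult)
qed

lemma carleson_box_mono:
  assumes "0 < t" "t \<le> h" "h < 1"
  shows "carleson_box t \<phi> \<subseteq> carleson_box h \<phi>"
proof
  fix \<xi> assume "\<xi> \<in> carleson_box t \<phi>"
  moreover have "cos (h / 2) \<le> cos (t / 2)"
    using assms pi_gt3 by (subst cos_mono_le_eq) auto
  then have "cmod \<xi> * cos (h / 2) \<le> cmod \<xi> * cos (t / 2)" by (intro mult_left_mono) auto
  ultimately show "\<xi> \<in> carleson_box h \<phi>"
    using assms by (auto simp: carleson_box_iff)
qed

text \<open>
  The law of cosines, separating the radial part of a distance from its angular part.
\<close>

lemma cmod_diff_power2:
  "(cmod (z - w))\<^sup>2 = (cmod z - cmod w)\<^sup>2 + 2 * (cmod z * cmod w - Re (w * cnj z))"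
proof -
  have "cmod z * cmod z = (cmod z)\<^sup>2" "cmod w * cmod w = (cmod w)\<^sup>2" by (simp_all add: power2_eq_square)
  then have "(cmod z - cmod w)\<^sup>2 = (cmod z)\<^sup>2 + (cmod w)\<^sup>2 - 2 * cmod z * cmod w"
    by (simp add: power2_diff)
  then show ?thesis
    by (simp add: cmod_power2) (simp add: algebra_simps power2_eq_square)
qed

text \<open>
  A square of height \<open>h\<close> has diameter of order \<open>h\<close>, so that the kernel \<open>kap z\<close> is nearly constant on
  it as soon as \<open>z\<close> is no closer to the boundary than its base point.
\<close>

lemma carleson_box_dist:
  assumes "0 < h" "h < 1" "\<xi> \<in> carleson_box h \<phi>"
  shows "cmod (\<xi> - box_pt h \<phi>) \<le> 2 * h"
proof -
  have \<xi>: "1 - h \<le> cmod \<xi>" "cmod \<xi> < 1" "cmod \<xi> * cos (h / 2) \<le> Re (cis \<phi> * cnj \<xi>)"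
    using assms carleson_box_iff by auto
  have b: "cmod (box_pt h \<phi>) = 1 - h" using assms cmod_box_pt by simp
  have "Re (box_pt h \<phi> * cnj \<xi>) = (1 - h) * Re (cis \<phi> * cnj \<xi>)"
    unfolding box_pt_def by (simp add: algebra_simps)
  also have "\<dots> \<ge> (1 - h) * (cmod \<xi> * cos (h / 2))" using \<xi> assms by (intro mult_left_mono) auto
  finally have "cmod \<xi> * (1 - h) - Re (box_pt h \<phi> * cnj \<xi>) \<le> (1 - h) * cmod \<xi> * (1 - cos (h / 2))"
    by (simp add: algebra_simps)
  also have "\<dots> \<le> 1 * (1 - cos (h / 2))"
    using \<xi> assms by (intro mult_right_mono mult_le_one) auto
  also have "\<dots> \<le> (h / 2)\<^sup>2 / 2"
    using one_minus_cos_le[of "h/2"] by simp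
  finally have "(cmod (\<xi> - box_pt h \<phi>))\<^sup>2 \<le> (cmod \<xi> - (1 - h))\<^sup>2 + (h / 2)\<^sup>2"
    unfolding cmod_diff_power2 b by simp
  also have "(cmod \<xi> - (1 - h))\<^sup>2 \<le> h\<^sup>2" using \<xi> assms by (intro power_mono) auto
  finally have "(cmod (\<xi> - box_pt h \<phi>))\<^sup>2 \<le> 5/4 * h\<^sup>2" by (simp add: power_divide)
  also have "\<dots> \<le> (2 * h)\<^sup>2" by (simp add: power_mult_distrib)
  finally have "(cmod (\<xi> - box_pt h \<phi>))\<^sup>2 \<le> (2 * h)\<^sup>2" .
  then show ?thesis using assms power2_le_imp_le[of "cmod (\<xi> - box_pt h \<phi>)" "2 * h"] by simp
qed

text \<open>
  Transfers the doubling of Carleson squares to balls centred at base points.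
\<close>

lemma ball_subset_carleson_box:
  assumes "0 < t" "t \<le> r" "8 * r < 1" "cmod \<xi> < 1" "cmod (\<xi> - box_pt t \<phi>) \<le> r"
  shows "\<xi> \<in> carleson_box (8 * r) \<phi>"
proof -
  have b: "cmod (box_pt t \<phi>) = 1 - t" using assms cmod_box_pt by simp
  have x: "1 - t - r \<le> cmod \<xi>"
    using assms(5) b norm_triangle_ineq3[of \<xi> "box_pt t \<phi>"] by simp
  have "cmod \<xi> * cos (8 * r / 2) \<le> Re (cis \<phi> * cnj \<xi>)"
  proof (rule ccontr)
    assume "\<not> ?thesis"
    then have less: "Re (cis \<phi> * cnj \<xi>) < cmod \<xi> * cos (4 * r)" by simp
    have c: "2 * r\<^sup>2 \<le> 1 - cos (4 * r)" using one_minus_cos_ge[of "4 * r"] assms by simp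
    have "Re (box_pt t \<phi> * cnj \<xi>) = (1 - t) * Re (cis \<phi> * cnj \<xi>)"
      unfolding box_pt_def by (simp add: algebra_simps)
    also have "\<dots> < (1 - t) * (cmod \<xi> * cos (4 * r))"
      using less assms by (intro mult_strict_left_mono) auto
    finally have "(1 - t) * cmod \<xi> * (1 - cos (4 * r)) < cmod \<xi> * (1 - t) - Re (box_pt t \<phi> * cnj \<xi>)"
      by (simp add: algebra_simps)
    moreover have "7/8 * (6/8) * (2 * r\<^sup>2) \<le> (1 - t) * cmod \<xi> * (1 - cos (4 * r))"
      using assms x c by (intro mult_mono) auto
    ultimately have "2 * (7/8 * (6/8) * (2 * r\<^sup>2)) < (cmod (\<xi> - box_pt t \<phi>))\<^sup>2"
      unfolding cmod_diff_power2 b using zero_le_power2[of "cmod \<xi> - (1 - t)"] by argo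
    also have "\<dots> \<le> r\<^sup>2" using assms by (intro power_mono) auto
    finally have "21/8 * r\<^sup>2 < r\<^sup>2" by simp
    then show False using zero_le_power2[of r] by argo
  qed
  then show ?thesis using assms x by (subst carleson_box_iff) auto
qed

lemma cos_ge_cos_3pi:
  assumes "0 < h" "h < pi" "\<bar>x\<bar> \<le> 3 * pi" "cos h \<le> cos x"
  shows "\<bar>x\<bar> \<le> h \<or> \<bar>x - 2 * pi\<bar> \<le> h \<or> \<bar>x + 2 * pi\<bar> \<le> h"
proof -
  have base: "\<bar>y\<bar> \<le> h" if "\<bar>y\<bar> \<le> pi" "cos h \<le> cos y" for y
    using that cos_mono_le_eq[of h "\<bar>y\<bar>"] assms by simp
  consider "\<bar>x\<bar> \<le> pi" | "pi < x" | "x < - pi" by linarith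
  then show ?thesis
  proof cases
    case 2
    then have "\<bar>x - 2 * pi\<bar> \<le> pi" using assms by (simp add: abs_le_iff)
    then show ?thesis using base[of "x - 2 * pi"] assms by (simp add: cos_diff)
  next
    case 3
    then have "\<bar>x + 2 * pi\<bar> \<le> pi" using assms by (simp add: abs_le_iff)
    then show ?thesis using base[of "x + 2 * pi"] assms by simp
  qed (use base assms in auto)
qed

lemma carleson_box_measurable_pair:
  assumes "0 < h" "h < 1"
  shows "(\<lambda>(\<phi>, \<xi>). indicator (carleson_box h \<phi>) \<xi> :: ennreal) \<in> borel_measurable (borel \<Otimes>\<^sub>M borel)"
proof -
  have "(\<lambda>(\<phi>, \<xi>). indicator (carleson_box h \<phi>) \<xi> :: ennreal)
    = (\<lambda>x. if 1 - h \<le> cmod (snd x) \<and> cmod (snd x) < 1 \<and>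
      cmod (snd x) * cos (h / 2) \<le> Re (cis (fst x)) * Re (snd x) + Im (cis (fst x)) * Im (snd x) then 1 else 0)"
    using carleson_box_iff[OF assms] by (auto simp: indicator_def fun_eq_iff)
  also have "\<dots> \<in> borel_measurable (borel \<Otimes>\<^sub>M borel)" by measurable
  finally show ?thesis .
qed

lemma carleson_box_borel[measurable]:
  assumes "0 < h" "h < 1"
  shows "carleson_box h \<phi> \<in> sets borel"
proof -
  have "carleson_box h \<phi> = {\<xi> \<in> space borel. 1 - h \<le> cmod \<xi> \<and> cmod \<xi> < 1 \<and>
    cmod \<xi> * cos (h / 2) \<le> cos \<phi> * Re \<xi> + sin \<phi> * Im \<xi>}"
    using carleson_box_iff[OF assms] by auto
  also have "\<dots> \<in> sets borel" by measurable
  finally show ?thesis .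
qed

lemma carleson_square_borel:
  assumes "a \<in> unit_disc - {0}"
  shows "carleson_square a \<in> sets borel"
proof -
  obtain \<phi> where \<phi>: "a = box_pt (1 - cmod a) \<phi>" using box_pt_cases[OF assms] by blast
  show ?thesis using carleson_box_borel[of "1 - cmod a" \<phi>] assms unfolding \<phi>[symmetric] by simp
qed

text \<open>
  Two periods rather than one: for a point with argument \<open>\<psi> \<in> (-\<pi>, \<pi>]\<close> the whole interval of angles
  around \<open>\<psi>\<close> then lies inside, without wrapping around. The price is a factor of at most \<open>3\<close>.
\<close>

abbreviation angles :: "real set" where "angles \<equiv> {-(2 * pi)..2 * pi}"

text \<open>
  A point \<open>\<xi>\<close> with \<open>1 - h \<le> |\<xi>|\<close> lies in the rotated square exactly for the \<open>\<phi>\<close> within \<open>h/2\<close> of its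
  argument modulo \<open>2\<pi>\<close>. The interval around the argument itself gives the lower bound, and its two
  translates by \<open>\<plusminus>2\<pi>\<close> account for the upper one.
\<close>

lemma carleson_box_angle_length:
  assumes h: "0 < h" "h < 1" and \<xi>: "1 - h \<le> cmod \<xi>" "cmod \<xi> < 1"
  shows "ennreal h \<le> (\<integral>\<^sup>+\<phi>\<in>angles. indicator (carleson_box h \<phi>) \<xi> \<partial>lborel)"
    and "(\<integral>\<^sup>+\<phi>\<in>angles. indicator (carleson_box h \<phi>) \<xi> \<partial>lborel) \<le> ennreal (3 * h)"
proof -
  define \<psi> where "\<psi> = Arg \<xi>"
  have "\<xi> \<noteq> 0" using h \<xi> by auto
  then have polar: "\<xi> = of_real (cmod \<xi>) * cis \<psi>" unfolding \<psi>_def by (metis rcis_cmod_Arg rcis_def)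
  have \<psi>: "-pi < \<psi>" "\<psi> \<le> pi" unfolding \<psi>_def using Arg_bounded by auto
  have iff: "\<xi> \<in> carleson_box h \<phi> \<longleftrightarrow> cos (h / 2) \<le> cos (\<phi> - \<psi>)" for \<phi>
    using carleson_box_polar[OF h, of "cmod \<xi>" \<psi> \<phi>] \<xi> \<open>\<xi> \<noteq> 0\<close> unfolding polar[symmetric] by simp
  define I where "I c = {c - h/2..c + h/2}" for c :: real
  have eI: "(\<integral>\<^sup>+\<phi>. indicator (I c) \<phi> \<partial>lborel) = ennreal h" for c
    unfolding I_def using h by simp
  have "indicator (I \<psi>) \<phi> \<le> indicator (carleson_box h \<phi>) \<xi> * (indicator angles \<phi> :: ennreal)" for \<phi>
  proof (cases "\<phi> \<in> I \<psi>")
    case True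
    then have 1: "\<bar>\<phi> - \<psi>\<bar> \<le> h / 2" unfolding I_def abs_le_iff by auto
    then have "cos (h / 2) \<le> cos \<bar>\<phi> - \<psi>\<bar>" using h pi_gt3 by (subst cos_mono_le_eq) auto
    moreover have "\<phi> \<in> angles" using abs_le_D1[OF 1] abs_le_D2[OF 1] \<psi> h pi_gt3 by simp
    ultimately show ?thesis using iff by (simp add: indicator_def)
  qed auto
  then have "(\<integral>\<^sup>+\<phi>. indicator (I \<psi>) \<phi> \<partial>lborel) \<le> (\<integral>\<^sup>+\<phi>\<in>angles. indicator (carleson_box h \<phi>) \<xi> \<partial>lborel)"
    by (intro nn_integral_mono)
  then show "ennreal h \<le> (\<integral>\<^sup>+\<phi>\<in>angles. indicator (carleson_box h \<phi>) \<xi> \<partial>lborel)" using eI by simp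
  have "indicator (carleson_box h \<phi>) \<xi> * (indicator angles \<phi> :: ennreal)
     \<le> indicator (I \<psi>) \<phi> + indicator (I (\<psi> + 2 * pi)) \<phi> + indicator (I (\<psi> - 2 * pi)) \<phi>" for \<phi>
  proof (cases "\<xi> \<in> carleson_box h \<phi> \<and> \<phi> \<in> angles")
    case True
    then have "\<bar>\<phi> - \<psi>\<bar> \<le> 3 * pi" using \<psi> by (auto simp: abs_le_iff)
    then have "\<bar>\<phi> - \<psi>\<bar> \<le> h/2 \<or> \<bar>\<phi> - \<psi> - 2 * pi\<bar> \<le> h/2 \<or> \<bar>\<phi> - \<psi> + 2 * pi\<bar> \<le> h/2"
      using True iff h pi_gt3 by (intro cos_ge_cos_3pi) auto
    moreover have "x \<in> I c \<longleftrightarrow> \<bar>x - c\<bar> \<le> h / 2" for x c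
      unfolding I_def abs_le_iff by auto
    ultimately have "\<phi> \<in> I \<psi> \<or> \<phi> \<in> I (\<psi> + 2 * pi) \<or> \<phi> \<in> I (\<psi> - 2 * pi)"
      by (simp add: algebra_simps)
    then show ?thesis using True by (auto simp: indicator_def)
  qed auto
  then have "(\<integral>\<^sup>+\<phi>\<in>angles. indicator (carleson_box h \<phi>) \<xi> \<partial>lborel)
     \<le> (\<integral>\<^sup>+\<phi>. indicator (I \<psi>) \<phi> + indicator (I (\<psi> + 2 * pi)) \<phi> + indicator (I (\<psi> - 2 * pi)) \<phi> \<partial>lborel)"
    by (intro nn_integral_mono)
  also have "\<dots> = ennreal h + ennreal h + ennreal h"
  proof -
    have [measurable]: "I c \<in> sets borel" for c unfolding I_def by simp
    have "(\<lambda>\<phi>. indicator (I c) \<phi> :: ennreal) \<in> borel_measurable lborel" for c by measurable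
    then show ?thesis by (subst nn_integral_add, measurable)+ (simp only: eI)
  qed
  also have "\<dots> = ennreal (3 * h)" using h by (simp flip: ennreal_plus)
  finally show "(\<integral>\<^sup>+\<phi>\<in>angles. indicator (carleson_box h \<phi>) \<xi> \<partial>lborel) \<le> ennreal (3 * h)" .
qed

section \<open>Averaging over rotated squares\<close>

text \<open>
  Tonelli: integrating an average over rotated squares recovers the integral over the strip, up to
  constants. In this form local estimates on single squares are summed to estimates on strips and
  annuli.
\<close>

lemma carleson_box_average:
  assumes M: "finite_measure M" "sets M = sets borel"
    and F[measurable]: "F \<in> borel_measurable borel"
    and h: "0 < h" "h < 1"
  shows "ennreal h * (\<integral>\<^sup>+\<xi>\<in>{\<xi>. 1 - h \<le> cmod \<xi> \<and> cmod \<xi> < 1}. F \<xi> \<partial>M)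
      \<le> (\<integral>\<^sup>+\<phi>\<in>angles. (\<integral>\<^sup>+\<xi>\<in>carleson_box h \<phi>. F \<xi> \<partial>M) \<partial>lborel)" (is "?L \<le> ?I")
    and "(\<integral>\<^sup>+\<phi>\<in>angles. (\<integral>\<^sup>+\<xi>\<in>carleson_box h \<phi>. F \<xi> \<partial>M) \<partial>lborel)
      \<le> ennreal (3 * h) * (\<integral>\<^sup>+\<xi>\<in>{\<xi>. 1 - h \<le> cmod \<xi> \<and> cmod \<xi> < 1}. F \<xi> \<partial>M)" (is "_ \<le> ?R")
    and "(\<lambda>\<phi>. \<integral>\<^sup>+\<xi>\<in>carleson_box h \<phi>. F \<xi> \<partial>M) \<in> borel_measurable borel"
proof -
  interpret M: finite_measure M by fact
  interpret P: pair_sigma_finite lborel M by unfold_locales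
  have [measurable_cong]: "sets M = sets borel" by fact
  define T where "T = {\<xi>::complex. 1 - h \<le> cmod \<xi> \<and> cmod \<xi> < 1}"
  have T[measurable]: "T \<in> sets borel" unfolding T_def by measurable
  note pair = carleson_box_measurable_pair[OF h]
  have pm: "(\<lambda>(\<phi>, \<xi>). F \<xi> * indicator (carleson_box h \<phi>) \<xi>) \<in> borel_measurable (lborel \<Otimes>\<^sub>M M)"
  proof -
    have [measurable]: "(\<lambda>x. indicator (carleson_box h (fst x)) (snd x) :: ennreal) \<in> borel_measurable (lborel \<Otimes>\<^sub>M M)"
      using pair by (simp add: case_prod_beta cong: measurable_cong_sets sets_pair_measure_cong)
    show ?thesis unfolding case_prod_beta by measurable
  qed
  show "(\<lambda>\<phi>. \<integral>\<^sup>+\<xi>\<in>carleson_box h \<phi>. F \<xi> \<partial>M) \<in> borel_measurable borel"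
    using M.borel_measurable_nn_integral_fst[OF pm] by simp
  have "?I = (\<integral>\<^sup>+\<phi>. (\<integral>\<^sup>+\<xi>. F \<xi> * indicator (carleson_box h \<phi>) \<xi> * indicator angles \<phi> \<partial>M) \<partial>lborel)"
    using pm by (intro nn_integral_cong nn_integral_multc[symmetric]) auto
  also have "\<dots> = (\<integral>\<^sup>+\<xi>. (\<integral>\<^sup>+\<phi>. F \<xi> * indicator (carleson_box h \<phi>) \<xi> * indicator angles \<phi> \<partial>lborel) \<partial>M)"
  proof (rule P.Fubini'[symmetric])
    show "(\<lambda>(\<phi>, \<xi>). F \<xi> * indicator (carleson_box h \<phi>) \<xi> * indicator angles \<phi>) \<in> borel_measurable (lborel \<Otimes>\<^sub>M M)"
      using pm unfolding case_prod_beta by measurable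
  qed
  also have "\<dots> = (\<integral>\<^sup>+\<xi>. F \<xi> * (\<integral>\<^sup>+\<phi>\<in>angles. indicator (carleson_box h \<phi>) \<xi> \<partial>lborel) \<partial>M)"
  proof (rule nn_integral_cong)
    fix \<xi>
    have [measurable]: "(\<lambda>\<phi>. indicator (carleson_box h \<phi>) \<xi> :: ennreal) \<in> borel_measurable borel"
      using measurable_compose[OF _ pair, of "\<lambda>\<phi>. (\<phi>, \<xi>)" borel] by simp
    show "(\<integral>\<^sup>+\<phi>. F \<xi> * indicator (carleson_box h \<phi>) \<xi> * indicator angles \<phi> \<partial>lborel)
      = F \<xi> * (\<integral>\<^sup>+\<phi>\<in>angles. indicator (carleson_box h \<phi>) \<xi> \<partial>lborel)"
      unfolding mult.assoc by (rule nn_integral_cmult) measurable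
  qed
  finally have I: "?I = (\<integral>\<^sup>+\<xi>. F \<xi> * (\<integral>\<^sup>+\<phi>\<in>angles. indicator (carleson_box h \<phi>) \<xi> \<partial>lborel) \<partial>M)" .
  have zero: "(\<integral>\<^sup>+\<phi>\<in>angles. indicator (carleson_box h \<phi>) \<xi> \<partial>lborel) = 0" if "\<xi> \<notin> T" for \<xi>
  proof -
    have "\<xi> \<notin> carleson_box h \<phi>" for \<phi> using that carleson_box_iff[OF h, of \<xi> \<phi>] unfolding T_def by blast
    then show ?thesis by simp
  qed
  have "?L = (\<integral>\<^sup>+\<xi>. ennreal h * (F \<xi> * indicator T \<xi>) \<partial>M)"
    unfolding T_def[symmetric] by (rule nn_integral_cmult[symmetric]) measurable
  also have "\<dots> \<le> ?I" unfolding I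
  proof (rule nn_integral_mono)
    fix \<xi> show "ennreal h * (F \<xi> * indicator T \<xi>)
      \<le> F \<xi> * (\<integral>\<^sup>+\<phi>\<in>angles. indicator (carleson_box h \<phi>) \<xi> \<partial>lborel)"
    proof (cases "\<xi> \<in> T")
      case True
      then show ?thesis using carleson_box_angle_length(1)[OF h, of \<xi>]
        unfolding T_def by (auto simp: mult.commute[of "F \<xi>"] intro!: mult_right_mono)
    qed simp
  qed
  finally show "?L \<le> ?I" .
  have "?I \<le> (\<integral>\<^sup>+\<xi>. ennreal (3 * h) * (F \<xi> * indicator T \<xi>) \<partial>M)" unfolding I
  proof (rule nn_integral_mono)
    fix \<xi> show "F \<xi> * (\<integral>\<^sup>+\<phi>\<in>angles. indicator (carleson_box h \<phi>) \<xi> \<partial>lborel)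
      \<le> ennreal (3 * h) * (F \<xi> * indicator T \<xi>)"
    proof (cases "\<xi> \<in> T")
      case True
      then show ?thesis using carleson_box_angle_length(2)[OF h, of \<xi>]
        unfolding T_def by (auto simp: mult.commute intro!: mult_left_mono)
    qed (simp add: zero)
  qed
  also have "\<dots> = ?R" unfolding T_def[symmetric] by (rule nn_integral_cmult) measurable
  finally show "?I \<le> ?R" .
qed

text \<open>
  What is used of \<open>\<mu> = \<omega> dA\<close> and \<open>\<eta> = \<nu> dA\<close>. The assumption \<open>tail_doubling\<close> expresses \<open>\<nu> \<in> \<D>\<close>-hat,
  with the iterated doubling turned into a power, and \<open>tail_annulus\<close> expresses \<open>\<nu> \<in> \<D>\<close>-check: of the
  \<open>\<eta>\<close>-mass of a strip, a fixed share stays away from the boundary. The \<open>B\<^sub>q\<close> condition enters as the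
  Hoelder inequality that it implies, in linear form: instead of bounding the mean of \<open>F\<close> over a
  square by the \<open>q\<close>-th root of a mean of \<open>F\<^sup>q\<close>, it bounds it by \<open>y\<close> plus \<open>y\<^sup>1\<^sup>-\<^sup>q\<close> times that mean,
  for all \<open>y > 0\<close>. The linear form can be integrated over rotations before \<open>y\<close> is optimised, and it
  needs no roots of possibly infinite integrals.
\<close>

locale regular_pair =
  fixes \<mu> \<eta> :: "complex measure" and q A K \<beta> C0 :: real
  assumes finite_mu: "finite_measure \<mu>" and sets_mu[measurable_cong]: "sets \<mu> = sets borel"
    and mu_disc: "AE z in \<mu>. z \<in> unit_disc"
    and finite_eta: "finite_measure \<eta>" and sets_eta[measurable_cong]: "sets \<eta> = sets borel"
    and eta_rotate: "distr \<eta> borel (\<lambda>z. cis \<theta> * z) = \<eta>"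
    and q: "1 < q" and A: "1 \<le> A" and K: "1 < K" and \<beta>: "0 \<le> \<beta>" and C0: "0 < C0"
    and tail_pos: "0 < h \<Longrightarrow> h < 1 \<Longrightarrow> 0 < measure \<eta> {z. 1 - h \<le> cmod z \<and> cmod z < 1}"
    and tail_doubling: "0 < t \<Longrightarrow> t \<le> h \<Longrightarrow> h < 1 \<Longrightarrow>
      measure \<eta> {z. 1 - h \<le> cmod z \<and> cmod z < 1}
        \<le> A * (h / t) powr \<beta> * measure \<eta> {z. 1 - t \<le> cmod z \<and> cmod z < 1}"
    and tail_annulus: "0 < h \<Longrightarrow> h < 1 \<Longrightarrow>
      measure \<eta> {z. 1 - h \<le> cmod z \<and> cmod z < 1} \<le> A * measure \<eta> {z. 1 - h \<le> cmod z \<and> cmod z < 1 - h / K}"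
    and mu_square_pos: "a \<in> unit_disc - {0} \<Longrightarrow> 0 < measure \<mu> (carleson_square a)"
    and B_condition: "\<And>a F y. a \<in> unit_disc - {0} \<Longrightarrow> F \<in> borel_measurable borel \<Longrightarrow> (\<And>z. 0 \<le> F z) \<Longrightarrow> 0 < y \<Longrightarrow>
      (\<integral>\<^sup>+z\<in>carleson_square a. ennreal (F z) \<partial>\<eta>)
        \<le> ennreal (C0 * measure \<eta> (carleson_square a) * y)
          + ennreal (C0 * measure \<eta> (carleson_square a) * y powr (1 - q) / measure \<mu> (carleson_square a))
            * (\<integral>\<^sup>+z\<in>carleson_square a. ennreal (F z powr q) \<partial>\<mu>)"
begin

sublocale mu: finite_measure \<mu> by (rule finite_mu)
sublocale eta: finite_measure \<eta> by (rule finite_eta)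

definition strip :: "real \<Rightarrow> complex set" where
  "strip h = {z. 1 - h \<le> cmod z \<and> cmod z < 1}"

definition annulus :: "real \<Rightarrow> complex set" where
  "annulus h = {z. 1 - h \<le> cmod z \<and> cmod z < 1 - h / K}"

lemma annulus_subset_strip: "0 < h \<Longrightarrow> annulus h \<subseteq> strip h"
proof -
  assume "0 < h"
  then have "0 < h / K" using K by simp
  then show ?thesis unfolding annulus_def strip_def by auto
qed

lemma strip_borel[measurable]: "strip h \<in> sets borel" unfolding strip_def by measurable
lemma annulus_borel[measurable]: "annulus h \<in> sets borel" unfolding annulus_def by measurable

lemma nn_integral_eta_rotate:
  assumes [measurable]: "F \<in> borel_measurable borel"
  shows "(\<integral>\<^sup>+z. F (cis \<theta> * z) \<partial>\<eta>) = (\<integral>\<^sup>+z. F z \<partial>\<eta>)"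
  using nn_integral_distr[of "\<lambda>z. cis \<theta> * z" \<eta> borel F] eta_rotate[of \<theta>] by simp

text \<open>
  By rotation invariance all squares of height \<open>h\<close> have the same \<open>\<eta>\<close>-measure, which therefore is the
  average computed by \<open>carleson_box_average\<close>.
\<close>

lemma eta_box:
  assumes h: "0 < h" "h < 1" and R[measurable]: "R \<in> sets borel" "R \<subseteq> {1-h..<1}"
  shows "h / (4 * pi) * measure \<eta> (cmod -` R) \<le> measure \<eta> (carleson_box h \<phi> \<inter> cmod -` R)"
    and "measure \<eta> (carleson_box h \<phi> \<inter> cmod -` R) \<le> h * measure \<eta> (cmod -` R)"
proof -
  define E where "E = cmod -` R"
  have E[measurable]: "E \<in> sets borel"
    unfolding E_def using measurable_sets[of cmod borel borel R] R by simp
  have Eh: "{\<xi>. 1 - h \<le> cmod \<xi> \<and> cmod \<xi> < 1} \<inter> E = E" unfolding E_def using R(2) by auto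
  note [measurable] = carleson_box_borel[OF h]
  define m where "m = measure \<eta> (carleson_box h \<phi> \<inter> E)"
  have same: "(\<integral>\<^sup>+\<xi>\<in>carleson_box h \<psi>. indicator E \<xi> \<partial>\<eta>) = ennreal m" for \<psi>
  proof -
    have "(\<integral>\<^sup>+\<xi>\<in>carleson_box h \<psi>. indicator E \<xi> \<partial>\<eta>)
        = (\<integral>\<^sup>+z. indicator E (cis (\<psi> - \<phi>) * z) * indicator (carleson_box h \<psi>) (cis (\<psi> - \<phi>) * z) \<partial>\<eta>)"
      by (rule nn_integral_eta_rotate[symmetric]) measurable
    also have "\<dots> = (\<integral>\<^sup>+z. indicator (carleson_box h \<phi> \<inter> E) z \<partial>\<eta>)"
    proof (rule nn_integral_cong)
      fix z
      have "cis \<psi> * cnj (cis (\<psi> - \<phi>) * z) = cis \<phi> * cnj z"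
        by (simp add: cis_cnj cis_mult flip: mult.assoc)
      then have "cis (\<psi> - \<phi>) * z \<in> carleson_box h \<psi> \<longleftrightarrow> z \<in> carleson_box h \<phi>"
        unfolding carleson_box_iff[OF h] by (simp only: norm_mult norm_cis mult_1)
      moreover have "cis (\<psi> - \<phi>) * z \<in> E \<longleftrightarrow> z \<in> E"
        unfolding E_def by (simp add: norm_mult)
      ultimately show "indicator E (cis (\<psi> - \<phi>) * z) * indicator (carleson_box h \<psi>) (cis (\<psi> - \<phi>) * z)
          = (indicator (carleson_box h \<phi> \<inter> E) z :: ennreal)"
        by (auto simp: indicator_def)
    qed
    finally show ?thesis unfolding m_def by (simp add: sets_eta eta.emeasure_eq_measure)
  qed
  have I: "(\<integral>\<^sup>+\<psi>\<in>angles. (\<integral>\<^sup>+\<xi>\<in>carleson_box h \<psi>. indicator E \<xi> \<partial>\<eta>) \<partial>lborel) = ennreal (4 * pi * m)"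
    unfolding same by (subst nn_integral_cmult_indicator) (auto simp: m_def ennreal_mult'[symmetric] mult_ac)
  have J: "(\<integral>\<^sup>+\<xi>\<in>{\<xi>. 1 - h \<le> cmod \<xi> \<and> cmod \<xi> < 1}. indicator E \<xi> \<partial>\<eta>) = ennreal (measure \<eta> E)"
  proof -
    have "(\<integral>\<^sup>+\<xi>\<in>{\<xi>. 1 - h \<le> cmod \<xi> \<and> cmod \<xi> < 1}. indicator E \<xi> \<partial>\<eta>) = (\<integral>\<^sup>+\<xi>. indicator E \<xi> \<partial>\<eta>)"
      using Eh by (intro nn_integral_cong) (auto simp: indicator_def)
    then show ?thesis by (simp add: sets_eta eta.emeasure_eq_measure)
  qed
  have m0: "0 \<le> m" unfolding m_def by simp
  have "ennreal h * ennreal (measure \<eta> E) \<le> ennreal (4 * pi * m)"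
    using carleson_box_average(1)[OF finite_eta sets_eta _ h, of "indicator E"] I J by simp
  then have "h * measure \<eta> E \<le> 4 * pi * m"
    using h m0 by (simp add: ennreal_mult'[symmetric])
  then show "h / (4 * pi) * measure \<eta> (cmod -` R) \<le> measure \<eta> (carleson_box h \<phi> \<inter> cmod -` R)"
    unfolding m_def[symmetric] E_def[symmetric] by (simp add: field_simps)
  have "ennreal (4 * pi * m) \<le> ennreal (3 * h) * ennreal (measure \<eta> E)"
    using carleson_box_average(2)[OF finite_eta sets_eta _ h, of "indicator E"] I J by simp
  then have "4 * pi * m \<le> 3 * h * measure \<eta> E"
    using h m0 by (simp add: ennreal_mult'[symmetric])
  moreover have "3 * m \<le> 4 * pi * m" using m0 pi_gt3 by (intro mult_right_mono) auto
  ultimately have "m \<le> h * measure \<eta> E" by simp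
  then show "measure \<eta> (carleson_box h \<phi> \<inter> cmod -` R) \<le> h * measure \<eta> (cmod -` R)"
    unfolding m_def E_def .
qed

lemma eta_carleson_box:
  assumes h: "0 < h" "h < 1"
  shows "h / (4 * pi) * measure \<eta> (strip h) \<le> measure \<eta> (carleson_box h \<phi>)"
    and "measure \<eta> (carleson_box h \<phi>) \<le> h * measure \<eta> (strip h)"
    and "h / (4 * pi) * measure \<eta> (annulus h) \<le> measure \<eta> (carleson_box h \<phi> \<inter> annulus h)"
proof -
  have s: "strip h = cmod -` {1-h..<1}" "annulus h = cmod -` {1-h..<1-h/K}"
    unfolding strip_def annulus_def by auto
  have "carleson_box h \<phi> \<subseteq> strip h" using carleson_box_iff[OF h] unfolding strip_def by auto
  then have e: "carleson_box h \<phi> \<inter> strip h = carleson_box h \<phi>" by auto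
  show "h / (4 * pi) * measure \<eta> (strip h) \<le> measure \<eta> (carleson_box h \<phi>)"
    "measure \<eta> (carleson_box h \<phi>) \<le> h * measure \<eta> (strip h)"
    using eta_box[OF h, of "{1-h..<1}" \<phi>] e unfolding s by auto
  have "0 < h / K" using h K by simp
  then have "{1 - h..<1 - h / K} \<subseteq> {1-h..<1}" by auto
  then show "h / (4 * pi) * measure \<eta> (annulus h) \<le> measure \<eta> (carleson_box h \<phi> \<inter> annulus h)"
    using eta_box(1)[OF h, of "{1-h..<1-h/K}" \<phi>] unfolding s by auto
qed

lemma eta_strip_pos: "0 < h \<Longrightarrow> h < 1 \<Longrightarrow> 0 < measure \<eta> (strip h)"
  unfolding strip_def by (rule tail_pos)

lemma eta_carleson_box_pos:
  assumes "0 < h" "h < 1" shows "0 < measure \<eta> (carleson_box h \<phi>)"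
proof -
  have "0 < h / (4 * pi) * measure \<eta> (strip h)" using eta_strip_pos[OF assms] assms by simp
  then show ?thesis using eta_carleson_box(1)[OF assms, of \<phi>] by linarith
qed

text \<open>
  The \<open>A\<^sub>\<infinity>\<close> property of \<open>\<mu>\<close> relative to \<open>\<eta>\<close> on squares: \<open>B_condition\<close> for the indicator of \<open>E\<close>, with
  \<open>y\<close> chosen such that the first term is at most half of \<open>\<eta>(E)\<close> and can be absorbed.
\<close>

lemma mu_le_of_eta_le:
  assumes h: "0 < h" "h < 1" and E: "E \<in> sets borel" "E \<subseteq> carleson_box h \<phi>"
    and r: "0 < r" "r * measure \<eta> (carleson_box h \<phi>) \<le> measure \<eta> E"
  shows "measure \<mu> (carleson_box h \<phi>) \<le> (2 * C0 / r) powr q * measure \<mu> E"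
proof -
  define S where "S = carleson_box h \<phi>"
  have a: "box_pt h \<phi> \<in> unit_disc - {0}" by (rule box_pt_in[OF h])
  have [measurable]: "S \<in> sets borel" "E \<in> sets borel"
    using carleson_box_borel[OF h] E unfolding S_def by auto
  have nS: "0 < measure \<eta> S" unfolding S_def by (rule eta_carleson_box_pos[OF h])
  have mS: "0 < measure \<mu> S" unfolding S_def by (rule mu_square_pos[OF a])
  define y where "y = r / (2 * C0)"
  have y: "0 < y" unfolding y_def using r C0 by simp
  have ind: "(\<integral>\<^sup>+z\<in>S. ennreal (indicator E z) \<partial>\<eta>) = ennreal (measure \<eta> E)"
    "(\<integral>\<^sup>+z\<in>S. ennreal (indicator E z powr q) \<partial>\<mu>) = ennreal (measure \<mu> E)"
  proof -
    have "(\<integral>\<^sup>+z\<in>S. ennreal (indicator E z) \<partial>\<eta>) = (\<integral>\<^sup>+z. indicator E z \<partial>\<eta>)"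
      using E unfolding S_def by (intro nn_integral_cong) (auto simp: indicator_def)
    then show "(\<integral>\<^sup>+z\<in>S. ennreal (indicator E z) \<partial>\<eta>) = ennreal (measure \<eta> E)"
      by (simp add: sets_eta eta.emeasure_eq_measure)
    have "(\<integral>\<^sup>+z\<in>S. ennreal (indicator E z powr q) \<partial>\<mu>) = (\<integral>\<^sup>+z. indicator E z \<partial>\<mu>)"
      using E q unfolding S_def by (intro nn_integral_cong) (auto simp: indicator_def)
    then show "(\<integral>\<^sup>+z\<in>S. ennreal (indicator E z powr q) \<partial>\<mu>) = ennreal (measure \<mu> E)"
      by (simp add: sets_mu mu.emeasure_eq_measure)
  qed
  have "ennreal (measure \<eta> E) \<le> ennreal (C0 * measure \<eta> S * y)
      + ennreal (C0 * measure \<eta> S * y powr (1 - q) / measure \<mu> S) * ennreal (measure \<mu> E)"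
    using B_condition[OF a, of "indicator E" y] y ind unfolding S_def by simp
  also have "\<dots> = ennreal (C0 * measure \<eta> S * y + C0 * measure \<eta> S * y powr (1 - q) / measure \<mu> S * measure \<mu> E)"
    using C0 y by (simp add: ennreal_mult'[symmetric] ennreal_plus[symmetric] del: ennreal_plus)
  finally have "measure \<eta> E \<le> C0 * measure \<eta> S * y + C0 * measure \<eta> S * y powr (1 - q) / measure \<mu> S * measure \<mu> E"
    using C0 y by (subst (asm) ennreal_le_iff) auto
  then have "r * measure \<eta> S \<le> (C0 * y + C0 * y powr (1 - q) / measure \<mu> S * measure \<mu> E) * measure \<eta> S"
    using r(2) unfolding S_def by (simp add: algebra_simps)
  then have "r \<le> C0 * y + C0 * y powr (1 - q) / measure \<mu> S * measure \<mu> E"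
    using nS by simp
  moreover have "C0 * y = r / 2" unfolding y_def using C0 by simp
  ultimately have "r / 2 \<le> C0 * y powr (1 - q) / measure \<mu> S * measure \<mu> E" by linarith
  then have "r / (2 * C0) * measure \<mu> S \<le> y powr (1 - q) * measure \<mu> E"
    using mS C0 by (simp add: field_simps)
  then have "y * measure \<mu> S \<le> y * y powr (- q) * measure \<mu> E"
    unfolding y_def[symmetric] using y by (simp add: powr_diff powr_minus_divide)
  then have "measure \<mu> S \<le> y powr (- q) * measure \<mu> E" using y by (simp add: mult.assoc)
  also have "y powr (- q) = (2 * C0 / r) powr q"
    unfolding y_def using r C0 by (simp add: powr_minus_divide powr_divide)
  finally show ?thesis unfolding S_def .
qed

end

section \<open>Kernel masses and the measure of Carleson squares\<close>

definition gap :: "complex \<Rightarrow> real" where "gap z = 1 - cmod z"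

text \<open>
  Comparable to \<open>1\<close> within the distance \<open>1 - |z|\<close> of \<open>z\<close> and to \<open>(1 - |z|) / |z - \<xi>|\<close> farther away.
  It is the model for all kernels below, and powers of it provide the decay.
\<close>

definition kap :: "complex \<Rightarrow> complex \<Rightarrow> real" where
  "kap z \<xi> = gap z / (gap z + cmod (z - \<xi>))"

lemma gap_measurable[measurable]: "gap \<in> borel_measurable borel"
  unfolding gap_def[abs_def] by measurable

lemma kap_measurable[measurable (raw)]:
  assumes [measurable]: "f \<in> borel_measurable M" "g \<in> borel_measurable M"
  shows "(\<lambda>x. kap (f x) (g x)) \<in> borel_measurable M"
  unfolding kap_def gap_def by measurable

lemma gap_pos: "z \<in> unit_disc \<Longrightarrow> 0 < gap z" unfolding gap_def by simp

lemma gap_le_1: "gap z \<le> 1" unfolding gap_def by simp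

lemma gap_lipschitz: "gap z \<le> gap w + cmod (z - w)"
  unfolding gap_def using norm_triangle_ineq3[of w z] by (simp add: norm_minus_commute)

lemma gap_box_pt: "h \<le> 1 \<Longrightarrow> gap (box_pt h \<phi>) = h"
  unfolding gap_def by (simp add: cmod_box_pt)

lemma kap_bounds:
  assumes "0 < gap z" shows "0 < kap z \<xi>" "kap z \<xi> \<le> 1"
  unfolding kap_def using assms by (auto simp: divide_simps add_pos_nonneg)

text \<open>
  Kernels with different base points and arguments are always compared in this way: \<open>b\<close> pays for the
  numerators, \<open>c\<close> for the denominators.
\<close>

lemma kap_le_kap:
  assumes "0 < gap z" "0 < gap w" "gap z \<le> b * gap w"
    and "gap w + cmod (w - \<xi>') \<le> c * (gap z + cmod (z - \<xi>))"
  shows "kap z \<xi> \<le> (b * c) * kap w \<xi>'"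
proof -
  define X Y where "X = gap z + cmod (z - \<xi>)" "Y = gap w + cmod (w - \<xi>')"
  have X: "0 < X" and Y: "0 < Y" unfolding X_Y_def using assms by (auto intro: add_pos_nonneg)
  have "gap z * Y \<le> (b * gap w) * (c * X)"
    using assms Y X unfolding X_Y_def[symmetric] by (intro mult_mono) auto
  then show ?thesis unfolding kap_def X_Y_def[symmetric] using X Y by (simp add: field_simps)
qed

lemma carleson_box_gap:
  assumes h: "0 < h" "h < 1" and \<xi>: "\<xi> \<in> carleson_box h \<phi>"
  shows "0 < gap \<xi>" "gap \<xi> \<le> h"
  using carleson_box_iff[OF h, of \<xi> \<phi>] \<xi> unfolding gap_def by auto

lemma kap_carleson_box:
  assumes h: "0 < h" "h < 1" and \<xi>: "\<xi> \<in> carleson_box h \<phi>" and z: "h \<le> gap z"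
  shows "kap z \<xi> \<le> 3 * kap z (box_pt h \<phi>)" "kap z (box_pt h \<phi>) \<le> 3 * kap z \<xi>"
proof -
  have d: "cmod (\<xi> - box_pt h \<phi>) \<le> 2 * h" by (rule carleson_box_dist[OF h \<xi>])
  have "cmod (z - box_pt h \<phi>) \<le> cmod (z - \<xi>) + 2 * h"
    using norm_triangle_ineq[of "z - \<xi>" "\<xi> - box_pt h \<phi>"] d by simp
  moreover have "cmod (z - \<xi>) \<le> cmod (z - box_pt h \<phi>) + 2 * h"
    using norm_triangle_ineq[of "z - box_pt h \<phi>" "box_pt h \<phi> - \<xi>"] d by (simp add: norm_minus_commute)
  moreover have "0 \<le> cmod (z - \<xi>)" "0 \<le> cmod (z - box_pt h \<phi>)" by auto
  ultimately have "gap z + cmod (z - box_pt h \<phi>) \<le> 3 * (gap z + cmod (z - \<xi>))"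
      "gap z + cmod (z - \<xi>) \<le> 3 * (gap z + cmod (z - box_pt h \<phi>))"
    using z h by argo+
  then show "kap z \<xi> \<le> 3 * kap z (box_pt h \<phi>)" "kap z (box_pt h \<phi>) \<le> 3 * kap z \<xi>"
    using kap_le_kap[of z z 1 _ 3] z h by auto
qed

context regular_pair
begin

definition top_const :: real where "top_const = (8 * pi * A * C0) powr q"

lemma top_const_pos: "0 < top_const"
  unfolding top_const_def using A C0 by (simp add: zero_less_mult_iff)

text \<open>
  \<open>\<D>\<close>-check for \<open>\<mu>\<close>: the part of a square away from the boundary has a fixed share of \<open>\<eta>\<close>, hence of
  \<open>\<mu>\<close>.
\<close>

lemma mu_carleson_box_le_top:
  assumes h: "0 < h" "h < 1"
  shows "measure \<mu> (carleson_box h \<phi>) \<le> top_const * measure \<mu> (carleson_box h \<phi> \<inter> annulus h)"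
proof -
  define r where "r = 1 / (4 * pi * A)"
  have r: "0 < r" unfolding r_def using A by simp
  have "r * measure \<eta> (carleson_box h \<phi>) \<le> r * (h * measure \<eta> (strip h))"
    using eta_carleson_box(2)[OF h] r by (intro mult_left_mono) auto
  also have "measure \<eta> (strip h) \<le> A * measure \<eta> (annulus h)"
    unfolding strip_def annulus_def by (rule tail_annulus[OF h])
  then have "r * (h * measure \<eta> (strip h)) \<le> r * (h * (A * measure \<eta> (annulus h)))"
    using r h by (intro mult_left_mono) auto
  also have "\<dots> = h / (4 * pi) * measure \<eta> (annulus h)"
    unfolding r_def using A by simp
  also have "\<dots> \<le> measure \<eta> (carleson_box h \<phi> \<inter> annulus h)" by (rule eta_carleson_box(3)[OF h])
  finally have "measure \<mu> (carleson_box h \<phi>) \<le> (2 * C0 / r) powr q * measure \<mu> (carleson_box h \<phi> \<inter> annulus h)"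
    using carleson_box_borel[OF h] r by (intro mu_le_of_eta_le[OF h]) auto
  also have "2 * C0 / r = 8 * pi * A * C0" unfolding r_def by simp
  finally show ?thesis unfolding top_const_def .
qed

text \<open>
  A square of height \<open>h\<close> has \<open>\<eta>\<close>-measure of order \<open>h\<close> times that of the strip, so \<open>\<eta>\<close> grows at most
  with exponent \<open>\<beta> + 1\<close>, and \<open>mu_le_of_eta_le\<close> multiplies exponents by \<open>q\<close>.
\<close>

definition growth :: real where "growth = (\<beta> + 1) * q"

lemma growth_pos: "0 < growth" unfolding growth_def using \<beta> q by simp

text \<open>
  \<open>\<D>\<close>-hat for \<open>\<mu>\<close>, in the form of polynomial growth.
\<close>

lemma mu_carleson_box_doubling:
  assumes t: "0 < t" "t \<le> h" "h < 1"
  shows "measure \<mu> (carleson_box h \<phi>) \<le> top_const * (h / t) powr growth * measure \<mu> (carleson_box t \<phi>)"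
proof -
  have h: "0 < h" "h < 1" and t': "0 < t" "t < 1" using t by auto
  define r where "r = (t / h) powr (\<beta> + 1) / (4 * pi * A)"
  have r: "0 < r" unfolding r_def using A t h by simp
  have "r * measure \<eta> (carleson_box h \<phi>) \<le> r * (h * measure \<eta> (strip h))"
    using eta_carleson_box(2)[OF h] r by (intro mult_left_mono) auto
  also have "measure \<eta> (strip h) \<le> A * (h / t) powr \<beta> * measure \<eta> (strip t)"
    unfolding strip_def by (rule tail_doubling[OF t])
  then have "r * (h * measure \<eta> (strip h)) \<le> r * (h * (A * (h / t) powr \<beta> * measure \<eta> (strip t)))"
    using r h by (intro mult_left_mono) auto
  also have "\<dots> = t / (4 * pi) * measure \<eta> (strip t)"
  proof -
    have "(t / h) powr (\<beta> + 1) * (h / t) powr \<beta> = t / h"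
      using t h by (simp add: powr_divide powr_add)
    then have "(t / h) powr (\<beta> + 1) * (h / t) powr \<beta> * h = t" using h by simp
    then show ?thesis unfolding r_def using A by (simp add: field_simps)
  qed
  also have "\<dots> \<le> measure \<eta> (carleson_box t \<phi>)" by (rule eta_carleson_box(1)[OF t'])
  finally have "measure \<mu> (carleson_box h \<phi>) \<le> (2 * C0 / r) powr q * measure \<mu> (carleson_box t \<phi>)"
    using carleson_box_borel[OF t'] carleson_box_mono[OF t] r by (intro mu_le_of_eta_le[OF h]) auto
  also have "2 * C0 / r = 8 * pi * A * C0 * (h / t) powr (\<beta> + 1)"
    unfolding r_def using t h by (simp add: powr_divide)
  also have "\<dots> powr q = top_const * (h / t) powr growth"
    unfolding top_const_def growth_def using A C0 t h by (subst powr_mult) (auto simp: powr_powr)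
  finally show ?thesis .
qed

text \<open>
  Compactness of the circle, made finite: every square of height \<open>1/2\<close> contains one of height \<open>1/4\<close>
  whose angle is a multiple of \<open>1/8\<close>.
\<close>

lemma mu_half_box_lower_bound: "\<exists>c>0. \<forall>\<phi>\<in>angles. c \<le> measure \<mu> (carleson_box (1/2) \<phi>)"
proof -
  (* The angles \<open>j/8\<close> cover all of \<open>angles\<close>, as \<open>16\<pi> < 65\<close>. *)
  define c where "c = Min ((\<lambda>j::int. measure \<mu> (carleson_box (1/4) (j / 8))) ` {-65..65})"
  have "0 < c" unfolding c_def
    by (subst Min_gr_iff) (auto intro!: mu_square_pos box_pt_in simp del: Diff_iff)
  moreover have "c \<le> measure \<mu> (carleson_box (1/2) \<phi>)" if "\<phi> \<in> angles" for \<phi>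
  proof -
    obtain j :: int where j: "\<bar>\<phi> - of_int j / 8\<bar> \<le> 1/8" "\<bar>of_int j / 8\<bar> \<le> 2 * pi"
    proof (cases "0 \<le> \<phi>")
      case True
      have "0 \<le> \<lfloor>8 * \<phi>\<rfloor>" using True by simp
      then have "0 \<le> real_of_int \<lfloor>8 * \<phi>\<rfloor>" by linarith
      moreover have "real_of_int \<lfloor>8 * \<phi>\<rfloor> \<le> 8 * \<phi>" "8 * \<phi> \<le> real_of_int \<lfloor>8 * \<phi>\<rfloor> + 1" by linarith+
      moreover have "- (2 * pi) \<le> \<phi>" "\<phi> \<le> 2 * pi" using \<open>\<phi> \<in> angles\<close> by auto
      ultimately have "\<bar>\<phi> - of_int \<lfloor>8 * \<phi>\<rfloor> / 8\<bar> \<le> 1/8" "\<bar>real_of_int \<lfloor>8 * \<phi>\<rfloor> / 8\<bar> \<le> 2 * pi" by linarith+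
      then show ?thesis by (rule that)
    next
      case False
      have "\<lceil>8 * \<phi>\<rceil> \<le> 0" using False by simp
      then have "real_of_int \<lceil>8 * \<phi>\<rceil> \<le> 0" by linarith
      moreover have "8 * \<phi> \<le> real_of_int \<lceil>8 * \<phi>\<rceil>" "real_of_int \<lceil>8 * \<phi>\<rceil> \<le> 8 * \<phi> + 1" by linarith+
      moreover have "- (2 * pi) \<le> \<phi>" "\<phi> \<le> 2 * pi" using \<open>\<phi> \<in> angles\<close> by auto
      ultimately have "\<bar>\<phi> - of_int \<lceil>8 * \<phi>\<rceil> / 8\<bar> \<le> 1/8" "\<bar>real_of_int \<lceil>8 * \<phi>\<rceil> / 8\<bar> \<le> 2 * pi" by linarith+
      then show ?thesis by (rule that)
    qed
    have "\<bar>real_of_int j\<bar> < 65" using j(2) pi_less_4 by linarith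
    then have "j \<in> {-65..65}" by auto
    then have "c \<le> measure \<mu> (carleson_box (1/4) (j / 8))" unfolding c_def by (intro Min_le) auto
    also have "\<dots> \<le> measure \<mu> (carleson_box (1/2) \<phi>)"
    proof (rule mu.finite_measure_mono)
      show "carleson_box (1/4) (j / 8) \<subseteq> carleson_box (1/2) \<phi>"
      proof
        fix \<xi> assume \<xi>: "\<xi> \<in> carleson_box (1/4) (j / 8)"
        define r where "r = cmod \<xi>"
        have r: "3/4 \<le> r" "r < 1" using \<xi> carleson_box_iff[of "1/4"] unfolding r_def by auto
        have pol: "\<xi> = of_real r * cis (Arg \<xi>)" unfolding r_def by (metis rcis_cmod_Arg rcis_def)
        define x where "x = of_int j / 8 - Arg \<xi>"
        have "cos (1/8) \<le> cos x"
          using carleson_box_polar[of "1/4" r "Arg \<xi>" "of_int j / 8"] \<xi> r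
          unfolding pol[symmetric] x_def by simp
        moreover have "\<bar>x\<bar> \<le> 3 * pi" using j(2) Arg_bounded[of \<xi>] unfolding x_def by linarith
        ultimately have "\<bar>x\<bar> \<le> 1/8 \<or> \<bar>x - 2 * pi\<bar> \<le> 1/8 \<or> \<bar>x + 2 * pi\<bar> \<le> 1/8"
          using pi_gt3 by (intro cos_ge_cos_3pi) auto
        then have "\<exists>k\<in>{0, -(2 * pi), 2 * pi}. \<bar>x + k\<bar> \<le> 1/8" by simp
        then obtain k where k: "k \<in> {0, -(2 * pi), 2 * pi}" "\<bar>x + k\<bar> \<le> 1/8" by blast
        have "\<bar>\<phi> - Arg \<xi> + k\<bar> \<le> 1/4" using k(2) j(1) unfolding x_def by linarith
        then have "cos (1/4) \<le> cos \<bar>\<phi> - Arg \<xi> + k\<bar>" using pi_gt3 by (subst cos_mono_le_eq) auto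
        also have "\<dots> = cos (\<phi> - Arg \<xi>)" using k(1) by (auto simp: cos_diff cos_add)
        finally show "\<xi> \<in> carleson_box (1/2) \<phi>"
          using carleson_box_polar[of "1/2" r "Arg \<xi>" \<phi>] r unfolding pol[symmetric] by simp
      qed
    qed (auto intro!: carleson_box_borel simp: sets_mu)
    finally show ?thesis .
  qed
  ultimately show ?thesis by blast
qed

text \<open>
  Inside the disc, balls of radius less than \<open>1/8\<close> lie in a larger square with the same angle. The
  others are compared with the square of height \<open>1/2\<close>, whose \<open>\<mu>\<close>-measure is bounded below uniformly
  in the angle.
\<close>

lemma mu_ball_le: "\<exists>C>0. \<forall>t r \<phi>. 0 < t \<and> t < 1 \<and> t \<le> r \<and> \<phi> \<in> angles \<longrightarrow>
  measure \<mu> (ball (box_pt t \<phi>) r) \<le> C * (r / t) powr growth * measure \<mu> (carleson_box t \<phi>)"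
proof -
  obtain c where c: "0 < c" "\<And>\<phi>. \<phi> \<in> angles \<Longrightarrow> c \<le> measure \<mu> (carleson_box (1/2) \<phi>)"
    using mu_half_box_lower_bound by blast
  (* Large enough for the three cases below: small balls, balls with base point below and above height 1/2. *)
  define C where "C = top_const * 8 powr growth * (1 + 1 / top_const) * (1 + measure \<mu> UNIV / c)"
  have Cp: "0 < C" unfolding C_def using top_const_pos c by (simp add: add_pos_nonneg)
  have C1: "top_const * 8 powr growth \<le> C"
  proof -
    have "top_const * 8 powr growth * 1 * 1 \<le> C" unfolding C_def
      using top_const_pos c by (intro mult_mono) auto
    then show ?thesis by simp
  qed
  have C2: "measure \<mu> UNIV / c * (top_const * 8 powr growth) \<le> C"
  proof -
    have "top_const * 8 powr growth * 1 * (measure \<mu> UNIV / c) \<le> C" unfolding C_def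
      using top_const_pos c by (intro mult_mono) auto
    then show ?thesis by (simp add: mult_ac)
  qed
  have C3: "measure \<mu> UNIV / c \<le> C"
  proof -
    have "1 * (measure \<mu> UNIV / c) \<le> (8 powr growth * (top_const + 1)) * (1 + measure \<mu> UNIV / c)"
      using top_const_pos c growth_pos
      by (intro mult_mono) (auto simp: ge_one_powr_ge_zero intro!: mult_ge1_I )
    also have "\<dots> = C" unfolding C_def using top_const_pos by (simp add: field_simps)
    finally show ?thesis by simp
  qed
  have "measure \<mu> (ball (box_pt t \<phi>) r) \<le> C * (r / t) powr growth * measure \<mu> (carleson_box t \<phi>)"
    if t: "0 < t" "t < 1" "t \<le> r" and \<phi>: "\<phi> \<in> angles" for t r \<phi>
  proof (cases "8 * r < 1")
    case True
    have "AE \<xi> in \<mu>. \<xi> \<in> ball (box_pt t \<phi>) r \<longrightarrow> \<xi> \<in> carleson_box (8 * r) \<phi>"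
      using mu_disc
    proof eventually_elim
      fix \<xi> assume "\<xi> \<in> unit_disc"
      then show "\<xi> \<in> ball (box_pt t \<phi>) r \<longrightarrow> \<xi> \<in> carleson_box (8 * r) \<phi>"
        using ball_subset_carleson_box[of t r \<xi> \<phi>] t True by (auto simp: dist_norm norm_minus_commute)
    qed
    then have "measure \<mu> (ball (box_pt t \<phi>) r) \<le> measure \<mu> (carleson_box (8 * r) \<phi>)"
      using t True by (intro mu.finite_measure_mono_AE) (auto intro!: carleson_box_borel simp: sets_mu)
    also have "\<dots> \<le> top_const * (8 * r / t) powr growth * measure \<mu> (carleson_box t \<phi>)"
      using t True by (intro mu_carleson_box_doubling) auto
    also have "(8 * r / t) powr growth = 8 powr growth * (r / t) powr growth"
    proof -
      have "(8 * (r / t)) powr growth = 8 powr growth * (r / t) powr growth" by (rule powr_mult)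
      then show ?thesis by (simp only: times_divide_eq_right)
    qed
    also have "top_const * (8 powr growth * (r / t) powr growth) * measure \<mu> (carleson_box t \<phi>)
        \<le> C * (r / t) powr growth * measure \<mu> (carleson_box t \<phi>)"
      using C1 by (simp add: mult.assoc[symmetric] mult_right_mono)
    finally show ?thesis .
  next
    case False
    have "measure \<mu> (ball (box_pt t \<phi>) r) \<le> measure \<mu> UNIV"
      by (intro mu.finite_measure_mono) (auto simp: sets_mu)
    also have "\<dots> \<le> measure \<mu> UNIV / c * measure \<mu> (carleson_box (1/2) \<phi>)"
      using mult_left_mono[OF c(2)[OF \<phi>], of "measure \<mu> UNIV / c"] c(1) by simp
    also have "\<dots> \<le> C * (r / t) powr growth * measure \<mu> (carleson_box t \<phi>)"
    proof (cases "t \<le> 1/2")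
      case True
      have "measure \<mu> (carleson_box (1/2) \<phi>) \<le> top_const * (1/2 / t) powr growth * measure \<mu> (carleson_box t \<phi>)"
        using t True by (intro mu_carleson_box_doubling) auto
      also have "\<dots> \<le> top_const * (8 powr growth * (r / t) powr growth) * measure \<mu> (carleson_box t \<phi>)"
      proof -
        have "(1/2 / t) powr growth \<le> (8 * (r / t)) powr growth"
          using t False growth_pos by (intro powr_mono2) (auto simp: divide_simps)
        also have "\<dots> = 8 powr growth * (r / t) powr growth" by (rule powr_mult)
        finally show ?thesis using top_const_pos by (intro mult_right_mono mult_left_mono) auto
      qed
      finally have "measure \<mu> UNIV / c * measure \<mu> (carleson_box (1/2) \<phi>)
          \<le> measure \<mu> UNIV / c * (top_const * (8 powr growth * (r / t) powr growth) * measure \<mu> (carleson_box t \<phi>))"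
        using c(1) by (intro mult_left_mono) auto
      also have "\<dots> = measure \<mu> UNIV / c * (top_const * 8 powr growth) * ((r / t) powr growth * measure \<mu> (carleson_box t \<phi>))"
        by (simp add: mult_ac)
      also have "\<dots> \<le> C * ((r / t) powr growth * measure \<mu> (carleson_box t \<phi>))"
        using C2 by (intro mult_right_mono) auto
      finally show ?thesis by (simp add: mult.assoc)
    next
      case False
      have "measure \<mu> (carleson_box (1/2) \<phi>) \<le> measure \<mu> (carleson_box t \<phi>)"
        using False t carleson_box_mono[of "1/2" t \<phi>]
        by (intro mu.finite_measure_mono) (auto intro!: carleson_box_borel simp: sets_mu)
      moreover have "1 \<le> (r / t) powr growth" using t growth_pos by (intro ge_one_powr_ge_zero) auto
      then have "C * 1 \<le> C * (r / t) powr growth" using Cp by (intro mult_left_mono) auto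
      then have "measure \<mu> UNIV / c \<le> C * (r / t) powr growth" using C3 by simp
      ultimately show ?thesis using c(1) Cp by (intro mult_mono) auto
    qed
    finally show ?thesis .
  qed
  with Cp show ?thesis by blast
qed

end

lemma dyadic_scale:
  fixes b x :: real
  assumes "1 < b" "1 \<le> x"
  obtains m where "b ^ m \<le> x" "x < b ^ Suc m"
proof -
  obtain n where "x < b ^ n" using real_arch_pow[OF assms(1)] by blast
  define m where "m = (LEAST m. x < b ^ Suc m)"
  have "x < b ^ Suc n" using \<open>x < b ^ n\<close> power_increasing[of n "Suc n" b] assms by linarith
  then have m: "x < b ^ Suc m" unfolding m_def by (rule LeastI)
  have "b ^ m \<le> x"
  proof (cases m)
    case (Suc k)
    then have "\<not> x < b ^ Suc k" unfolding m_def by (metis lessI not_less_Least)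
    then show ?thesis using Suc by simp
  qed (use assms in simp)
  then show ?thesis using that m by blast
qed

lemma ennreal_le_suminf: "f m \<le> (\<Sum>m. f m)" for f :: "nat \<Rightarrow> ennreal"
  using sum_le_suminf[of f "{m}"] by simp

context regular_pair
begin

text \<open>
  At least one more than \<open>growth\<close>, to leave a factor \<open>2\<^sup>-\<^sup>m\<close> when the kernel is summed over the
  balls of radius \<open>2\<^sup>m (1 - |z|)\<close>.
\<close>

definition expo :: nat where "expo = nat \<lceil>growth\<rceil> + 1"

lemma expo_ge: "growth + 1 \<le> real expo" unfolding expo_def by linarith

text \<open>
  If a strip has at most \<open>C\<close> times the mass of its upper annulus, where
  \<open>C = 3 * 9 ^ expo * top_const\<close>, then at most the share \<open>1 - 1/C\<close> of its mass remains below. The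
  summand \<open>2\<close> keeps \<open>decay\<close> away from \<open>0\<close>.
\<close>

definition decay :: real where
  "decay = 1 - 1 / (3 * 9 ^ expo * top_const + 2)"

lemma decay_bounds: "1/2 \<le> decay" "decay < 1"
proof -
  define c where "c = 3 * 9 ^ expo * top_const"
  have "0 < c" unfolding c_def using top_const_pos by simp
  then show "1/2 \<le> decay" "decay < 1" unfolding decay_def c_def[symmetric] by (auto simp: field_simps)
qed

text \<open>
  Chosen such that the loss \<open>K\<^sup>\<epsilon>\<close> in each step towards the boundary uses up half, on the logarithmic
  scale, of the gain \<open>decay\<close>.
\<close>

definition eps :: real where "eps = ln (1 / sqrt decay) / ln K"

lemma eps_pos: "0 < eps"
  unfolding eps_def using decay_bounds K by (auto simp: real_sqrt_lt_1_iff intro!: divide_pos_pos)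

lemma K_powr_eps: "K powr eps * decay = sqrt decay"
proof -
  have d: "0 < sqrt decay" using decay_bounds by simp
  have "K powr eps = 1 / sqrt decay"
    unfolding eps_def powr_def using K d by simp
  then show ?thesis using decay_bounds by (simp add: real_div_sqrt)
qed

definition kmeas :: "complex \<Rightarrow> complex measure" where
  "kmeas z = density \<mu> (\<lambda>\<xi>. ennreal (kap z \<xi> ^ expo))"

lemma sets_kmeas[measurable_cong]: "sets (kmeas z) = sets borel"
  unfolding kmeas_def by (simp add: sets_mu)

lemma finite_kmeas: assumes "0 < gap z" shows "finite_measure (kmeas z)"
proof
  have "emeasure (kmeas z) (space (kmeas z)) = (\<integral>\<^sup>+\<xi>. ennreal (kap z \<xi> ^ expo) \<partial>\<mu>)"
    unfolding kmeas_def by (subst emeasure_density) (auto simp: space_density intro!: nn_integral_cong)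
  also have "\<dots> \<le> (\<integral>\<^sup>+\<xi>. 1 \<partial>\<mu>)"
    using kap_bounds[OF assms] by (intro nn_integral_mono) (auto simp: power_le_one less_imp_le)
  also have "\<dots> < \<infinity>" using mu.emeasure_finite[of "space \<mu>"] by (simp add: less_top[symmetric])
  finally show "emeasure (kmeas z) (space (kmeas z)) \<noteq> \<infinity>" by simp
qed

lemma emeasure_kmeas: "E \<in> sets borel \<Longrightarrow> emeasure (kmeas z) E = (\<integral>\<^sup>+\<xi>\<in>E. ennreal (kap z \<xi> ^ expo) \<partial>\<mu>)"
  unfolding kmeas_def by (subst emeasure_density) (auto simp: sets_mu)

text \<open>
  On each square of height \<open>t \<le> 1 - |z|\<close> the kernel is constant up to a factor, so the comparison of
  a square with its upper part survives multiplication by the kernel. Averaging over rotations turns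
  it into one of strips with annuli.
\<close>

lemma kmeas_annulus:
  assumes t: "0 < t" "t \<le> gap z" "t < 1"
  shows "measure (kmeas z) (strip t) \<le> 3 * 9 ^ expo * top_const * measure (kmeas z) (annulus t)"
proof -
  have gz: "0 < gap z" using t by simp
  interpret k: finite_measure "kmeas z" by (rule finite_kmeas[OF gz])
  have h: "0 < t" "t < 1" using t by auto
  note box = carleson_box_average[OF finite_mu sets_mu _ h]
  note [measurable] = carleson_box_borel[OF h]
  have m: "(\<lambda>\<xi>. ennreal (kap z \<xi> ^ expo)) \<in> borel_measurable borel" by measurable
  define c where "c = 9 ^ expo * top_const"
  have c: "0 \<le> c" unfolding c_def using top_const_pos by simp
  have pt: "(\<integral>\<^sup>+\<xi>\<in>carleson_box t \<phi>. ennreal (kap z \<xi> ^ expo) \<partial>\<mu>)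
      \<le> ennreal c * (\<integral>\<^sup>+\<xi>\<in>carleson_box t \<phi>. ennreal (kap z \<xi> ^ expo) * indicator (annulus t) \<xi> \<partial>\<mu>)" for \<phi>
  proof -
    define a where "a = kap z (box_pt t \<phi>) ^ expo"
    have kp: "0 < kap z \<xi>" for \<xi> using kap_bounds(1)[OF gz] .
    have a0: "0 \<le> a" unfolding a_def using kp by (simp add: less_imp_le)
    have up: "kap z \<xi> ^ expo \<le> 3 ^ expo * a" and low: "a \<le> 3 ^ expo * kap z \<xi> ^ expo"
      if "\<xi> \<in> carleson_box t \<phi>" for \<xi>
      using power_mono[OF kap_carleson_box(1)[OF h that t(2)], of expo]
        power_mono[OF kap_carleson_box(2)[OF h that t(2)], of expo] kp
      unfolding a_def power_mult_distrib by (simp_all add: less_imp_le)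
    have "(\<integral>\<^sup>+\<xi>\<in>carleson_box t \<phi>. ennreal (kap z \<xi> ^ expo) \<partial>\<mu>)
        \<le> (\<integral>\<^sup>+\<xi>. ennreal (3 ^ expo * a) * indicator (carleson_box t \<phi>) \<xi> \<partial>\<mu>)"
      using up by (intro nn_integral_mono) (auto simp: indicator_def intro!: ennreal_leI)
    also have "\<dots> = ennreal (3 ^ expo * a * measure \<mu> (carleson_box t \<phi>))"
      using a0 by (subst nn_integral_cmult_indicator) (auto simp: mu.emeasure_eq_measure ennreal_mult' sets_mu)
    also have "\<dots> \<le> ennreal (3 ^ expo * top_const * (a * measure \<mu> (carleson_box t \<phi> \<inter> annulus t)))"
      using mult_left_mono[OF mu_carleson_box_le_top[OF h, of \<phi>], of "3 ^ expo * a"] a0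
      by (intro ennreal_leI) (simp add: mult_ac)
    also have "\<dots> = ennreal (3 ^ expo * top_const) * (\<integral>\<^sup>+\<xi>. ennreal a * indicator (carleson_box t \<phi> \<inter> annulus t) \<xi> \<partial>\<mu>)"
      using a0 top_const_pos by (subst nn_integral_cmult_indicator) (auto simp: mu.emeasure_eq_measure ennreal_mult' sets_mu)
    also have "\<dots> \<le> ennreal (3 ^ expo * top_const) *
        (\<integral>\<^sup>+\<xi>. ennreal (3 ^ expo) * (ennreal (kap z \<xi> ^ expo) * indicator (annulus t) \<xi> * indicator (carleson_box t \<phi>) \<xi>) \<partial>\<mu>)"
      using low kp by (intro mult_left_mono nn_integral_mono)
        (auto simp: indicator_def ennreal_mult'[symmetric] less_imp_le intro!: ennreal_leI)
    also have "\<dots> = ennreal (3 ^ expo * top_const) * (ennreal (3 ^ expo) *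
        (\<integral>\<^sup>+\<xi>. (ennreal (kap z \<xi> ^ expo) * indicator (annulus t) \<xi> * indicator (carleson_box t \<phi>) \<xi>) \<partial>\<mu>))"
      by (subst nn_integral_cmult) auto
    also have "\<dots> = ennreal (3 ^ expo * top_const * 3 ^ expo) *
        (\<integral>\<^sup>+\<xi>. (ennreal (kap z \<xi> ^ expo) * indicator (annulus t) \<xi> * indicator (carleson_box t \<phi>) \<xi>) \<partial>\<mu>)"
      using top_const_pos by (simp only: mult.assoc[symmetric], subst ennreal_mult''[symmetric]) auto
    also have "3 ^ expo * top_const * 3 ^ expo = c"
      unfolding c_def by (simp add: power_mult_distrib[symmetric] mult_ac)
    finally show ?thesis .
  qed
  have "ennreal t * emeasure (kmeas z) (strip t)
      \<le> (\<integral>\<^sup>+\<phi>\<in>angles. (\<integral>\<^sup>+\<xi>\<in>carleson_box t \<phi>. ennreal (kap z \<xi> ^ expo) \<partial>\<mu>) \<partial>lborel)"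
    unfolding emeasure_kmeas[OF strip_borel] using box(1)[OF m] unfolding strip_def .
  also have "\<dots> \<le> (\<integral>\<^sup>+\<phi>. ennreal c * ((\<integral>\<^sup>+\<xi>\<in>carleson_box t \<phi>. ennreal (kap z \<xi> ^ expo) * indicator (annulus t) \<xi> \<partial>\<mu>) * indicator angles \<phi>) \<partial>lborel)"
    using pt by (intro nn_integral_mono) (auto simp: indicator_def)
  also have "\<dots> = ennreal c * (\<integral>\<^sup>+\<phi>\<in>angles. (\<integral>\<^sup>+\<xi>\<in>carleson_box t \<phi>. ennreal (kap z \<xi> ^ expo) * indicator (annulus t) \<xi> \<partial>\<mu>) \<partial>lborel)"
    by (intro nn_integral_cmult borel_measurable_times_ennreal) (auto intro!: box(3))
  also have "\<dots> \<le> ennreal c * (ennreal (3 * t) * (\<integral>\<^sup>+\<xi>\<in>strip t. ennreal (kap z \<xi> ^ expo) * indicator (annulus t) \<xi> \<partial>\<mu>))"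
    unfolding strip_def by (intro mult_left_mono box(2)) auto
  also have "(\<integral>\<^sup>+\<xi>\<in>strip t. ennreal (kap z \<xi> ^ expo) * indicator (annulus t) \<xi> \<partial>\<mu>) = emeasure (kmeas z) (annulus t)"
    unfolding emeasure_kmeas[OF annulus_borel] using annulus_subset_strip[OF t(1)]
    by (intro nn_integral_cong) (auto simp: indicator_def)
  finally have "ennreal t * ennreal (measure (kmeas z) (strip t)) \<le> ennreal c * (ennreal (3 * t) * ennreal (measure (kmeas z) (annulus t)))"
    unfolding k.emeasure_eq_measure .
  then have "t * measure (kmeas z) (strip t) \<le> c * (3 * t * measure (kmeas z) (annulus t))"
    using t c by (simp add: ennreal_mult'[symmetric] ennreal_mult''[symmetric] ennreal_le_iff)
  then show ?thesis using t unfolding c_def by (simp add: field_simps)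
qed

lemma kmeas_strip_decay:
  assumes t: "0 < t" "t \<le> gap z" "t < 1"
  shows "measure (kmeas z) (strip (t / K ^ m)) \<le> decay ^ m * measure (kmeas z) (strip t)"
proof (induction m)
  case (Suc m)
  have gz: "0 < gap z" using t by simp
  interpret k: finite_measure "kmeas z" by (rule finite_kmeas[OF gz])
  define s where "s = t / K ^ m"
  have "s \<le> t" unfolding s_def using K t by (simp add: divide_le_eq mult_le_cancel_left1)
  moreover have "0 < s" using t K unfolding s_def by simp
  ultimately have s: "0 < s" "s \<le> gap z" "s < 1" using t by linarith+
  define C where "C = 3 * 9 ^ expo * top_const"
  have C: "0 < C" unfolding C_def using top_const_pos by simp
  have sK: "0 < s / K" "s / K < s" using s K by (auto simp: divide_less_eq)
  have "strip s = annulus s \<union> strip (s / K)" "annulus s \<inter> strip (s / K) = {}"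
    using sK unfolding strip_def annulus_def by auto
  then have eq: "measure (kmeas z) (strip s) = measure (kmeas z) (annulus s) + measure (kmeas z) (strip (s / K))"
    by (simp add: k.finite_measure_Union sets_kmeas)
  have "measure (kmeas z) (strip s) \<le> C * measure (kmeas z) (annulus s)"
    unfolding C_def by (rule kmeas_annulus[OF s])
  also have "\<dots> \<le> (C + 2) * measure (kmeas z) (annulus s)" by (intro mult_right_mono) auto
  finally have lower: "measure (kmeas z) (strip s) / (C + 2) \<le> measure (kmeas z) (annulus s)"
    using C by (simp add: divide_le_eq mult.commute)
  have "measure (kmeas z) (strip (s / K)) \<le> decay * measure (kmeas z) (strip s)"
  proof -
    have "decay * measure (kmeas z) (strip s) = measure (kmeas z) (strip s) - measure (kmeas z) (strip s) / (C + 2)"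
      unfolding decay_def C_def[symmetric] by (simp add: left_diff_distrib)
    with eq show ?thesis
      using lower by linarith
  qed
  also have "\<dots> \<le> decay * (decay ^ m * measure (kmeas z) (strip t))"
    using Suc decay_bounds unfolding s_def by (intro mult_left_mono) auto
  finally show ?case unfolding s_def by (simp add: mult_ac)
qed simp

text \<open>
  The mass that \<open>\<mu>\<close> has near \<open>z\<close>, with the integrand made larger towards the boundary. The weight
  \<open>(1 - |\<xi>|)\<^sup>-\<^sup>\<epsilon>\<close> does not change its order of magnitude but provides the room for the geometric
  loss in \<open>pointwise_by_derivative\<close>.
\<close>

definition W :: "complex \<Rightarrow> ennreal" where
  "W z = (\<integral>\<^sup>+\<xi>. ennreal (kap z \<xi> ^ expo * (gap z / gap \<xi>) powr eps) \<partial>\<mu>)"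

text \<open>
  Off the strip of height \<open>t = (1 - |z|)/2\<close> the additional factor is bounded. Inside, the strip of
  height \<open>t / K\<^sup>m\<close> contributes at most the share \<open>(K\<^sup>\<epsilon>)\<^sup>m decay\<^sup>m\<close>, up to a constant, and by the
  choice of \<open>\<epsilon>\<close> these shares form a convergent geometric series.
\<close>

lemma W_le_kmeas: "\<exists>C>0. \<forall>z\<in>unit_disc. W z \<le> ennreal (C * measure (kmeas z) UNIV)"
proof -
  define G where "G = K powr eps"
  have G: "1 < G" unfolding G_def using K eps_pos by simp
  have Gd: "G * decay = sqrt decay" unfolding G_def by (rule K_powr_eps)
  have sd: "0 < sqrt decay" "sqrt decay < 1" using decay_bounds by auto
  define C where "C = 2 powr eps * (1 + G * (1 / (1 - sqrt decay)))"
  have "0 < C" unfolding C_def using G sd by (intro mult_pos_pos add_pos_pos) auto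
  moreover have "W z \<le> ennreal (C * measure (kmeas z) UNIV)" if z: "z \<in> unit_disc" for z
  proof -
    have gz: "0 < gap z" using z by (rule gap_pos)
    interpret k: finite_measure "kmeas z" by (rule finite_kmeas[OF gz])
    define t where "t = gap z / 2"
    have t: "0 < t" "t \<le> gap z" "t < 1" unfolding t_def using gz gap_le_1[of z] by auto
    have Km: "0 < K ^ m" for m using K by simp
    have pt: "ennreal ((gap z / gap \<xi>) powr eps)
       \<le> ennreal (2 powr eps) * (1 + (\<Sum>m. ennreal (G ^ Suc m) * indicator (strip (t / K ^ m)) \<xi>))"
      if \<xi>: "\<xi> \<in> unit_disc" for \<xi>
    proof -
      have g: "0 < gap \<xi>" using \<xi> by (rule gap_pos)
      have split: "(gap z / gap \<xi>) powr eps = 2 powr eps * (t / gap \<xi>) powr eps"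
      proof -
        have "gap z / gap \<xi> = 2 * (t / gap \<xi>)" unfolding t_def by simp
        moreover have "(2 * (t / gap \<xi>)) powr eps = 2 powr eps * (t / gap \<xi>) powr eps"
          by (rule powr_mult)
        ultimately show ?thesis by (simp only:)
      qed
      show ?thesis
      proof (cases "t / gap \<xi> < 1")
        case True
        then have "(t / gap \<xi>) powr eps \<le> 1" using t g eps_pos by (simp add: powr_le1)
        then have "ennreal ((gap z / gap \<xi>) powr eps) \<le> ennreal (2 powr eps) * 1"
          unfolding split by (auto intro!: ennreal_leI)
        also have "\<dots> \<le> ennreal (2 powr eps) * (1 + (\<Sum>m. ennreal (G ^ Suc m) * indicator (strip (t / K ^ m)) \<xi>))"
          by (intro mult_left_mono) auto
        finally show ?thesis .
      next
        case False
        then obtain m where m: "K ^ m \<le> t / gap \<xi>" "t / gap \<xi> < K ^ Suc m"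
          using dyadic_scale[OF K, of "t / gap \<xi>"] by auto
        have "gap \<xi> \<le> t / K ^ m" using m(1) g Km[of m] by (simp add: field_simps)
        then have in_strip: "\<xi> \<in> strip (t / K ^ m)" using \<xi> unfolding strip_def gap_def by auto
        have "(t / gap \<xi>) powr eps \<le> (K ^ Suc m) powr eps"
          using m(2) t g eps_pos by (intro powr_mono2) auto
        also have "\<dots> = G ^ Suc m"
        proof -
          have "(K ^ Suc m) powr eps = (K powr real (Suc m)) powr eps"
            using K by (subst powr_realpow) auto
          also have "\<dots> = G powr real (Suc m)" unfolding G_def powr_powr by (simp only: mult.commute)
          also have "\<dots> = G ^ Suc m" using G by (intro powr_realpow) auto
          finally show ?thesis .
        qed
        finally have "ennreal ((t / gap \<xi>) powr eps) \<le> ennreal (G ^ Suc m) * indicator (strip (t / K ^ m)) \<xi>"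
          using in_strip by (simp add: ennreal_leI del: power_Suc)
        also have "\<dots> \<le> (\<Sum>m. ennreal (G ^ Suc m) * indicator (strip (t / K ^ m)) \<xi>)"
          by (rule ennreal_le_suminf)
        also have "\<dots> \<le> 1 + \<dots>" by simp
        finally show ?thesis unfolding split by (simp add: ennreal_mult' mult_left_mono)
      qed
    qed
    have "W z = (\<integral>\<^sup>+\<xi>. ennreal ((gap z / gap \<xi>) powr eps) \<partial>kmeas z)"
      unfolding W_def kmeas_def
      by (subst nn_integral_density) (auto simp: ennreal_mult'' intro!: nn_integral_cong)
    also have "\<dots> \<le> (\<integral>\<^sup>+\<xi>. ennreal (2 powr eps) * (1 + (\<Sum>m. ennreal (G ^ Suc m) * indicator (strip (t / K ^ m)) \<xi>)) \<partial>kmeas z)"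
    proof (rule nn_integral_mono_AE)
      have "AE \<xi> in kmeas z. \<xi> \<in> unit_disc"
        unfolding kmeas_def by (subst AE_density) (use mu_disc in auto)
      then show "AE \<xi> in kmeas z. ennreal ((gap z / gap \<xi>) powr eps)
         \<le> ennreal (2 powr eps) * (1 + (\<Sum>m. ennreal (G ^ Suc m) * indicator (strip (t / K ^ m)) \<xi>))"
        by eventually_elim (rule pt)
    qed
    also have "\<dots> = ennreal (2 powr eps) * (emeasure (kmeas z) UNIV + (\<Sum>m. ennreal (G ^ Suc m) * emeasure (kmeas z) (strip (t / K ^ m))))"
    proof -
      have "(\<integral>\<^sup>+\<xi>. 1 + (\<Sum>m. ennreal (G ^ Suc m) * indicator (strip (t / K ^ m)) \<xi>) \<partial>kmeas z)
         = (\<integral>\<^sup>+\<xi>. 1 \<partial>kmeas z) + (\<integral>\<^sup>+\<xi>. (\<Sum>m. ennreal (G ^ Suc m) * indicator (strip (t / K ^ m)) \<xi>) \<partial>kmeas z)"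
        by (rule nn_integral_add) measurable
      also have "(\<integral>\<^sup>+\<xi>. (\<Sum>m. ennreal (G ^ Suc m) * indicator (strip (t / K ^ m)) \<xi>) \<partial>kmeas z)
         = (\<Sum>m. \<integral>\<^sup>+\<xi>. ennreal (G ^ Suc m) * indicator (strip (t / K ^ m)) \<xi> \<partial>kmeas z)"
        by (rule nn_integral_suminf) measurable
      also have "\<dots> = (\<Sum>m. ennreal (G ^ Suc m) * emeasure (kmeas z) (strip (t / K ^ m)))"
        by (intro suminf_cong nn_integral_cmult_indicator) (simp add: sets_kmeas)
      also have "(\<integral>\<^sup>+\<xi>. 1 \<partial>kmeas z) = emeasure (kmeas z) UNIV"
        using sets_eq_imp_space_eq[OF sets_kmeas[of z]] by simp
      finally show ?thesis by (subst nn_integral_cmult) (simp, measurable)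
    qed
    also have "\<dots> \<le> ennreal (2 powr eps) * (ennreal (measure (kmeas z) UNIV)
        + (\<Sum>m. ennreal (G * sqrt decay ^ m * measure (kmeas z) UNIV)))"
    proof (intro mult_left_mono add_mono suminf_le summableI)
      fix m
      have "measure (kmeas z) (strip (t / K ^ m)) \<le> decay ^ m * measure (kmeas z) (strip t)"
        by (rule kmeas_strip_decay[OF t])
      also have "\<dots> \<le> decay ^ m * measure (kmeas z) UNIV"
        using decay_bounds by (intro mult_left_mono k.finite_measure_mono) (auto simp: sets_kmeas)
      finally have "G ^ Suc m * measure (kmeas z) (strip (t / K ^ m)) \<le> G ^ Suc m * (decay ^ m * measure (kmeas z) UNIV)"
        using G by (intro mult_left_mono) auto
      also have "\<dots> = G * (G * decay) ^ m * measure (kmeas z) UNIV" by (simp add: power_mult_distrib)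
      finally have "G ^ Suc m * measure (kmeas z) (strip (t / K ^ m)) \<le> G * sqrt decay ^ m * measure (kmeas z) UNIV"
        unfolding Gd .
      then show "ennreal (G ^ Suc m) * emeasure (kmeas z) (strip (t / K ^ m)) \<le> ennreal (G * sqrt decay ^ m * measure (kmeas z) UNIV)"
        using G unfolding k.emeasure_eq_measure by (simp add: ennreal_mult'[symmetric] ennreal_leI)
    qed (auto simp: k.emeasure_eq_measure)
    also have "(\<Sum>m. ennreal (G * sqrt decay ^ m * measure (kmeas z) UNIV))
        = ennreal (G * (1 / (1 - sqrt decay)) * measure (kmeas z) UNIV)"
    proof (rule suminf_ennreal_eq)
      have "(\<lambda>m. sqrt decay ^ m) sums (1 / (1 - sqrt decay))" using sd by (intro geometric_sums) auto
      then show "(\<lambda>m. G * sqrt decay ^ m * measure (kmeas z) UNIV) sums (G * (1 / (1 - sqrt decay)) * measure (kmeas z) UNIV)"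
        by (intro sums_mult sums_mult2)
    qed (use G sd in auto)
    also have "ennreal (2 powr eps) * (ennreal (measure (kmeas z) UNIV) + ennreal (G * (1 / (1 - sqrt decay)) * measure (kmeas z) UNIV))
       = ennreal (C * measure (kmeas z) UNIV)"
      using G sd unfolding C_def by (simp add: ennreal_mult'[symmetric] ennreal_plus[symmetric] algebra_simps del: ennreal_plus)
    finally show ?thesis .
  qed
  ultimately show ?thesis by blast
qed

text \<open>
  The kernel is at most \<open>2\<^sup>1\<^sup>-\<^sup>m\<close> outside the ball of radius \<open>2\<^sup>m\<^sup>-\<^sup>1 t\<close>; its power \<open>expo\<close> beats the
  growth of \<open>\<mu>\<close> on these balls.
\<close>

lemma kmeas_le_mu: "\<exists>C>0. \<forall>t \<phi>. 0 < t \<and> t < 1 \<and> \<phi> \<in> angles \<longrightarrow>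
  measure (kmeas (box_pt t \<phi>)) UNIV \<le> C * measure \<mu> (carleson_box t \<phi>)"
proof -
  obtain C where C: "0 < C" "\<And>t r \<phi>. 0 < t \<Longrightarrow> t < 1 \<Longrightarrow> t \<le> r \<Longrightarrow> \<phi> \<in> angles \<Longrightarrow>
    measure \<mu> (ball (box_pt t \<phi>) r) \<le> C * (r / t) powr growth * measure \<mu> (carleson_box t \<phi>)"
    using mu_ball_le by blast
  have "measure (kmeas (box_pt t \<phi>)) UNIV \<le> (2 ^ expo * C * 2) * measure \<mu> (carleson_box t \<phi>)"
    if t: "0 < t" "t < 1" and \<phi>: "\<phi> \<in> angles" for t \<phi>
  proof -
    define a where "a = box_pt t \<phi>"
    have ga: "gap a = t" unfolding a_def using t by (simp add: gap_box_pt)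
    interpret k: finite_measure "kmeas a" by (rule finite_kmeas) (use ga t in simp)
    have pt: "ennreal (kap a \<xi> ^ expo) \<le> (\<Sum>m. ennreal ((2 / 2 ^ m) ^ expo) * indicator (ball a (2 ^ m * t)) \<xi>)" for \<xi>
    proof -
      have kp: "0 < kap a \<xi>" "kap a \<xi> \<le> 1" using kap_bounds[of a \<xi>] ga t by auto
      have "\<exists>m. cmod (a - \<xi>) < 2 ^ m * t \<and> kap a \<xi> \<le> 2 / 2 ^ m"
      proof (cases "cmod (a - \<xi>) < t")
        case True
        then show ?thesis using kp by (intro exI[of _ 0]) auto
      next
        case False
        then obtain m where m: "2 ^ m \<le> cmod (a - \<xi>) / t" "cmod (a - \<xi>) / t < 2 ^ Suc m"
          using dyadic_scale[of 2 "cmod (a - \<xi>) / t"] t by auto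
        have m': "2 ^ m * t \<le> cmod (a - \<xi>)" using m t by (simp add: field_simps)
        have mp: "0 < 2 ^ m * t" using t by simp
        have "0 < t + cmod (a - \<xi>)" using t(1) norm_ge_zero[of "a - \<xi>"] by linarith
        then have "kap a \<xi> \<le> t / (2 ^ m * t)"
          unfolding kap_def ga using t m' by (intro frac_le) auto
        also have "\<dots> = 2 / 2 ^ Suc m" using t by simp
        finally show ?thesis using m(2) t by (intro exI[of _ "Suc m"]) (simp add: field_simps)
      qed
      then obtain m where m: "cmod (a - \<xi>) < 2 ^ m * t" "kap a \<xi> \<le> 2 / 2 ^ m" by blast
      have "ennreal (kap a \<xi> ^ expo) \<le> ennreal ((2 / 2 ^ m) ^ expo) * indicator (ball a (2 ^ m * t)) \<xi>"
        using m kp by (auto simp: dist_norm intro!: ennreal_leI power_mono)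
      also have "\<dots> \<le> (\<Sum>m. ennreal ((2 / 2 ^ m) ^ expo) * indicator (ball a (2 ^ m * t)) \<xi>)"
        by (rule ennreal_le_suminf)
      finally show ?thesis .
    qed
    have "ennreal (measure (kmeas a) UNIV) = (\<integral>\<^sup>+\<xi>. ennreal (kap a \<xi> ^ expo) \<partial>\<mu>)"
      using emeasure_kmeas[of UNIV a] by (simp add: k.emeasure_eq_measure)
    also have "\<dots> \<le> (\<integral>\<^sup>+\<xi>. (\<Sum>m. ennreal ((2 / 2 ^ m) ^ expo) * indicator (ball a (2 ^ m * t)) \<xi>) \<partial>\<mu>)"
      using pt by (intro nn_integral_mono)
    also have "\<dots> = (\<Sum>m. \<integral>\<^sup>+\<xi>. ennreal ((2 / 2 ^ m) ^ expo) * indicator (ball a (2 ^ m * t)) \<xi> \<partial>\<mu>)"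
      by (rule nn_integral_suminf)
         (intro borel_measurable_times_ennreal borel_measurable_const borel_measurable_indicator, simp add: sets_mu)
    also have "\<dots> = (\<Sum>m. ennreal ((2 / 2 ^ m) ^ expo * measure \<mu> (ball a (2 ^ m * t))))"
      by (intro suminf_cong, subst nn_integral_cmult_indicator)
         (auto simp: sets_mu mu.emeasure_eq_measure ennreal_mult')
    also have "\<dots> \<le> (\<Sum>m. ennreal (2 ^ expo * C * measure \<mu> (carleson_box t \<phi>) * (1/2) ^ m))"
    proof (intro suminf_le summableI ennreal_leI)
      fix m
      have "measure \<mu> (ball a (2 ^ m * t)) \<le> C * (2 ^ m * t / t) powr growth * measure \<mu> (carleson_box t \<phi>)"
        unfolding a_def using C(2)[OF t, of "2 ^ m * t" \<phi>] t \<phi> by simp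
      then have "(2 / 2 ^ m) ^ expo * measure \<mu> (ball a (2 ^ m * t))
          \<le> (2 / 2 ^ m) ^ expo * (C * (2 ^ m * t / t) powr growth * measure \<mu> (carleson_box t \<phi>))"
        by (intro mult_left_mono) auto
      also have "\<dots> = 2 ^ expo * C * measure \<mu> (carleson_box t \<phi>) * ((2 ^ m) powr growth / (2 ^ m) ^ expo)"
        using t by (simp add: power_divide)
      also have "(2 ^ m) powr growth / (2 ^ m) ^ expo \<le> ((1/2) ^ m :: real)"
      proof -
        have "(2 ^ m :: real) ^ expo = (2 ^ m) powr real expo" by (simp add: powr_realpow)
        then have "(2 ^ m) powr growth / (2 ^ m :: real) ^ expo = (2 ^ m) powr (growth - real expo)"
          by (simp add: powr_diff)
        also have "\<dots> \<le> (2 ^ m) powr (-1)" using expo_ge by (intro powr_mono) auto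
        also have "\<dots> = (1/2) ^ m" using powr_minus[of "2 ^ m :: real" 1] power_one_over[of "2::real" m]
          by (simp only: powr_one inverse_eq_divide zero_le_power zero_le_numeral)
        finally show ?thesis .
      qed
      finally show "(2 / 2 ^ m) ^ expo * measure \<mu> (ball a (2 ^ m * t))
          \<le> 2 ^ expo * C * measure \<mu> (carleson_box t \<phi>) * (1/2) ^ m"
        using C(1) by (simp add: mult_left_mono)
    qed
    also have "\<dots> = ennreal (2 ^ expo * C * measure \<mu> (carleson_box t \<phi>) * 2)"
    proof (rule suminf_ennreal_eq)
      have "(\<lambda>m. (1/2::real) ^ m) sums 2" using geometric_sums[of "1/2::real"] by simp
      then show "(\<lambda>m. 2 ^ expo * C * measure \<mu> (carleson_box t \<phi>) * (1/2) ^ m) sums (2 ^ expo * C * measure \<mu> (carleson_box t \<phi>) * 2)"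
        by (rule sums_mult)
    qed (use C in auto)
    finally have "measure (kmeas a) UNIV \<le> 2 ^ expo * C * measure \<mu> (carleson_box t \<phi>) * 2"
      using C(1) by (subst (asm) ennreal_le_iff) auto
    then show ?thesis unfolding a_def by (simp add: mult_ac)
  qed
  with C(1) show ?thesis by (intro exI[of _ "2 ^ expo * C * 2"]) auto
qed

lemma W_box_bound: "\<exists>C>0. \<forall>t \<phi>. 0 < t \<and> t < 1 \<and> \<phi> \<in> angles \<longrightarrow>
  W (box_pt t \<phi>) \<le> ennreal (C * measure \<mu> (carleson_box t \<phi>))"
proof -
  obtain C1 where C1: "0 < C1" "\<And>z. z \<in> unit_disc \<Longrightarrow> W z \<le> ennreal (C1 * measure (kmeas z) UNIV)"
    using W_le_kmeas by blast
  obtain C2 where C2: "0 < C2" "\<And>t \<phi>. 0 < t \<Longrightarrow> t < 1 \<Longrightarrow> \<phi> \<in> angles \<Longrightarrow>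
      measure (kmeas (box_pt t \<phi>)) UNIV \<le> C2 * measure \<mu> (carleson_box t \<phi>)"
    using kmeas_le_mu by blast
  have "W (box_pt t \<phi>) \<le> ennreal (C1 * C2 * measure \<mu> (carleson_box t \<phi>))"
    if t: "0 < t" "t < 1" "\<phi> \<in> angles" for t \<phi>
  proof -
    have "W (box_pt t \<phi>) \<le> ennreal (C1 * measure (kmeas (box_pt t \<phi>)) UNIV)"
      using box_pt_in[OF t(1,2), of \<phi>] by (intro C1) auto
    also have "\<dots> \<le> ennreal (C1 * (C2 * measure \<mu> (carleson_box t \<phi>)))"
      using C1(1) C2(2)[OF t] by (intro ennreal_leI mult_left_mono) auto
    finally show ?thesis by (simp add: mult_ac)
  qed
  with C1(1) C2(1) show ?thesis by (intro exI[of _ "C1 * C2"]) auto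
qed

end

section \<open>The sub-mean value inequality for the weight\<close>

lemma nn_integral_angles_le:
  assumes f[measurable]: "f \<in> borel_measurable borel" and per: "\<And>\<phi>. f (\<phi> - 2 * pi) = f \<phi>"
  shows "(\<integral>\<^sup>+\<phi>\<in>angles. f \<phi> \<partial>lborel) \<le> 2 * (\<integral>\<^sup>+\<phi>\<in>{0..2*pi}. f \<phi> \<partial>lborel)"
proof -
  have "(\<integral>\<^sup>+\<phi>\<in>angles. f \<phi> \<partial>lborel)
      \<le> (\<integral>\<^sup>+\<phi>. f \<phi> * indicator {0..2*pi} \<phi> + f \<phi> * indicator {-(2*pi)..0} \<phi> \<partial>lborel)"
    by (intro nn_integral_mono) (auto simp: indicator_def)
  also have "\<dots> = (\<integral>\<^sup>+\<phi>\<in>{0..2*pi}. f \<phi> \<partial>lborel) + (\<integral>\<^sup>+\<phi>\<in>{-(2*pi)..0}. f \<phi> \<partial>lborel)"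
    by (rule nn_integral_add) measurable
  also have "(\<integral>\<^sup>+\<phi>\<in>{-(2*pi)..0}. f \<phi> \<partial>lborel)
      = (\<integral>\<^sup>+\<phi>. f (-(2*pi) + 1 * \<phi>) * indicator {-(2*pi)..0} (-(2*pi) + 1 * \<phi>) \<partial>lborel)"
    by (subst nn_integral_real_affine[where c=1 and t="-(2*pi)"]) auto
  also have "\<dots> = (\<integral>\<^sup>+\<phi>\<in>{0..2*pi}. f \<phi> \<partial>lborel)"
  proof (rule nn_integral_cong)
    fix \<phi> :: real
    have "f (-(2*pi) + 1 * \<phi>) = f \<phi>" using per[of \<phi>] by (simp add: algebra_simps)
    then show "f (-(2*pi) + 1 * \<phi>) * indicator {-(2*pi)..0} (-(2*pi) + 1 * \<phi>) = f \<phi> * indicator {0..2*pi} \<phi>"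
      by (simp add: indicator_def)
  qed
  finally show ?thesis by (simp only: mult_2)
qed

lemma nn_integral_indicator_swap:
  fixes f :: "real \<Rightarrow> real"
  shows "(\<integral>\<^sup>+x. ennreal (indicator A x * f x) \<partial>M) = (\<integral>\<^sup>+x\<in>A. ennreal (f x) \<partial>M)"
  by (intro nn_integral_cong) (auto simp: indicator_def)

text \<open>
  Base points at height \<open>h = (1 - |w|)/2\<close> lie on a circle outside \<open>w\<close>, where \<open>kap w\<close> squared is at
  most \<open>16 h\<close> times a Poisson kernel. This is why two powers of the kernel are split off in
  \<open>box_Hoelder\<close>.
\<close>

lemma kap_box_pt_integral:
  assumes w: "w \<in> unit_disc"
  shows "(\<integral>\<^sup>+\<phi>\<in>angles. ennreal (kap w (box_pt (gap w / 2) \<phi>) ^ 2) \<partial>lborel) \<le> ennreal (32 * pi * gap w)"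
proof -
  define h where "h = gap w / 2"
  have g: "0 < gap w" using w by (rule gap_pos)
  have h: "0 < h" "h \<le> 1/2" "gap w = 2 * h" using g gap_le_1[of w] unfolding h_def by auto
  (* Rescaling the circle of radius \<open>1 - h\<close> to the unit circle moves \<open>w\<close> to \<open>x\<close>. *)
  define x where "x = w / of_real (1 - h)"
  have nw: "cmod w = 1 - 2 * h" using h unfolding gap_def by simp
  have nx: "cmod x = (1 - 2 * h) / (1 - h)" unfolding x_def norm_divide norm_of_real nw using h by simp
  have x1: "cmod x < 1" unfolding nx using h by simp
  define P where "P \<phi> = (1 - (cmod x)\<^sup>2) / (cmod (cis \<phi> - x))\<^sup>2" for \<phi>
  have P0: "0 \<le> P \<phi>" for \<phi> unfolding P_def using x1 by (simp add: power_le_one)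
  have Pint: "(\<integral>\<^sup>+\<phi>\<in>{0..2*pi}. ennreal (P \<phi>) \<partial>lborel) = ennreal (2 * pi)"
    using nn_integral_has_integral_lebesgue[OF P0 Poisson_kernel_integral[OF x1, folded P_def]]
    by (simp only: nn_integral_indicator_swap)
  have Pm[measurable]: "P \<in> borel_measurable borel" unfolding P_def by measurable
  have pt: "kap w (box_pt h \<phi>) ^ 2 \<le> 16 * h * P \<phi>" for \<phi>
  proof -
    have eq: "w - box_pt h \<phi> = of_real (1 - h) * (x - cis \<phi>)"
    proof -
      have "complex_of_real (1 - h) \<noteq> 0" unfolding of_real_eq_0_iff using h by simp
      then have "of_real (1 - h) * x = w" unfolding x_def by simp
      then show ?thesis unfolding box_pt_def by (simp only: right_diff_distrib)
    qed
    have d: "cmod (w - box_pt h \<phi>) = (1 - h) * cmod (cis \<phi> - x)"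
      unfolding eq norm_mult norm_of_real using h by (simp add: norm_minus_commute)
    have pos: "0 < cmod (cis \<phi> - x)" using cis_neq_disc[OF x1] by simp
    have "kap w (box_pt h \<phi>) \<le> gap w / cmod (w - box_pt h \<phi>)"
      unfolding kap_def d using g pos h by (intro frac_le) auto
    also have "\<dots> \<le> 2 * gap w / cmod (cis \<phi> - x)"
    proof -
      have "1/2 * cmod (cis \<phi> - x) \<le> (1 - h) * cmod (cis \<phi> - x)"
        using h pos by (intro mult_right_mono) auto
      then have "gap w / ((1 - h) * cmod (cis \<phi> - x)) \<le> gap w / (1/2 * cmod (cis \<phi> - x))"
        using g pos h by (intro frac_le) auto
      then show ?thesis unfolding d by (simp add: mult.commute)
    qed
    finally have "kap w (box_pt h \<phi>) ^ 2 \<le> (2 * gap w / cmod (cis \<phi> - x)) ^ 2"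
      using kap_bounds(1)[OF g] by (intro power_mono) (auto simp: less_imp_le)
    also have "\<dots> = 16 * h * (h / (cmod (cis \<phi> - x))\<^sup>2)" using h by (simp add: power_divide power2_eq_square)
    also have "\<dots> \<le> 16 * h * P \<phi>"
    proof -
      have "(cmod x)\<^sup>2 \<le> cmod x * 1" unfolding power2_eq_square using x1 by (intro mult_left_mono) auto
      moreover have "h \<le> 1 - cmod x" unfolding nx using h by (simp add: field_simps)
      ultimately have "h \<le> 1 - (cmod x)\<^sup>2" by simp
      then show ?thesis unfolding P_def using h by (intro mult_left_mono divide_right_mono) auto
    qed
    finally show ?thesis .
  qed
  have "(\<integral>\<^sup>+\<phi>\<in>angles. ennreal (kap w (box_pt h \<phi>) ^ 2) \<partial>lborel)
      \<le> (\<integral>\<^sup>+\<phi>\<in>angles. ennreal (16 * h * P \<phi>) \<partial>lborel)"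
    using pt by (intro nn_integral_mono mult_right_mono ennreal_leI) auto
  also have "\<dots> \<le> 2 * (\<integral>\<^sup>+\<phi>\<in>{0..2*pi}. ennreal (16 * h * P \<phi>) \<partial>lborel)"
  proof (rule nn_integral_angles_le)
    show "ennreal (16 * h * P (\<phi> - 2 * pi)) = ennreal (16 * h * P \<phi>)" for \<phi>
      unfolding P_def cis_divide[symmetric] by simp
  qed measurable
  also have "(\<integral>\<^sup>+\<phi>\<in>{0..2*pi}. ennreal (16 * h * P \<phi>) \<partial>lborel)
      = (\<integral>\<^sup>+\<phi>. ennreal (16 * h) * (ennreal (P \<phi>) * indicator {0..2*pi} \<phi>) \<partial>lborel)"
    using h by (intro nn_integral_cong) (auto simp: ennreal_mult' mult.assoc)
  also have "\<dots> = ennreal (16 * h) * ennreal (2 * pi)"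
    unfolding Pint[symmetric] by (rule nn_integral_cmult) measurable
  also have "2 * (ennreal (16 * h) * ennreal (2 * pi)) = ennreal 2 * (ennreal (16 * h) * ennreal (2 * pi))"
    by simp
  also have "\<dots> = ennreal (2 * (16 * h * (2 * pi)))"
    using h by (simp only: ennreal_mult'[symmetric] ennreal_mult''[symmetric] mult_nonneg_nonneg pi_ge_zero zero_le_numeral less_imp_le)
  also have "2 * (16 * h * (2 * pi)) = 32 * pi * gap w" using h by simp
  finally show ?thesis unfolding h_def .
qed

text \<open>
  The points of a circle of radius at least \<open>(1 + |w|)/2\<close> all have distance at least \<open>(1 - |w|)/2\<close>
  from \<open>w\<close>, so that the denominators \<open>|w - \<zeta>|\<close> and \<open>1 - |w| + |w - \<zeta>|\<close> differ by a factor of at most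
  \<open>3\<close>.
\<close>

lemma circle_kernel_le_kap:
  assumes w: "w \<in> unit_disc" and \<zeta>: "1 - gap w / 2 \<le> cmod \<zeta>" "cmod \<zeta> < 1"
  shows "circle_kernel M (w / \<zeta>) \<theta> * gap w \<le> 2 ^ M * 3 ^ Suc M * kap w (cis \<theta> * \<zeta>) ^ Suc M"
proof -
  have g: "0 < gap w" using w by (rule gap_pos)
  define \<rho> where "\<rho> = cmod \<zeta>"
  have gw: "cmod w = 1 - gap w" unfolding gap_def by simp
  have \<rho>: "0 < \<rho>" "\<rho> < 1" "gap w / 2 \<le> \<rho> - cmod w" "\<rho> - cmod w \<le> gap w"
    using \<zeta> g gw gap_le_1[of w] unfolding \<rho>_def by auto
  have \<zeta>0: "\<zeta> \<noteq> 0" using \<rho> unfolding \<rho>_def by auto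
  define d where "d = cmod (w - cis \<theta> * \<zeta>)"
  have "cmod (cis \<theta> * \<zeta>) = \<rho>" unfolding \<rho>_def by (simp add: norm_mult)
  then have "\<rho> - cmod w \<le> d" unfolding d_def using norm_triangle_ineq2[of "cis \<theta> * \<zeta>" w] by (simp add: norm_minus_commute)
  then have d: "gap w / 2 \<le> d" "0 < d" using \<rho> g by linarith+
  have "cis \<theta> - w / \<zeta> = (cis \<theta> * \<zeta> - w) / \<zeta>" using \<zeta>0 by (simp add: field_simps)
  then have dx: "cmod (cis \<theta> - w / \<zeta>) = d / \<rho>"
    unfolding d_def \<rho>_def by (simp add: norm_divide norm_minus_commute)
  define x where "x = cmod (w / \<zeta>)"
  have x: "0 \<le> x" "x = cmod w / \<rho>" unfolding x_def \<rho>_def by (auto simp: norm_divide)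
  have xl: "x < 1" unfolding x(2) using \<rho> g by simp
  have "1 - x\<^sup>2 = (1 + x) * (1 - x)" by (simp add: algebra_simps power2_eq_square)
  also have "\<dots> \<le> 2 * (1 - x)" using x xl by (intro mult_right_mono) auto
  also have "1 - x = (\<rho> - cmod w) / \<rho>" unfolding x(2) using \<rho> by (simp add: field_simps)
  also have "2 * ((\<rho> - cmod w) / \<rho>) \<le> 2 * (gap w / \<rho>)"
    using \<rho> by (intro mult_left_mono divide_right_mono) auto
  finally have num: "1 - x\<^sup>2 \<le> 2 * gap w / \<rho>" by simp
  have num0: "0 \<le> 1 - x\<^sup>2" using x xl by (simp add: power_le_one)
  have "circle_kernel M (w / \<zeta>) \<theta> = (1 - x\<^sup>2) ^ M / (d / \<rho>) ^ Suc M"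
    unfolding circle_kernel_def dx x_def by simp
  also have "\<dots> \<le> (2 * gap w / \<rho>) ^ M / (d / \<rho>) ^ Suc M"
    using num num0 d \<rho> by (intro divide_right_mono power_mono) auto
  also have "\<dots> = 2 ^ M * gap w ^ M * \<rho> / d ^ Suc M"
    using \<rho> d by (simp add: power_divide power_mult_distrib field_simps)
  also have "\<dots> \<le> 2 ^ M * gap w ^ M * 1 / ((gap w + d) / 3) ^ Suc M"
    using \<rho> d g by (intro frac_le mult_left_mono power_mono) auto
  finally have "circle_kernel M (w / \<zeta>) \<theta> * gap w \<le> 2 ^ M * gap w ^ M * 1 / ((gap w + d) / 3) ^ Suc M * gap w"
    using g by (intro mult_right_mono) auto
  also have "\<dots> = 2 ^ M * 3 ^ Suc M * kap w (cis \<theta> * \<zeta>) ^ Suc M"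
    unfolding kap_def d_def[symmetric] by (simp add: power_divide field_simps)
  finally show ?thesis .
qed

text \<open>
  \<open>circle_power_mean\<close> for the function \<open>\<xi> \<mapsto> g(\<zeta> \<xi>)\<close>, at the point \<open>w/\<zeta>\<close>.
\<close>

lemma circle_mean_kap:
  fixes s :: real
  assumes g: "g holomorphic_on unit_disc" and s: "0 < s" and w: "w \<in> unit_disc"
    and \<zeta>: "1 - gap w / 2 \<le> cmod \<zeta>" "cmod \<zeta> < 1"
  shows "ennreal (2 * pi * cmod (g w) powr s * gap w)
    \<le> (\<integral>\<^sup>+\<theta>\<in>{0..2*pi}. ennreal (2 ^ M * 3 ^ Suc M *
        (cmod (g (cis \<theta> * \<zeta>)) powr s * kap w (cis \<theta> * \<zeta>) ^ Suc M)) \<partial>lborel)"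
proof -
  have gp: "0 < gap w" using w by (rule gap_pos)
  have \<zeta>0: "0 < cmod \<zeta>" using \<zeta> gp gap_le_1[of w] by linarith
  define x where "x = w / \<zeta>"
  have "cmod w < cmod \<zeta>" using \<zeta> gp unfolding gap_def by (simp add: field_simps)
  then have x1: "cmod x < 1" unfolding x_def norm_divide using \<zeta>0 by simp
  define G where "G \<xi> = g (\<zeta> * \<xi>)" for \<xi>
  have Gh: "G holomorphic_on ball 0 (1 / cmod \<zeta>)"
    unfolding G_def
  proof (rule holomorphic_on_compose_gen[OF _ g, unfolded o_def])
    show "(*) \<zeta> ` ball 0 (1 / cmod \<zeta>) \<subseteq> unit_disc"
      using \<zeta>0 by (auto simp: norm_mult field_simps)
  qed (auto intro: holomorphic_intros)
  have R: "1 / cmod \<zeta> > 1" using \<zeta> \<zeta>0 by simp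
  have Gx: "G x = g w" unfolding G_def x_def using \<zeta>0 by simp
  define H where "H \<theta> = 2 ^ M * 3 ^ Suc M *
        (cmod (g (cis \<theta> * \<zeta>)) powr s * kap w (cis \<theta> * \<zeta>) ^ Suc M)" for \<theta>
  have H0: "0 \<le> H \<theta>" for \<theta> unfolding H_def using kap_bounds(1)[OF gp] by (simp add: less_imp_le)
  have inb: "cis \<theta> * \<zeta> \<in> unit_disc" for \<theta> using \<zeta> by (simp add: norm_mult)
  have gc: "continuous_on {0..2*pi} (\<lambda>\<theta>. g (cis \<theta> * \<zeta>))"
    using inb by (intro continuous_on_compose2[OF holomorphic_on_imp_continuous_on[OF g]] continuous_intros) auto
  have dpos: "gap w + cmod (w - cis \<theta> * \<zeta>) \<noteq> 0" for \<theta>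
    using gp norm_ge_zero[of "w - cis \<theta> * \<zeta>"] by linarith
  have Hc: "continuous_on {0..2*pi} H"
    unfolding H_def kap_def using dpos s gp by (intro continuous_intros gc continuous_on_powr') auto
  have Kc: "continuous_on {0..2*pi} (\<lambda>\<theta>. cmod (G (cis \<theta>)) powr s * circle_kernel M x \<theta> * gap w)"
    unfolding G_def using gc s
    by (intro continuous_intros continuous_on_powr' continuous_on_circle_kernel[OF x1]) (auto simp: mult.commute)
  have "2 * pi * cmod (g w) powr s * gap w
      \<le> integral {0..2*pi} (\<lambda>\<theta>. cmod (G (cis \<theta>)) powr s * circle_kernel M x \<theta>) * gap w"
    using circle_power_mean[OF Gh R s x1, of M] gp unfolding Gx by (intro mult_right_mono) auto
  also have "\<dots> = integral {0..2*pi} (\<lambda>\<theta>. cmod (G (cis \<theta>)) powr s * circle_kernel M x \<theta> * gap w)"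
    by simp
  also have "\<dots> \<le> integral {0..2*pi} H"
  proof (rule integral_le)
    fix \<theta> :: real
    have "cmod (G (cis \<theta>)) powr s * (circle_kernel M x \<theta> * gap w)
       \<le> cmod (G (cis \<theta>)) powr s * (2 ^ M * 3 ^ Suc M * kap w (cis \<theta> * \<zeta>) ^ Suc M)"
      unfolding x_def by (intro mult_left_mono circle_kernel_le_kap[OF w \<zeta>]) auto
    then show "cmod (G (cis \<theta>)) powr s * circle_kernel M x \<theta> * gap w \<le> H \<theta>"
      unfolding H_def G_def by (simp add: mult_ac)
  qed (use Hc Kc in \<open>auto intro: integrable_continuous_real\<close>)
  finally have "ennreal (2 * pi * cmod (g w) powr s * gap w) \<le> ennreal (integral {0..2*pi} H)"
    by (rule ennreal_leI)
  also have "ennreal (integral {0..2*pi} H) = (\<integral>\<^sup>+\<theta>\<in>{0..2*pi}. ennreal (H \<theta>) \<partial>lborel)"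
    using nn_integral_has_integral_lebesgue[OF H0 integrable_integral[OF integrable_continuous_real[OF Hc]]]
    by (simp only: nn_integral_indicator_swap)
  finally show ?thesis unfolding H_def .
qed

context regular_pair
begin

lemma W_finite: assumes "z \<in> unit_disc" shows "W z < \<infinity>"
proof -
  obtain C where "\<forall>z\<in>unit_disc. W z \<le> ennreal (C * measure (kmeas z) UNIV)"
    using W_le_kmeas by blast
  then show ?thesis using assms by (metis ennreal_less_top infinity_ennreal_def order_le_less_trans)
qed

lemma mu_UNIV_pos: "0 < measure \<mu> UNIV"
proof -
  have "0 < measure \<mu> (carleson_box (1/2) 0)"
    by (rule mu_square_pos) (rule box_pt_in, auto)
  also have "\<dots> \<le> measure \<mu> UNIV" by (intro mu.finite_measure_mono) (auto simp: sets_mu)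
  finally show ?thesis .
qed

text \<open>
  A crude bound that makes \<open>W\<close> positive, and uniformly so at a fixed distance from the boundary.
\<close>

lemma W_ge:
  assumes z: "z \<in> unit_disc"
  shows "ennreal ((gap z / 3) ^ expo * gap z powr eps * measure \<mu> UNIV) \<le> W z"
proof -
  have g: "0 < gap z" using z by (rule gap_pos)
  have "ennreal ((gap z / 3) ^ expo * gap z powr eps * measure \<mu> UNIV)
      = (\<integral>\<^sup>+\<xi>. ennreal ((gap z / 3) ^ expo * gap z powr eps) * indicator UNIV \<xi> \<partial>\<mu>)"
    using g by (subst nn_integral_cmult_indicator) (auto simp: mu.emeasure_eq_measure ennreal_mult' sets_mu)
  also have "\<dots> \<le> W z" unfolding W_def
  proof (rule nn_integral_mono_AE)
    show "AE \<xi> in \<mu>. ennreal ((gap z / 3) ^ expo * gap z powr eps) * indicator UNIV \<xi>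
        \<le> ennreal (kap z \<xi> ^ expo * (gap z / gap \<xi>) powr eps)"
      using mu_disc
    proof eventually_elim
      fix \<xi> assume \<xi>: "\<xi> \<in> unit_disc"
      have gx: "0 < gap \<xi>" using \<xi> by (rule gap_pos)
      have "cmod (z - \<xi>) \<le> 2" using norm_triangle_ineq4[of z \<xi>] z \<xi> by simp
      then have "gap z / 3 \<le> kap z \<xi>"
        unfolding kap_def using g gap_le_1[of z] norm_ge_zero[of "z - \<xi>"] by (intro frac_le) linarith+
      moreover have "gap z powr eps \<le> (gap z / gap \<xi>) powr eps"
        using g gx gap_le_1[of \<xi>] eps_pos by (intro powr_mono2) (auto simp: field_simps mult_le_cancel_left1)
      ultimately show "ennreal ((gap z / 3) ^ expo * gap z powr eps) * indicator UNIV \<xi>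
        \<le> ennreal (kap z \<xi> ^ expo * (gap z / gap \<xi>) powr eps)"
        using g by (auto intro!: ennreal_leI mult_mono power_mono)
    qed
  qed
  finally show ?thesis .
qed

lemma W_pos: assumes z: "z \<in> unit_disc" shows "0 < W z"
proof -
  have "0 < gap z" using z by (rule gap_pos)
  then have "0 < (gap z / 3) ^ expo * gap z powr eps * measure \<mu> UNIV"
    using mu_UNIV_pos by simp
  then show ?thesis using W_ge[OF z] by (metis ennreal_less_zero_iff order_less_le_trans)
qed

lemma W_le_W:
  assumes z: "z \<in> unit_disc" and w: "w \<in> unit_disc" and c: "0 \<le> c" "gap z \<le> b * gap w" "0 \<le> b"
    and kap: "\<And>\<xi>. kap z \<xi> \<le> c * kap w \<xi>"
  shows "W z \<le> ennreal (c ^ expo * b powr eps) * W w"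
proof -
  have g: "0 < gap z" "0 < gap w" using z w gap_pos by auto
  have "W z \<le> (\<integral>\<^sup>+\<xi>. ennreal (c ^ expo * b powr eps) * ennreal (kap w \<xi> ^ expo * (gap w / gap \<xi>) powr eps) \<partial>\<mu>)"
    unfolding W_def
  proof (rule nn_integral_mono_AE)
    show "AE \<xi> in \<mu>. ennreal (kap z \<xi> ^ expo * (gap z / gap \<xi>) powr eps)
        \<le> ennreal (c ^ expo * b powr eps) * ennreal (kap w \<xi> ^ expo * (gap w / gap \<xi>) powr eps)"
      using mu_disc
    proof eventually_elim
      fix \<xi> assume \<xi>: "\<xi> \<in> unit_disc"
      have gx: "0 < gap \<xi>" using \<xi> by (rule gap_pos)
      have k0: "0 \<le> kap z \<xi>" "0 \<le> kap w \<xi>" using kap_bounds(1) g by (auto intro: less_imp_le)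
      have "kap z \<xi> ^ expo \<le> (c * kap w \<xi>) ^ expo" using k0 kap by (intro power_mono) auto
      moreover have "(gap z / gap \<xi>) powr eps \<le> (b * (gap w / gap \<xi>)) powr eps"
        using g gx c eps_pos by (intro powr_mono2) (auto simp: divide_right_mono)
      ultimately have "kap z \<xi> ^ expo * (gap z / gap \<xi>) powr eps
          \<le> (c * kap w \<xi>) ^ expo * (b * (gap w / gap \<xi>)) powr eps"
        using k0 c by (intro mult_mono) auto
      also have "\<dots> = c ^ expo * b powr eps * (kap w \<xi> ^ expo * (gap w / gap \<xi>) powr eps)"
        unfolding power_mult_distrib powr_mult[of b] by (simp only: mult_ac)
      finally show "ennreal (kap z \<xi> ^ expo * (gap z / gap \<xi>) powr eps)
        \<le> ennreal (c ^ expo * b powr eps) * ennreal (kap w \<xi> ^ expo * (gap w / gap \<xi>) powr eps)"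
        using c by (subst ennreal_mult'[symmetric]) (auto intro!: ennreal_leI)
    qed
  qed
  also have "\<dots> = ennreal (c ^ expo * b powr eps) * W w"
    unfolding W_def by (rule nn_integral_cmult) measurable
  finally show ?thesis .
qed

lemma W_le_mu_box: "\<exists>C>0. \<forall>h \<phi> \<zeta>. 0 < h \<and> h < 1 \<and> \<phi> \<in> angles \<and> \<zeta> \<in> carleson_box h \<phi> \<inter> annulus h \<longrightarrow>
  W \<zeta> \<le> ennreal (C * measure \<mu> (carleson_box h \<phi>))"
proof -
  obtain C where C: "0 < C" "\<And>t \<phi>. 0 < t \<Longrightarrow> t < 1 \<Longrightarrow> \<phi> \<in> angles \<Longrightarrow>
      W (box_pt t \<phi>) \<le> ennreal (C * measure \<mu> (carleson_box t \<phi>))"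
    using W_box_bound by blast
  have "W \<zeta> \<le> ennreal ((3 * K) ^ expo * C * measure \<mu> (carleson_box h \<phi>))"
    if h: "0 < h" "h < 1" and \<phi>: "\<phi> \<in> angles" and \<zeta>: "\<zeta> \<in> carleson_box h \<phi> \<inter> annulus h" for h \<phi> \<zeta>
  proof -
    define a where "a = box_pt h \<phi>"
    have a: "a \<in> unit_disc" unfolding a_def using box_pt_in[OF h] by auto
    have ga: "gap a = h" unfolding a_def using h by (simp add: gap_box_pt)
    have g\<zeta>: "0 < gap \<zeta>" "gap \<zeta> \<le> h" using carleson_box_gap[OF h] \<zeta> by auto
    have "h / K \<le> gap \<zeta>" using \<zeta> unfolding annulus_def gap_def by auto
    then have hK: "h \<le> K * gap \<zeta>" using K by (simp add: field_simps)
    have d: "cmod (\<zeta> - a) \<le> 2 * h" unfolding a_def using \<zeta> by (intro carleson_box_dist[OF h]) auto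
    have "kap \<zeta> \<xi> \<le> (3 * K) * kap a \<xi>" for \<xi>
    proof -
      have "cmod (a - \<xi>) \<le> 2 * h + cmod (\<zeta> - \<xi>)"
        using norm_triangle_ineq[of "a - \<zeta>" "\<zeta> - \<xi>"] d by (simp add: norm_minus_commute)
      moreover have "1 * cmod (\<zeta> - \<xi>) \<le> (3 * K) * cmod (\<zeta> - \<xi>)" using K by (intro mult_right_mono) auto
      ultimately have "gap a + cmod (a - \<xi>) \<le> (3 * K) * (gap \<zeta> + cmod (\<zeta> - \<xi>))"
        using hK ga by (simp add: algebra_simps)
      then show ?thesis using kap_le_kap[of \<zeta> a 1 \<xi> "3 * K" \<xi>] g\<zeta> ga h by simp
    qed
    then have "W \<zeta> \<le> ennreal ((3 * K) ^ expo * 1 powr eps) * W a"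
      using g\<zeta> ga K by (intro W_le_W a) (auto simp: gap_def)
    also have "\<dots> \<le> ennreal ((3 * K) ^ expo) * ennreal (C * measure \<mu> (carleson_box h \<phi>))"
      unfolding a_def using C(2)[OF h \<phi>] by (simp add: mult_left_mono)
    finally show ?thesis using K C(1) by (simp add: ennreal_mult'[symmetric] mult.assoc)
  qed
  with C(1) K show ?thesis by (intro exI[of _ "(3 * K) ^ expo * C"]) auto
qed

lemma eta_annulus_pos: assumes "0 < h" "h < 1" shows "0 < measure \<eta> (annulus h)"
proof -
  have "0 < A * measure \<eta> (annulus h)"
    using eta_strip_pos[OF assms] tail_annulus[OF assms] unfolding strip_def annulus_def by linarith
  then show ?thesis using A by (simp add: zero_less_mult_iff)
qed

text \<open>
  \<open>circle_mean_kap\<close> holds on each circle of the annulus. Integrating it against \<open>\<eta>\<close> and exchanging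
  the integrals leaves an integral over rotations that all have the same value.
\<close>

lemma annulus_mean:
  fixes s :: real
  assumes g: "g holomorphic_on unit_disc" and gm[measurable]: "g \<in> borel_measurable borel"
    and s: "0 < s" and w: "w \<in> unit_disc"
  shows "ennreal (cmod (g w) powr s * gap w * measure \<eta> (annulus (gap w / 2)))
    \<le> ennreal (2 ^ M * 3 ^ Suc M) * (\<integral>\<^sup>+\<zeta>\<in>annulus (gap w / 2). ennreal (cmod (g \<zeta>) powr s * kap w \<zeta> ^ Suc M) \<partial>\<eta>)"
proof -
  interpret P: pair_sigma_finite lborel \<eta> by unfold_locales
  have gp: "0 < gap w" using w by (rule gap_pos)
  define R where "R = annulus (gap w / 2)"
  have R[measurable]: "R \<in> sets borel" unfolding R_def by measurable
  define c where "c = (2 ^ M * 3 ^ Suc M :: real)"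
  have c: "0 < c" unfolding c_def by simp
  define H where "H \<zeta> = c * (cmod (g \<zeta>) powr s * kap w \<zeta> ^ Suc M)" for \<zeta>
  have Hm[measurable]: "H \<in> borel_measurable borel" unfolding H_def by measurable
  have HR[measurable]: "(\<lambda>\<zeta>. ennreal (H \<zeta>) * indicator R \<zeta>) \<in> borel_measurable borel" by measurable
  define u where "u = 2 * pi * cmod (g w) powr s * gap w"
  have u: "0 \<le> u" unfolding u_def using gp by simp
  have rotm: "(\<lambda>x. cis (fst x) * snd x) \<in> borel_measurable (lborel \<Otimes>\<^sub>M \<eta>)" by measurable
  have "ennreal (u * measure \<eta> R) = (\<integral>\<^sup>+\<zeta>. ennreal u * indicator R \<zeta> \<partial>\<eta>)"
    using u by (subst nn_integral_cmult_indicator) (auto simp: eta.emeasure_eq_measure ennreal_mult' sets_eta)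
  also have "\<dots> \<le> (\<integral>\<^sup>+\<zeta>. (\<integral>\<^sup>+\<theta>. ennreal (H (cis \<theta> * \<zeta>)) * indicator R (cis \<theta> * \<zeta>) * indicator {0..2*pi} \<theta> \<partial>lborel) \<partial>\<eta>)"
  proof (rule nn_integral_mono)
    fix \<zeta>
    show "ennreal u * indicator R \<zeta> \<le> (\<integral>\<^sup>+\<theta>. ennreal (H (cis \<theta> * \<zeta>)) * indicator R (cis \<theta> * \<zeta>) * indicator {0..2*pi} \<theta> \<partial>lborel)"
    proof (cases "\<zeta> \<in> R")
      case True
      have "0 < gap w / 2 / K" using gp K by simp
      then have z: "1 - gap w / 2 \<le> cmod \<zeta>" "cmod \<zeta> < 1" using True unfolding R_def annulus_def by auto
      have "indicator R (cis \<theta> * \<zeta>) = (1::ennreal)" for \<theta>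
        using True unfolding R_def annulus_def by (simp add: norm_mult)
      then show ?thesis using circle_mean_kap[OF g s w z, of M] True unfolding H_def u_def c_def by simp
    qed simp
  qed
  also have "\<dots> = (\<integral>\<^sup>+\<theta>. (\<integral>\<^sup>+\<zeta>. ennreal (H (cis \<theta> * \<zeta>)) * indicator R (cis \<theta> * \<zeta>) * indicator {0..2*pi} \<theta> \<partial>\<eta>) \<partial>lborel)"
  proof (rule P.Fubini')
    have "(\<lambda>x. ennreal (H (cis (fst x) * snd x)) * indicator R (cis (fst x) * snd x)) \<in> borel_measurable (lborel \<Otimes>\<^sub>M \<eta>)"
      using measurable_compose[OF rotm HR] .
    then show "(\<lambda>(\<theta>, \<zeta>). ennreal (H (cis \<theta> * \<zeta>)) * indicator R (cis \<theta> * \<zeta>) * indicator {0..2*pi} \<theta>)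
        \<in> borel_measurable (lborel \<Otimes>\<^sub>M \<eta>)"
      unfolding case_prod_beta by measurable
  qed
  also have "\<dots> = (\<integral>\<^sup>+\<theta>. (\<integral>\<^sup>+\<zeta>\<in>R. ennreal (H \<zeta>) \<partial>\<eta>) * indicator {0..2*pi} \<theta> \<partial>lborel)"
  proof (rule nn_integral_cong)
    fix \<theta>
    have rm: "(\<lambda>\<zeta>. ennreal (H (cis \<theta> * \<zeta>)) * indicator R (cis \<theta> * \<zeta>)) \<in> borel_measurable \<eta>"
      by (rule measurable_compose[OF _ HR]) measurable
    have "(\<integral>\<^sup>+\<zeta>. ennreal (H (cis \<theta> * \<zeta>)) * indicator R (cis \<theta> * \<zeta>) * indicator {0..2*pi} \<theta> \<partial>\<eta>)
        = (\<integral>\<^sup>+\<zeta>. ennreal (H (cis \<theta> * \<zeta>)) * indicator R (cis \<theta> * \<zeta>) \<partial>\<eta>) * indicator {0..2*pi} \<theta>"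
      by (rule nn_integral_multc[OF rm])
    also have "(\<integral>\<^sup>+\<zeta>. ennreal (H (cis \<theta> * \<zeta>)) * indicator R (cis \<theta> * \<zeta>) \<partial>\<eta>) = (\<integral>\<^sup>+\<zeta>\<in>R. ennreal (H \<zeta>) \<partial>\<eta>)"
      using nn_integral_eta_rotate[OF HR, of \<theta>] by simp
    finally show "(\<integral>\<^sup>+\<zeta>. ennreal (H (cis \<theta> * \<zeta>)) * indicator R (cis \<theta> * \<zeta>) * indicator {0..2*pi} \<theta> \<partial>\<eta>)
      = (\<integral>\<^sup>+\<zeta>\<in>R. ennreal (H \<zeta>) \<partial>\<eta>) * indicator {0..2*pi} \<theta>" .
  qed
  also have "\<dots> = (\<integral>\<^sup>+\<zeta>\<in>R. ennreal (H \<zeta>) \<partial>\<eta>) * ennreal (2 * pi)"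
    by (subst nn_integral_cmult_indicator) auto
  also have "(\<integral>\<^sup>+\<zeta>\<in>R. ennreal (H \<zeta>) \<partial>\<eta>)
      = (\<integral>\<^sup>+\<zeta>. ennreal c * (ennreal (cmod (g \<zeta>) powr s * kap w \<zeta> ^ Suc M) * indicator R \<zeta>) \<partial>\<eta>)"
    unfolding H_def using c by (intro nn_integral_cong) (simp add: ennreal_mult' mult.assoc)
  also have "\<dots> = ennreal c * (\<integral>\<^sup>+\<zeta>\<in>R. ennreal (cmod (g \<zeta>) powr s * kap w \<zeta> ^ Suc M) \<partial>\<eta>)" (is "_ = ennreal c * ?I")
    by (rule nn_integral_cmult) measurable
  finally have "ennreal (u * measure \<eta> R) \<le> ennreal c * ?I * ennreal (2 * pi)" .
  then have "ennreal (2 * pi) * ennreal (cmod (g w) powr s * gap w * measure \<eta> R) \<le> ennreal (2 * pi) * (ennreal c * ?I)"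
    unfolding u_def by (simp add: ennreal_mult'[symmetric] mult_ac)
  then have "ennreal (cmod (g w) powr s * gap w * measure \<eta> R) \<le> ennreal c * ?I"
    by (subst (asm) ennreal_mult_le_mult_iff) auto
  then show ?thesis unfolding R_def c_def .
qed

end

text \<open>
  Optimising the parameter \<open>y\<close> of \<open>B_condition\<close>: at \<open>y = u/(2c)\<close> the first term is half of the
  left-hand side.
\<close>

lemma powr_le_of_linear_bounds:
  fixes u c q Z :: real
  assumes "0 \<le> u" "0 < c" "1 < q" "0 \<le> Z" and bd: "\<And>y. 0 < y \<Longrightarrow> u \<le> c * (y + y powr (1 - q) * Z)"
  shows "u powr q \<le> (2 * c) powr q * Z"
proof (cases "u = 0")
  case True
  then show ?thesis using assms by simp
next
  case False
  then have u: "0 < u" using assms by simp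
  define y where "y = u / (2 * c)"
  have y: "0 < y" unfolding y_def using u assms by simp
  have "c * y = u / 2" unfolding y_def using assms by simp
  with bd[OF y] have "c * y \<le> c * (y powr (1 - q) * Z)" by (simp add: distrib_left)
  then have "y \<le> y powr (1 - q) * Z" using assms by simp
  then have "y powr (q - 1) * y \<le> y powr (q - 1) * (y powr (1 - q) * Z)" by (intro mult_left_mono) auto
  also have "y powr (q - 1) * (y powr (1 - q) * Z) = Z"
    using y by (simp add: mult.assoc[symmetric] powr_add[symmetric])
  also have "y powr (q - 1) * y = y powr q" using y by (simp add: powr_diff)
  finally have "(2 * c) powr q * y powr q \<le> (2 * c) powr q * Z" by (intro mult_left_mono) auto
  moreover have "(2 * c) powr q * y powr q = (2 * c * y) powr q" by (rule powr_mult[symmetric])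
  moreover have "2 * c * y = u" unfolding y_def using assms by simp
  ultimately show ?thesis by simp
qed

lemma ennreal_distrib_mult:
  "0 \<le> x \<Longrightarrow> ennreal x * (ennreal y + ennreal z * I) = ennreal (x * y) + ennreal (x * z) * I"
  by (simp only: distrib_left ennreal_mult' mult.assoc)

context regular_pair
begin

text \<open>
  The integrand of the operator \<open>Phi\<close>, with a free power \<open>m\<close> of the kernel.
\<close>

definition J :: "real \<Rightarrow> nat \<Rightarrow> (complex \<Rightarrow> complex) \<Rightarrow> complex \<Rightarrow> complex \<Rightarrow> ennreal" where
  "J p m g w \<zeta> = ennreal (kap w \<zeta> ^ m * cmod (g \<zeta>) powr p) / W \<zeta>"

lemma W_measurable[measurable]: "W \<in> borel_measurable borel"
proof -
  have "(\<lambda>(z, \<xi>). ennreal (kap z \<xi> ^ expo * (gap z / gap \<xi>) powr eps)) \<in> borel_measurable (borel \<Otimes>\<^sub>M \<mu>)"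
    by measurable
  from mu.borel_measurable_nn_integral[OF this] show ?thesis unfolding W_def[abs_def] .
qed

lemma J_measurable: 
  assumes [measurable]: "g \<in> borel_measurable borel"
  shows "J p m g w \<in> borel_measurable borel"
proof -
  have "(\<lambda>\<zeta>. ennreal (kap w \<zeta> ^ m * cmod (g \<zeta>) powr p) / W \<zeta>) \<in> borel_measurable borel"
    by measurable
  then show ?thesis unfolding J_def[abs_def] .
qed

text \<open>
  \<open>B_condition\<close> on the square of height \<open>(1 - |w|)/2\<close> for the function \<open>|g|\<^sup>s\<close> on its upper part.
  There the kernel is constant up to a factor, and the \<open>\<mu>\<close>-measure of the square in the denominator
  may be replaced by the function \<open>W\<close>. The surplus power of the kernel is kept on the first term as
  a square, to make that term integrable in \<open>\<phi>\<close>.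
\<close>

lemma box_Hoelder: "\<exists>c>0. \<forall>g s w y \<phi> h R. g \<in> borel_measurable borel \<and> 0 < s \<and> w \<in> unit_disc \<and> 0 < y \<and> \<phi> \<in> angles
    \<and> h = gap w / 2 \<and> R = measure \<eta> (annulus h) \<longrightarrow>
   (\<integral>\<^sup>+\<zeta>\<in>carleson_box h \<phi>. ennreal (cmod (g \<zeta>) powr s * kap w \<zeta> ^ Suc (Suc m)) * indicator (annulus h) \<zeta> \<partial>\<eta>)
   \<le> ennreal (c * h * R * y) * ennreal (kap w (box_pt h \<phi>) ^ 2)
     + ennreal (c * h * R * y powr (1 - q)) *
       (\<integral>\<^sup>+\<zeta>\<in>carleson_box h \<phi>. J (s * q) (Suc (Suc m)) g w \<zeta> * indicator (annulus h) \<zeta> \<partial>\<mu>)"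
proof -
  obtain CW where CW: "0 < CW" "\<And>h \<phi> \<zeta>. 0 < h \<Longrightarrow> h < 1 \<Longrightarrow> \<phi> \<in> angles \<Longrightarrow>
      \<zeta> \<in> carleson_box h \<phi> \<inter> annulus h \<Longrightarrow> W \<zeta> \<le> ennreal (CW * measure \<mu> (carleson_box h \<phi>))"
    using W_le_mu_box by blast
  define n where "n = Suc (Suc m)"
  define c where "c = 9 ^ n * C0 * A * (1 + CW)"
  have c: "0 < c" unfolding c_def using C0 A CW by (auto intro!: mult_pos_pos add_pos_pos)
  have main: "(\<integral>\<^sup>+\<zeta>\<in>carleson_box h \<phi>. ennreal (cmod (g \<zeta>) powr s * kap w \<zeta> ^ n) * indicator (annulus h) \<zeta> \<partial>\<eta>)
   \<le> ennreal (c * h * R * y) * ennreal (kap w (box_pt h \<phi>) ^ 2)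
     + ennreal (c * h * R * y powr (1 - q)) *
       (\<integral>\<^sup>+\<zeta>\<in>carleson_box h \<phi>. J (s * q) n g w \<zeta> * indicator (annulus h) \<zeta> \<partial>\<mu>)"
    if gm: "g \<in> borel_measurable borel" and s: "0 < s" and w: "w \<in> unit_disc" and y: "0 < y" and \<phi>: "\<phi> \<in> angles"
    and hdef: "h = gap w / 2" and Rdef: "R = measure \<eta> (annulus h)"
    for g s w y \<phi> h R
  proof -
    note [measurable] = gm
    have gp: "0 < gap w" using w by (rule gap_pos)
    have h: "0 < h" "h < 1" "h \<le> gap w" unfolding hdef using gp gap_le_1[of w] by auto
    note [measurable] = carleson_box_borel[OF h(1,2)]
    have [measurable]: "J (s * q) n g w \<in> borel_measurable borel" by (rule J_measurable[OF gm])
    define a where "a = box_pt h \<phi>"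
    have a: "a \<in> unit_disc - {0}" unfolding a_def by (rule box_pt_in[OF h(1,2)])
    define k where "k = kap w a"
    have k: "0 < k" "k \<le> 1" unfolding k_def using kap_bounds[OF gp] by auto
    define e where "e = measure \<eta> (carleson_box h \<phi>)"
    define b where "b = measure \<mu> (carleson_box h \<phi>)"
    have b: "0 < b" unfolding b_def using mu_square_pos[OF a] unfolding a_def .
    have e0: "0 \<le> e" unfolding e_def by simp
    have R0: "0 \<le> R" unfolding Rdef by simp
    have "e \<le> h * measure \<eta> (strip h)" unfolding e_def by (rule eta_carleson_box(2)[OF h(1,2)])
    also have "\<dots> \<le> h * (A * R)"
      using tail_annulus[OF h(1,2)] h unfolding Rdef strip_def annulus_def by (intro mult_left_mono) auto
    finally have e: "e \<le> h * A * R" by simp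
    define F where "F \<zeta> = cmod (g \<zeta>) powr s * indicator (annulus h) \<zeta>" for \<zeta>
    have F1[measurable]: "F \<in> borel_measurable borel" unfolding F_def by measurable
    have F2: "0 \<le> F \<zeta>" for \<zeta> unfolding F_def by simp
    have up: "kap w \<zeta> ^ n \<le> 3 ^ n * k ^ n" and low: "k ^ n \<le> 3 ^ n * kap w \<zeta> ^ n" if "\<zeta> \<in> carleson_box h \<phi>" for \<zeta>
      using power_mono[OF kap_carleson_box(1)[OF h(1,2) that h(3)], of n]
        power_mono[OF kap_carleson_box(2)[OF h(1,2) that h(3)], of n] kap_bounds(1)[OF gp]
      unfolding k_def a_def power_mult_distrib by (simp_all add: less_imp_le)
    have FB: "(\<integral>\<^sup>+\<zeta>\<in>carleson_box h \<phi>. ennreal (F \<zeta>) \<partial>\<eta>)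
       \<le> ennreal (C0 * e * y) + ennreal (C0 * e * y powr (1 - q) / b) * (\<integral>\<^sup>+\<zeta>\<in>carleson_box h \<phi>. ennreal (F \<zeta> powr q) \<partial>\<mu>)"
      (is "_ \<le> _ + _ * ?I")
      using B_condition[OF a F1 F2 y] unfolding e_def b_def a_def .
    have "(\<integral>\<^sup>+\<zeta>\<in>carleson_box h \<phi>. ennreal (cmod (g \<zeta>) powr s * kap w \<zeta> ^ n) * indicator (annulus h) \<zeta> \<partial>\<eta>)
        \<le> (\<integral>\<^sup>+\<zeta>. ennreal (3 ^ n * k ^ n) * (ennreal (F \<zeta>) * indicator (carleson_box h \<phi>) \<zeta>) \<partial>\<eta>)"
    proof (rule nn_integral_mono)
      fix \<zeta>
      show "ennreal (cmod (g \<zeta>) powr s * kap w \<zeta> ^ n) * indicator (annulus h) \<zeta> * indicator (carleson_box h \<phi>) \<zeta>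
        \<le> ennreal (3 ^ n * k ^ n) * (ennreal (F \<zeta>) * indicator (carleson_box h \<phi>) \<zeta>)"
      proof (cases "\<zeta> \<in> annulus h \<and> \<zeta> \<in> carleson_box h \<phi>")
        case True
        then have "cmod (g \<zeta>) powr s * kap w \<zeta> ^ n \<le> cmod (g \<zeta>) powr s * (3 ^ n * k ^ n)"
          using up by (intro mult_left_mono) auto
        then show ?thesis using True k unfolding F_def
          by (simp add: ennreal_mult'[symmetric] mult.commute ennreal_leI)
      qed auto
    qed
    also have "\<dots> = ennreal (3 ^ n * k ^ n) * (\<integral>\<^sup>+\<zeta>\<in>carleson_box h \<phi>. ennreal (F \<zeta>) \<partial>\<eta>)"
      by (rule nn_integral_cmult) measurable
    also have "\<dots> \<le> ennreal (3 ^ n * k ^ n) * (ennreal (C0 * e * y) + ennreal (C0 * e * y powr (1 - q) / b) * ?I)"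
      by (rule mult_left_mono[OF FB]) simp
    also have "ennreal (3 ^ n * k ^ n) * (ennreal (C0 * e * y) + ennreal (C0 * e * y powr (1 - q) / b) * ?I)
       = ennreal (3 ^ n * k ^ n * (C0 * e * y)) + ennreal (3 ^ n * k ^ n * (C0 * e * y powr (1 - q) / b)) * ?I"
      by (rule ennreal_distrib_mult) (use k in simp)
    also have "\<dots> \<le> ennreal (c * h * R * y) * ennreal (k ^ 2) + ennreal (c * h * R * y powr (1 - q)) *
       (\<integral>\<^sup>+\<zeta>\<in>carleson_box h \<phi>. J (s * q) n g w \<zeta> * indicator (annulus h) \<zeta> \<partial>\<mu>)"
    proof (rule add_mono)
      have kn: "k ^ n \<le> k ^ 2" using k unfolding n_def by (intro power_decreasing) auto
      have tn: "(3::real) ^ n \<le> 9 ^ n" by (rule power_mono) auto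
      have f1: "C0 * e * y \<le> C0 * (h * A * R) * y"
        by (rule mult_right_mono[OF mult_left_mono[OF e less_imp_le[OF C0]] less_imp_le[OF y]])
      have f2: "3 ^ n * k ^ n \<le> 9 ^ n * k ^ 2"
        by (rule mult_mono[OF tn kn]) (use k in auto)
      have f3: "0 \<le> C0 * e * y" using C0 e0 y by simp
      have f4: "0 \<le> 9 ^ n * k ^ 2" by simp
      have "3 ^ n * k ^ n * (C0 * e * y) \<le> 9 ^ n * k ^ 2 * (C0 * (h * A * R) * y)"
        by (rule mult_mono[OF f2 f1 f4 f3])
      also have "\<dots> = 9 ^ n * C0 * A * 1 * (h * R * y * k ^ 2)" by (simp add: mult_ac)
      also have "\<dots> \<le> c * (h * R * y * k ^ 2)"
        unfolding c_def using CW C0 A h R0 y by (intro mult_right_mono mult_left_mono) auto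
      finally have "3 ^ n * k ^ n * (C0 * e * y) \<le> c * h * R * y * k ^ 2" by (simp add: mult_ac)
      then show "ennreal (3 ^ n * k ^ n * (C0 * e * y)) \<le> ennreal (c * h * R * y) * ennreal (k ^ 2)"
        using c h R0 y by (simp add: ennreal_mult'[symmetric] ennreal_leI)
    next
      define d where "d = C0 * e * y powr (1 - q)"
      have d0: "0 \<le> d" unfolding d_def using C0 e0 by simp
      then have nd: "0 \<le> 3 ^ n * d" by simp
      have "ennreal (k ^ n / b) * ?I = (\<integral>\<^sup>+\<zeta>. ennreal (k ^ n / b) * (ennreal (F \<zeta> powr q) * indicator (carleson_box h \<phi>) \<zeta>) \<partial>\<mu>)"
        by (rule nn_integral_cmult[symmetric]) measurable
      also have "\<dots> \<le> (\<integral>\<^sup>+\<zeta>. ennreal (3 ^ n * CW) * (J (s * q) n g w \<zeta> * indicator (annulus h) \<zeta> * indicator (carleson_box h \<phi>) \<zeta>) \<partial>\<mu>)"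
      proof (rule nn_integral_mono)
        fix \<zeta>
        show "ennreal (k ^ n / b) * (ennreal (F \<zeta> powr q) * indicator (carleson_box h \<phi>) \<zeta>)
          \<le> ennreal (3 ^ n * CW) * (J (s * q) n g w \<zeta> * indicator (annulus h) \<zeta> * indicator (carleson_box h \<phi>) \<zeta>)"
        proof (cases "\<zeta> \<in> carleson_box h \<phi> \<inter> annulus h")
          case True
          have \<zeta>d: "\<zeta> \<in> unit_disc" using True carleson_box_iff[OF h(1,2), of \<zeta> \<phi>] by simp
          obtain v where v: "W \<zeta> = ennreal v" "0 < v"
            using W_finite[OF \<zeta>d] W_pos[OF \<zeta>d] by (cases "W \<zeta>") auto
          have "v \<le> CW * b" using CW(2)[OF h(1,2) \<phi> True] v b CW(1) unfolding b_def[symmetric] by simp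
          then have "1 / b \<le> CW / v" using b v CW(1) by (simp add: field_simps)
          then have "k ^ n * (1 / b) \<le> 3 ^ n * kap w \<zeta> ^ n * (CW / v)"
            using low[of \<zeta>] True b k kap_bounds(1)[OF gp, of \<zeta>] less_imp_le[of 0 "kap w \<zeta>"]
            by (intro mult_mono[of "k ^ n"]) auto
          then have "k ^ n / b * cmod (g \<zeta>) powr (s * q) \<le> 3 ^ n * kap w \<zeta> ^ n * (CW / v) * cmod (g \<zeta>) powr (s * q)"
            by (intro mult_right_mono) auto
          also have "\<dots> = 3 ^ n * CW * (kap w \<zeta> ^ n * cmod (g \<zeta>) powr (s * q) / v)" by simp
          finally have le: "k ^ n / b * cmod (g \<zeta>) powr (s * q) \<le> 3 ^ n * CW * (kap w \<zeta> ^ n * cmod (g \<zeta>) powr (s * q) / v)" .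
          have Jv: "J (s * q) n g w \<zeta> = ennreal (kap w \<zeta> ^ n * cmod (g \<zeta>) powr (s * q) / v)"
            unfolding J_def v(1) using v(2) kap_bounds(1)[OF gp, of \<zeta>]
            by (intro divide_ennreal) (auto simp: less_imp_le)
          have Fq: "F \<zeta> powr q = cmod (g \<zeta>) powr (s * q)" unfolding F_def using True by (simp add: powr_powr)
          show ?thesis using True le k b CW(1) unfolding Jv Fq
            by (simp add: ennreal_mult'[symmetric] ennreal_leI)
        next
          case False
          then have "F \<zeta> powr q * indicator (carleson_box h \<phi>) \<zeta> = 0" unfolding F_def by (auto simp: indicator_def)
          then show ?thesis by (auto simp: indicator_def)
        qed
      qed
      also have "\<dots> = ennreal (3 ^ n * CW) * (\<integral>\<^sup>+\<zeta>\<in>carleson_box h \<phi>. J (s * q) n g w \<zeta> * indicator (annulus h) \<zeta> \<partial>\<mu>)"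
        by (rule nn_integral_cmult) measurable
      finally have inner: "ennreal (k ^ n / b) * ?I
         \<le> ennreal (3 ^ n * CW) * (\<integral>\<^sup>+\<zeta>\<in>carleson_box h \<phi>. J (s * q) n g w \<zeta> * indicator (annulus h) \<zeta> \<partial>\<mu>)" .
      have "ennreal (3 ^ n * k ^ n * (C0 * e * y powr (1 - q) / b)) * ?I
          = ennreal (3 ^ n * d) * (ennreal (k ^ n / b) * ?I)"
      proof -
        have eq: "3 ^ n * k ^ n * (C0 * e * y powr (1 - q) / b) = (3 ^ n * d) * (k ^ n / b)"
          unfolding d_def by (simp add: mult_ac)
        show ?thesis unfolding eq by (subst ennreal_mult'[OF nd]) (rule mult.assoc)
      qed
      also have "\<dots> \<le> ennreal (3 ^ n * d) * (ennreal (3 ^ n * CW) * (\<integral>\<^sup>+\<zeta>\<in>carleson_box h \<phi>. J (s * q) n g w \<zeta> * indicator (annulus h) \<zeta> \<partial>\<mu>))"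
        by (rule mult_left_mono[OF inner]) simp
      also have "\<dots> = ennreal (3 ^ n * d * (3 ^ n * CW)) * (\<integral>\<^sup>+\<zeta>\<in>carleson_box h \<phi>. J (s * q) n g w \<zeta> * indicator (annulus h) \<zeta> \<partial>\<mu>)"
        by (subst ennreal_mult'[OF nd]) (rule mult.assoc[symmetric])
      also have "\<dots> \<le> ennreal (c * h * R * y powr (1 - q)) * (\<integral>\<^sup>+\<zeta>\<in>carleson_box h \<phi>. J (s * q) n g w \<zeta> * indicator (annulus h) \<zeta> \<partial>\<mu>)"
      proof (intro mult_right_mono ennreal_leI)
        have "(3::real) ^ n * 3 ^ n = 9 ^ n" by (simp add: power_mult_distrib[symmetric])
        then have "3 ^ n * d * (3 ^ n * CW) = 9 ^ n * CW * (C0 * y powr (1 - q)) * e" unfolding d_def by (simp add: mult_ac)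
        also have "\<dots> \<le> 9 ^ n * CW * (C0 * y powr (1 - q)) * (h * A * R)"
          using e CW(1) C0 by (intro mult_left_mono) auto
        also have "\<dots> \<le> 9 ^ n * (1 + CW) * (C0 * y powr (1 - q)) * (h * A * R)"
          using e e0 CW(1) C0 h A R0 by (intro mult_right_mono mult_left_mono) auto
        also have "\<dots> = c * h * R * y powr (1 - q)" unfolding c_def by (simp add: mult_ac)
        finally show "3 ^ n * d * (3 ^ n * CW) \<le> c * h * R * y powr (1 - q)" .
      qed auto
      finally show "ennreal (3 ^ n * k ^ n * (C0 * e * y powr (1 - q) / b)) * ?I
        \<le> ennreal (c * h * R * y powr (1 - q)) * (\<integral>\<^sup>+\<zeta>\<in>carleson_box h \<phi>. J (s * q) n g w \<zeta> * indicator (annulus h) \<zeta> \<partial>\<mu>)" .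
    qed
    finally show ?thesis unfolding k_def a_def .
  qed
  show ?thesis
    by (intro exI[of _ c] conjI allI impI c, elim conjE) (rule main[unfolded n_def]; assumption)
qed

text \<open>
  The mean of \<open>|g|\<^sup>p\<^sup>/\<^sup>q\<close> over the annulus is assembled from \<open>box_Hoelder\<close> by integration over \<open>\<phi>\<close>.
  Only after that is \<open>y\<close> chosen, the same for all squares, which raises the inequality to the power
  \<open>q\<close>. A different choice for each square would leave \<open>q\<close>-th roots inside the integral over \<open>\<phi>\<close>.
\<close>

lemma annulus_bound: "0 < p \<Longrightarrow> \<exists>C>0. \<forall>g w. g holomorphic_on unit_disc \<and> g \<in> borel_measurable borel \<and> w \<in> unit_disc \<longrightarrow>
  ennreal (cmod (g w) powr p) \<le> ennreal C * (\<integral>\<^sup>+\<zeta>\<in>annulus (gap w / 2). J p (Suc (Suc m)) g w \<zeta> \<partial>\<mu>)"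
proof -
  assume p: "0 < p"
  (* The power \<open>q\<close> in the weighted inequality turns this exponent into \<open>p\<close>. *)
  define s where "s = p / q"
  have s: "0 < s" "s * q = p" unfolding s_def using p q by auto
  define n where "n = Suc (Suc m)"
  obtain c where c: "0 < c" and box0: "\<forall>g s w y \<phi> h R. g \<in> borel_measurable borel \<and> 0 < s \<and> w \<in> unit_disc \<and> 0 < y \<and> \<phi> \<in> angles
    \<and> h = gap w / 2 \<and> R = measure \<eta> (annulus h) \<longrightarrow>
   (\<integral>\<^sup>+\<zeta>\<in>carleson_box h \<phi>. ennreal (cmod (g \<zeta>) powr s * kap w \<zeta> ^ Suc (Suc m)) * indicator (annulus h) \<zeta> \<partial>\<eta>)
   \<le> ennreal (c * h * R * y) * ennreal (kap w (box_pt h \<phi>) ^ 2)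
     + ennreal (c * h * R * y powr (1 - q)) *
       (\<integral>\<^sup>+\<zeta>\<in>carleson_box h \<phi>. J (s * q) (Suc (Suc m)) g w \<zeta> * indicator (annulus h) \<zeta> \<partial>\<mu>)"
    using box_Hoelder[of m] by (elim exE conjE) (rule that)
  have box: "(\<integral>\<^sup>+\<zeta>\<in>carleson_box h \<phi>. ennreal (cmod (g \<zeta>) powr s * kap w \<zeta> ^ n) * indicator (annulus h) \<zeta> \<partial>\<eta>)
   \<le> ennreal (c * h * R * y) * ennreal (kap w (box_pt h \<phi>) ^ 2)
     + ennreal (c * h * R * y powr (1 - q)) *
       (\<integral>\<^sup>+\<zeta>\<in>carleson_box h \<phi>. J p n g w \<zeta> * indicator (annulus h) \<zeta> \<partial>\<mu>)"
    if "g \<in> borel_measurable borel" "w \<in> unit_disc" "0 < y" "\<phi> \<in> angles" "h = gap w / 2" "R = measure \<eta> (annulus h)"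
    for g w y \<phi> h R
    by (rule box0[rule_format, of g s w y \<phi> h R, unfolded s(2), folded n_def]) (intro conjI s(1) that)
  define cM where "cM = (2 ^ Suc m * 3 ^ n :: real)"
  define c2 where "c2 = cM * c * (32 * pi)"
  have cM: "0 < cM" unfolding cM_def by simp
  have c2: "0 < c2" unfolding c2_def using cM c by simp
  have "ennreal (cmod (g w) powr p) \<le> ennreal ((2 * c2) powr q) * (\<integral>\<^sup>+\<zeta>\<in>annulus (gap w / 2). J p n g w \<zeta> \<partial>\<mu>)"
    if gh: "g holomorphic_on unit_disc" and gm: "g \<in> borel_measurable borel" and w: "w \<in> unit_disc" for g w
  proof -
    note [measurable] = gm
    define h where "h = gap w / 2"
    have gp: "0 < gap w" using w by (rule gap_pos)
    have h: "0 < h" "h < 1" "gap w = 2 * h" unfolding h_def using gp gap_le_1[of w] by auto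
    define R where "R = measure \<eta> (annulus h)"
    have R: "0 < R" unfolding R_def by (rule eta_annulus_pos[OF h(1,2)])
    define Z where "Z = (\<integral>\<^sup>+\<zeta>\<in>annulus h. J p n g w \<zeta> \<partial>\<mu>)"
    define u where "u = cmod (g w) powr s"
    have u: "0 \<le> u" unfolding u_def by simp
    have sr: "indicator (annulus h) \<zeta> * indicator {\<xi>. 1 - h \<le> cmod \<xi> \<and> cmod \<xi> < 1} \<zeta> = (indicator (annulus h) \<zeta> :: ennreal)" for \<zeta>
      using annulus_subset_strip[OF h(1)] unfolding strip_def by (auto simp: indicator_def)
    show ?thesis
    proof (cases "Z = \<infinity>")
      case True
      then show ?thesis using c2 unfolding Z_def[symmetric] h_def[symmetric] by (simp add: ennreal_mult_top)
    next
      case False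
      then obtain z where z: "Z = ennreal z" "0 \<le> z" by (cases Z) auto
      have "u \<le> c2 * (y + y powr (1 - q) * z)" if y: "0 < y" for y
      proof -
        define F where "F \<zeta> = ennreal (cmod (g \<zeta>) powr s * kap w \<zeta> ^ n) * indicator (annulus h) \<zeta>" for \<zeta>
        have Fm[measurable]: "F \<in> borel_measurable borel" unfolding F_def by measurable
        have [measurable]: "J p n g w \<in> borel_measurable borel" by (rule J_measurable[OF gm])
        define G where "G \<zeta> = J p n g w \<zeta> * indicator (annulus h) \<zeta>" for \<zeta>
        have Gm[measurable]: "G \<in> borel_measurable borel" unfolding G_def by measurable
        note avF = carleson_box_average[OF finite_eta sets_eta Fm h(1,2)]
        note avG = carleson_box_average[OF finite_mu sets_mu Gm h(1,2)]
        define D where "D = c * h * R * y"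
        define E where "E = c * h * R * y powr (1 - q)"
        have D0: "0 \<le> D" "0 \<le> E" unfolding D_def E_def using c h R y by auto
        have bm: "(\<lambda>\<phi>. ennreal (kap w (box_pt h \<phi>) ^ 2)) \<in> borel_measurable borel"
          unfolding box_pt_def by measurable
        have "ennreal h * (\<integral>\<^sup>+\<zeta>. F \<zeta> \<partial>\<eta>) \<le> (\<integral>\<^sup>+\<phi>\<in>angles. (\<integral>\<^sup>+\<zeta>\<in>carleson_box h \<phi>. F \<zeta> \<partial>\<eta>) \<partial>lborel)"
          using avF(1) unfolding F_def mult.assoc sr .
        also have "\<dots> \<le> (\<integral>\<^sup>+\<phi>. ennreal D * (ennreal (kap w (box_pt h \<phi>) ^ 2) * indicator angles \<phi>)
            + ennreal E * ((\<integral>\<^sup>+\<zeta>\<in>carleson_box h \<phi>. G \<zeta> \<partial>\<mu>) * indicator angles \<phi>) \<partial>lborel)"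
        proof (rule nn_integral_mono)
          fix \<phi>
          show "(\<integral>\<^sup>+\<zeta>\<in>carleson_box h \<phi>. F \<zeta> \<partial>\<eta>) * indicator angles \<phi>
            \<le> ennreal D * (ennreal (kap w (box_pt h \<phi>) ^ 2) * indicator angles \<phi>)
              + ennreal E * ((\<integral>\<^sup>+\<zeta>\<in>carleson_box h \<phi>. G \<zeta> \<partial>\<mu>) * indicator angles \<phi>)"
          proof (cases "\<phi> \<in> angles")
            case True
            then show ?thesis using box[OF gm w y True h_def R_def] unfolding F_def G_def D_def E_def by simp
          qed simp
        qed
        also have "\<dots> = ennreal D * (\<integral>\<^sup>+\<phi>\<in>angles. ennreal (kap w (box_pt h \<phi>) ^ 2) \<partial>lborel)
            + ennreal E * (\<integral>\<^sup>+\<phi>\<in>angles. (\<integral>\<^sup>+\<zeta>\<in>carleson_box h \<phi>. G \<zeta> \<partial>\<mu>) \<partial>lborel)"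
        proof -
          have m1: "(\<lambda>\<phi>. ennreal (kap w (box_pt h \<phi>) ^ 2) * indicator angles \<phi>) \<in> borel_measurable lborel"
            using bm by measurable
          have m2: "(\<lambda>\<phi>. (\<integral>\<^sup>+\<zeta>\<in>carleson_box h \<phi>. G \<zeta> \<partial>\<mu>) * indicator angles \<phi>) \<in> borel_measurable lborel"
            using avG(3) by measurable
          show ?thesis
            using nn_integral_add[OF borel_measurable_times_ennreal[OF borel_measurable_const m1, of "ennreal D"]
                borel_measurable_times_ennreal[OF borel_measurable_const m2, of "ennreal E"]]
            unfolding nn_integral_cmult[OF m1] nn_integral_cmult[OF m2] .
        qed
        also have "\<dots> \<le> ennreal D * ennreal (32 * pi * gap w) + ennreal E * (ennreal (3 * h) * Z)"
        proof (intro add_mono mult_left_mono)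
          show "(\<integral>\<^sup>+\<phi>\<in>angles. ennreal (kap w (box_pt h \<phi>) ^ 2) \<partial>lborel) \<le> ennreal (32 * pi * gap w)"
            using kap_box_pt_integral[OF w] unfolding h_def .
          show "(\<integral>\<^sup>+\<phi>\<in>angles. (\<integral>\<^sup>+\<zeta>\<in>carleson_box h \<phi>. G \<zeta> \<partial>\<mu>) \<partial>lborel) \<le> ennreal (3 * h) * Z"
            using avG(2) unfolding G_def Z_def mult.assoc sr .
        qed auto
        also have "\<dots> = ennreal (D * (32 * pi * gap w) + E * (3 * h * z))"
          unfolding z(1) using D0 z(2) h gp
          by (simp add: ennreal_mult'[symmetric] ennreal_plus[symmetric] del: ennreal_plus)
        finally have L: "ennreal h * (\<integral>\<^sup>+\<zeta>. F \<zeta> \<partial>\<eta>) \<le> ennreal (D * (32 * pi * gap w) + E * (3 * h * z))" .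
        have "ennreal (u * gap w * R) \<le> ennreal cM * (\<integral>\<^sup>+\<zeta>. F \<zeta> \<partial>\<eta>)"
          using annulus_mean[OF gh gm s(1) w, of "Suc m"]
          unfolding u_def R_def h_def F_def cM_def n_def by simp
        then have "ennreal h * ennreal (u * gap w * R) \<le> ennreal h * (ennreal cM * (\<integral>\<^sup>+\<zeta>. F \<zeta> \<partial>\<eta>))"
          by (rule mult_left_mono) simp
        also have "\<dots> = ennreal cM * (ennreal h * (\<integral>\<^sup>+\<zeta>. F \<zeta> \<partial>\<eta>))" by (simp only: mult.left_commute)
        also have "\<dots> \<le> ennreal cM * ennreal (D * (32 * pi * gap w) + E * (3 * h * z))"
          by (rule mult_left_mono[OF L]) simp
        finally have "ennreal (h * (u * gap w * R)) \<le> ennreal (cM * (D * (32 * pi * gap w) + E * (3 * h * z)))"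
          using h cM by (simp add: ennreal_mult'[symmetric])
        then have "h * (u * gap w * R) \<le> cM * (D * (32 * pi * gap w) + E * (3 * h * z))"
          using cM D0 gp h z by (subst (asm) ennreal_le_iff) auto
        also have "\<dots> = 2 * h * h * R * (cM * c * (32 * pi * y + 3/2 * (y powr (1 - q) * z)))"
          unfolding D_def E_def h(3) by (simp add: algebra_simps)
        also have "\<dots> \<le> 2 * h * h * R * (cM * c * (32 * pi * y + 32 * pi * (y powr (1 - q) * z)))"
          using h R cM c z pi_gt3 by (intro mult_left_mono add_mono mult_right_mono) auto
        finally have "(2 * h * h * R) * u \<le> (2 * h * h * R) * (c2 * (y + y powr (1 - q) * z))"
          unfolding c2_def h(3) by (simp add: algebra_simps)
        then show ?thesis using h R by (subst (asm) mult_le_cancel_left_pos) auto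
      qed
      from powr_le_of_linear_bounds[OF u c2 q z(2) this] have "u powr q \<le> (2 * c2) powr q * z" .
      moreover have "u powr q = cmod (g w) powr p" unfolding u_def powr_powr s(2) ..
      ultimately have "ennreal (cmod (g w) powr p) \<le> ennreal ((2 * c2) powr q * z)" by (simp add: ennreal_leI)
      also have "\<dots> = ennreal ((2 * c2) powr q) * Z" unfolding z(1) by (simp add: ennreal_mult')
      finally show ?thesis unfolding Z_def h_def .
    qed
  qed
  moreover have "0 < (2 * c2) powr q" using c2 by simp
  ultimately show ?thesis unfolding n_def by blast
qed

end

section \<open>Boundedness of the averaging operator\<close>

lemma half_powr_less_one: "0 < e \<Longrightarrow> (1/2) powr e < 1" for e :: real
  using powr_less_mono2[of e "1/2" 1] by simp

lemma suminf_dyadic_powr_le: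
  fixes p X :: real
  assumes p: "0 < p"
  shows "(\<Sum>n. ennreal (((1/2) ^ n) powr p) * indicator {..X} ((1/2) ^ n)) \<le> ennreal (1 / (1 - (1/2) powr p)) * ennreal (X powr p)"
proof (cases "0 < X")
  case False
  have "indicator {..X} ((1/2::real) ^ n) = (0::ennreal)" for n
    using False by (auto simp: indicator_def not_le intro: less_le_trans[of _ 0]) (meson less_le_trans not_le zero_less_power half_gt_zero_iff zero_less_one)
  then show ?thesis by simp
next
  case X: True
  define r where "r = (1/2) powr p"
  have r: "0 < r" "r < 1" unfolding r_def using half_powr_less_one[OF p] by auto
  have rn: "((1/2) ^ n) powr p = r ^ n" for n :: nat
  proof -
    have "((1/2::real) ^ n) powr p = ((1/2) powr real n) powr p" by (simp add: powr_realpow)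
    also have "\<dots> = ((1/2) powr p) powr real n" by (simp only: powr_powr mult.commute)
    also have "\<dots> = r ^ n" unfolding r_def by (simp add: powr_realpow)
    finally show ?thesis .
  qed
  obtain N where N: "(1/2::real) ^ N < X" using real_arch_pow_inv[OF X, of "1/2"] by auto
  define n0 where "n0 = (LEAST n. (1/2::real) ^ n \<le> X)"
  have n0: "(1/2::real) ^ n0 \<le> X" unfolding n0_def by (rule LeastI[of _ N]) (use N in simp)
  have n0': "n0 \<le> n" if "(1/2::real) ^ n \<le> X" for n unfolding n0_def using that by (rule Least_le)
  define f where "f n = (if n0 \<le> n then r ^ n else 0)" for n
  have "(\<lambda>i. f (i + n0)) sums (r ^ n0 * (1 / (1 - r)))"
  proof -
    have "(\<lambda>i. r ^ n0 * r ^ i) sums (r ^ n0 * (1 / (1 - r)))"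
      by (intro sums_mult geometric_sums) (use r in auto)
    then show ?thesis unfolding f_def by (simp add: power_add mult.commute)
  qed
  then have fs: "f sums (r ^ n0 * (1 / (1 - r)))"
    by (subst (asm) sums_zero_iff_shift) (auto simp: f_def)
  have "(\<Sum>n. ennreal (((1/2) ^ n) powr p) * indicator {..X} ((1/2) ^ n)) \<le> (\<Sum>n. ennreal (f n))"
    using n0' r unfolding rn f_def by (intro suminf_le summableI) (auto simp: indicator_def)
  also have "\<dots> = ennreal (r ^ n0 * (1 / (1 - r)))"
    by (rule suminf_ennreal_eq[OF _ fs]) (use r in \<open>auto simp: f_def\<close>)
  also have "\<dots> \<le> ennreal (1 / (1 - r) * X powr p)"
  proof -
    have "r ^ n0 \<le> X powr p" unfolding rn[symmetric] using n0 p by (intro powr_mono2) auto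
    then show ?thesis using r by (intro ennreal_leI) (simp add: divide_right_mono)
  qed
  also have "\<dots> = ennreal (1 / (1 - r)) * ennreal (X powr p)" using r by (intro ennreal_mult') simp
  finally show ?thesis unfolding r_def .
qed

text \<open>
  For \<open>p > 1\<close> this is Hoelder's inequality, for \<open>p \<le> 1\<close> the subadditivity of \<open>x\<^sup>p\<close>. A uniform
  argument: if \<open>T\<close> is the sum on the right, each term satisfies \<open>x\<^sub>n \<le> T\<^sup>1\<^sup>/\<^sup>p b\<^sup>N\<^sup>-\<^sup>n\<close> with
  \<open>b = 2\<^sup>-\<^sup>e\<^sup>/\<^sup>p\<close>, and these bounds form a geometric series.
\<close>

lemma powr_sum_le_geometric_weights:
  fixes p e :: real
  assumes p: "0 < p" and e: "0 < e"
  shows "\<exists>c>0. \<forall>(N::nat) x. (\<forall>n. 0 \<le> x n) \<longrightarrow>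
    (\<Sum>n\<le>N. x n) powr p \<le> c * (\<Sum>n\<le>N. (2 ^ (N - n)) powr e * x n powr p)"
proof -
  define b where "b = (1/2::real) powr (e / p)"
  have b: "0 < b" "b < 1" unfolding b_def using half_powr_less_one[of "e / p"] p e by auto
  define c where "c = (1 / (1 - b)) powr p"
  have c: "0 < c" unfolding c_def using b by simp
  have "(\<Sum>n\<le>N. x n) powr p \<le> c * (\<Sum>n\<le>N. (2 ^ (N - n)) powr e * x n powr p)"
    if x: "\<forall>n. 0 \<le> x n" for N :: nat and x :: "nat \<Rightarrow> real"
  proof -
    define T where "T = (\<Sum>n\<le>N. (2 ^ (N - n)) powr e * x n powr p)"
    have T0: "0 \<le> T" unfolding T_def by (intro sum_nonneg) auto
    have xn: "x n \<le> T powr (1 / p) * b ^ (N - n)" if n: "n \<le> N" for n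
    proof -
      have "(2 ^ (N - n)) powr e * x n powr p \<le> T"
        unfolding T_def using n by (intro member_le_sum[of n "{..N}" "\<lambda>n. (2 ^ (N - n)) powr e * x n powr p"]) auto
      then have "((2 ^ (N - n)) powr e * x n powr p) powr (1 / p) \<le> T powr (1 / p)"
        using p by (intro powr_mono2) auto
      moreover have "((2 ^ (N - n)) powr e * x n powr p) powr (1 / p) = (2 ^ (N - n)) powr (e / p) * x n"
        using x p by (subst powr_mult) (simp add: powr_powr)
      ultimately have le: "(2 ^ (N - n)) powr (e / p) * x n \<le> T powr (1 / p)" by simp
      have "b ^ (N - n) * (2 ^ (N - n)) powr (e / p) = 1"
      proof -
        have "(2 ^ (N - n)) powr (e / p) = (2 powr (e / p)) ^ (N - n)"
        proof -
          have "(2 ^ (N - n) :: real) powr (e / p) = (2 powr real (N - n)) powr (e / p)" by (subst powr_realpow) auto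
          also have "\<dots> = (2 powr (e / p)) powr real (N - n)" by (simp only: powr_powr mult.commute)
          also have "\<dots> = (2 powr (e / p)) ^ (N - n)" by (rule powr_realpow) simp
          finally show ?thesis .
        qed
        moreover have "b * 2 powr (e / p) = 1" unfolding b_def powr_mult[symmetric] by simp
        ultimately show ?thesis by (simp only: power_mult_distrib[symmetric] power_one)
      qed
      then have "x n = b ^ (N - n) * ((2 ^ (N - n)) powr (e / p) * x n)" by (simp only: mult.assoc[symmetric] mult_1)
      also have "\<dots> \<le> b ^ (N - n) * T powr (1 / p)" using le b by (intro mult_left_mono) auto
      finally show ?thesis by (simp only: mult.commute)
    qed
    have "(\<Sum>n\<le>N. x n) \<le> (\<Sum>n\<le>N. T powr (1 / p) * b ^ (N - n))" using xn by (intro sum_mono) auto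
    also have "\<dots> = T powr (1 / p) * (\<Sum>n\<le>N. b ^ (N - n))" by (simp only: sum_distrib_left)
    also have "(\<Sum>n\<le>N. b ^ (N - n)) = (\<Sum>n\<le>N. b ^ n)"
      using sum.nat_diff_reindex[of "\<lambda>n. b ^ n" "Suc N"] by (simp add: lessThan_Suc_atMost)
    also have "T powr (1 / p) * (\<Sum>n\<le>N. b ^ n) \<le> T powr (1 / p) * (1 / (1 - b))"
    proof (rule mult_left_mono)
      have "(\<Sum>n<Suc N. b ^ n) \<le> (\<Sum>n. b ^ n)"
        using b by (intro sum_le_suminf summable_geometric) auto
      also have "\<dots> = 1 / (1 - b)" using b by (intro suminf_geometric) auto
      finally show "(\<Sum>n\<le>N. b ^ n) \<le> 1 / (1 - b)" by (simp only: lessThan_Suc_atMost)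
    qed simp
    finally have "(\<Sum>n\<le>N. x n) powr p \<le> (T powr (1 / p) * (1 / (1 - b))) powr p"
      using x p by (intro powr_mono2 sum_nonneg) auto
    also have "\<dots> = c * T"
    proof -
      have "(T powr (1 / p) * (1 / (1 - b))) powr p = (T powr (1 / p)) powr p * (1 / (1 - b)) powr p"
        by (rule powr_mult)
      also have "(T powr (1 / p)) powr p = T" using T0 p by (simp add: powr_powr)
      finally show ?thesis unfolding c_def by (simp only: mult.commute)
    qed
    finally show ?thesis unfolding T_def .
  qed
  with c show ?thesis by blast
qed

lemma powr_add_le:
  fixes a b p :: real
  assumes "0 \<le> a" "0 \<le> b" "0 < p"
  shows "(a + b) powr p \<le> 2 powr p * (a powr p + b powr p)"
proof -
  have "(a + b) powr p \<le> (2 * max a b) powr p" using assms by (intro powr_mono2) auto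
  also have "\<dots> = 2 powr p * (max a b) powr p" by (rule powr_mult)
  also have "(max a b) powr p \<le> a powr p + b powr p" by (auto simp: max_def)
  finally show ?thesis by (simp add: mult_left_mono)
qed

context regular_pair
begin

text \<open>
  An annulus at height comparable to \<open>1 - |z|\<close>, wide enough to contain the annuli of \<open>annulus_bound\<close>
  for all \<open>w\<close> with \<open>|w - z| \<le> (1 - |z|)/2\<close>; these satisfy \<open>(1 - |z|)/2 \<le> 1 - |w| \<le> 3(1 - |z|)/2\<close>.
\<close>

definition near :: "complex \<Rightarrow> complex set" where
  "near z = {\<zeta>. gap z \<le> 4 * K * gap \<zeta> \<and> gap \<zeta> \<le> gap z}"

definition Phi :: "real \<Rightarrow> (complex \<Rightarrow> complex) \<Rightarrow> complex \<Rightarrow> ennreal" where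
  "Phi p g z = (\<integral>\<^sup>+\<zeta>\<in>near z. J p expo g z \<zeta> \<partial>\<mu>)"

lemma near_measurable_pair:
  assumes [measurable]: "Z \<in> borel_measurable borel"
  shows "(\<lambda>x. indicator (near (Z (fst x))) (snd x) :: ennreal) \<in> borel_measurable (\<mu> \<Otimes>\<^sub>M \<mu>)"
proof -
  have "(\<lambda>x. indicator (near (Z (fst x))) (snd x) :: ennreal)
     = (\<lambda>x. if gap (Z (fst x)) \<le> 4 * K * gap (snd x) \<and> gap (snd x) \<le> gap (Z (fst x)) then 1 else 0)"
    unfolding near_def by (auto simp: indicator_def fun_eq_iff)
  also have "\<dots> \<in> borel_measurable (\<mu> \<Otimes>\<^sub>M \<mu>)" by measurable
  finally show ?thesis .
qed

text \<open>
  Moving the base point from \<open>w\<close> to \<open>z\<close> changes the kernel by a bounded factor only and the annulus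
  stays inside \<open>near z\<close>.
\<close>

lemma local_bound:
  assumes p: "0 < p"
  shows "\<exists>C>0. \<forall>g z w. g holomorphic_on unit_disc \<and> g \<in> borel_measurable borel \<and> z \<in> unit_disc \<and> w \<in> cball z (gap z / 2)
    \<longrightarrow> ennreal (cmod (g w) powr p) \<le> ennreal C * Phi p g z"
proof -
  obtain C where C: "0 < C" and CB: "\<forall>g w. g holomorphic_on unit_disc \<and> g \<in> borel_measurable borel \<and> w \<in> unit_disc \<longrightarrow>
      ennreal (cmod (g w) powr p) \<le> ennreal C * (\<integral>\<^sup>+\<zeta>\<in>annulus (gap w / 2). J p (Suc (Suc expo)) g w \<zeta> \<partial>\<mu>)"
    using annulus_bound[OF p, of expo] by (elim exE conjE) (rule that)
  define n where "n = Suc (Suc expo)"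
  have "ennreal (cmod (g w) powr p) \<le> ennreal (C * 5 ^ n) * Phi p g z"
    if gh: "g holomorphic_on unit_disc" and gm: "g \<in> borel_measurable borel" and z: "z \<in> unit_disc" and w: "w \<in> cball z (gap z / 2)" for g z w
  proof -
    have gz: "0 < gap z" using z by (rule gap_pos)
    have d: "cmod (z - w) \<le> gap z / 2" using w by (simp add: dist_norm)
    have gw: "gap z \<le> 2 * gap w" "2 * gap w \<le> 3 * gap z"
      using gap_lipschitz[of z w] gap_lipschitz[of w z] d by (simp_all add: norm_minus_commute)
    have gw0: "0 < gap w" using gw gz by linarith
    have wd: "w \<in> unit_disc" using gw0 unfolding gap_def by simp
    have "J p n g w \<zeta> * indicator (annulus (gap w / 2)) \<zeta> \<le> ennreal (5 ^ n) * (J p expo g z \<zeta> * indicator (near z) \<zeta>)" for \<zeta>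
    proof (cases "\<zeta> \<in> annulus (gap w / 2)")
      case True
      have "1 - gap w / 2 \<le> cmod \<zeta>" "cmod \<zeta> < 1 - gap w / 2 / K" using True unfolding annulus_def by auto
      then have "gap w / 2 / K \<le> gap \<zeta>" "gap \<zeta> \<le> gap w / 2" unfolding gap_def[of \<zeta>] by linarith+
      then have "gap w \<le> 2 * K * gap \<zeta>" "gap \<zeta> \<le> gap w / 2" using K by (auto simp: field_simps)
      then have near: "\<zeta> \<in> near z" unfolding near_def using gw gz by auto
      have kz: "0 < kap z \<zeta>" "kap z \<zeta> \<le> 1" using kap_bounds[OF gz] by auto
      have "cmod (z - \<zeta>) \<le> gap z / 2 + cmod (w - \<zeta>)" using norm_triangle_ineq[of "z - w" "w - \<zeta>"] d by simp
      then have "gap z + cmod (z - \<zeta>) \<le> 3 * (gap w + cmod (w - \<zeta>))"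
        using gw norm_ge_zero[of "w - \<zeta>"] by argo
      then have "kap w \<zeta> \<le> (3/2 * 3) * kap z \<zeta>" using gw gw0 gz by (intro kap_le_kap) auto
      then have k5: "kap w \<zeta> \<le> 5 * kap z \<zeta>" using kz by linarith
      have "kap w \<zeta> ^ n \<le> (5 * kap z \<zeta>) ^ n"
        using k5 kap_bounds(1)[OF gw0, of \<zeta>] by (intro power_mono) auto
      also have "\<dots> = 5 ^ n * kap z \<zeta> ^ n" by (rule power_mult_distrib)
      also have "\<dots> \<le> 5 ^ n * kap z \<zeta> ^ expo"
        using kz unfolding n_def by (intro mult_left_mono power_decreasing) auto
      finally have "kap w \<zeta> ^ n * cmod (g \<zeta>) powr p \<le> 5 ^ n * kap z \<zeta> ^ expo * cmod (g \<zeta>) powr p"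
        by (intro mult_right_mono) auto
      then have "ennreal (kap w \<zeta> ^ n * cmod (g \<zeta>) powr p) \<le> ennreal (5 ^ n * (kap z \<zeta> ^ expo * cmod (g \<zeta>) powr p))"
        by (intro ennreal_leI) (simp only: mult.assoc)
      also have "\<dots> = ennreal (5 ^ n) * ennreal (kap z \<zeta> ^ expo * cmod (g \<zeta>) powr p)"
        by (rule ennreal_mult') simp
      finally have "J p n g w \<zeta> \<le> ennreal (5 ^ n) * J p expo g z \<zeta>"
        unfolding J_def ennreal_times_divide by (rule divide_right_mono_ennreal)
      then show ?thesis using True near by simp
    qed simp
    then have "(\<integral>\<^sup>+\<zeta>\<in>annulus (gap w / 2). J p n g w \<zeta> \<partial>\<mu>) \<le> (\<integral>\<^sup>+\<zeta>. ennreal (5 ^ n) * (J p expo g z \<zeta> * indicator (near z) \<zeta>) \<partial>\<mu>)"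
      by (rule nn_integral_mono)
    also have "\<dots> = ennreal (5 ^ n) * Phi p g z"
      unfolding Phi_def
    proof (rule nn_integral_cmult)
      have "near z \<in> sets borel" unfolding near_def by measurable
      then show "(\<lambda>\<zeta>. J p expo g z \<zeta> * indicator (near z) \<zeta>) \<in> borel_measurable \<mu>"
        using J_measurable[OF gm, of p expo z] by measurable
    qed
    finally have B: "(\<integral>\<^sup>+\<zeta>\<in>annulus (gap w / 2). J p n g w \<zeta> \<partial>\<mu>) \<le> ennreal (5 ^ n) * Phi p g z" .
    have "ennreal (cmod (g w) powr p) \<le> ennreal C * (\<integral>\<^sup>+\<zeta>\<in>annulus (gap w / 2). J p n g w \<zeta> \<partial>\<mu>)"
      using CB[rule_format, of g w, folded n_def] gh gm wd by simp
    also have "\<dots> \<le> ennreal C * (ennreal (5 ^ n) * Phi p g z)" by (rule mult_left_mono[OF B]) simp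
    also have "\<dots> = ennreal (C * 5 ^ n) * Phi p g z"
      using C by (subst ennreal_mult') (auto simp: mult.assoc)
    finally show ?thesis .
  qed
  moreover have "0 < C * 5 ^ n" using C by simp
  ultimately show ?thesis by blast
qed

text \<open>
  For \<open>\<zeta>\<close> at the height of \<open>Z z\<close>, the kernel based at \<open>Z z\<close> and evaluated at \<open>\<zeta>\<close> is at most a
  constant times the one based at \<open>\<zeta>\<close> and evaluated at \<open>z\<close>, whose integral is \<open>W \<zeta>\<close>. The map \<open>Z\<close>
  will be the identity or \<open>z \<mapsto> (1 - 2\<^sup>-\<^sup>n) z\<close>.
\<close>

lemma kernel_integral_le:
  "\<exists>C>0. \<forall>\<zeta>\<in>unit_disc. \<forall>E Z. (\<forall>z\<in>E. z \<in> unit_disc \<longrightarrow> Z z \<in> unit_disc \<and> \<zeta> \<in> near (Z z) \<and> cmod (Z z - z) \<le> gap (Z z)) \<longrightarrow>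
    (\<integral>\<^sup>+z\<in>E. ennreal (kap (Z z) \<zeta> ^ expo * (gap \<zeta> / gap z) powr eps) \<partial>\<mu>) \<le> ennreal C * W \<zeta>"
proof -
  define C where "C = (8 * K) ^ expo"
  have C: "0 < C" unfolding C_def using K by simp
  have "(\<integral>\<^sup>+z\<in>E. ennreal (kap (Z z) \<zeta> ^ expo * (gap \<zeta> / gap z) powr eps) \<partial>\<mu>) \<le> ennreal C * W \<zeta>"
    if \<zeta>: "\<zeta> \<in> unit_disc" and Z: "\<forall>z\<in>E. z \<in> unit_disc \<longrightarrow> Z z \<in> unit_disc \<and> \<zeta> \<in> near (Z z) \<and> cmod (Z z - z) \<le> gap (Z z)" for \<zeta> E Z
  proof -
    have g\<zeta>: "0 < gap \<zeta>" using \<zeta> by (rule gap_pos)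
    have "(\<integral>\<^sup>+z\<in>E. ennreal (kap (Z z) \<zeta> ^ expo * (gap \<zeta> / gap z) powr eps) \<partial>\<mu>)
       \<le> (\<integral>\<^sup>+z. ennreal C * ennreal (kap \<zeta> z ^ expo * (gap \<zeta> / gap z) powr eps) \<partial>\<mu>)"
    proof (rule nn_integral_mono_AE)
      show "AE z in \<mu>. ennreal (kap (Z z) \<zeta> ^ expo * (gap \<zeta> / gap z) powr eps) * indicator E z
         \<le> ennreal C * ennreal (kap \<zeta> z ^ expo * (gap \<zeta> / gap z) powr eps)"
        using mu_disc
      proof eventually_elim
        fix z assume z: "z \<in> unit_disc"
        show "ennreal (kap (Z z) \<zeta> ^ expo * (gap \<zeta> / gap z) powr eps) * indicator E z
         \<le> ennreal C * ennreal (kap \<zeta> z ^ expo * (gap \<zeta> / gap z) powr eps)"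
        proof (cases "z \<in> E")
          case True
          then have Zz: "Z z \<in> unit_disc" "\<zeta> \<in> near (Z z)" "cmod (Z z - z) \<le> gap (Z z)" using Z z by auto
          have gZ: "0 < gap (Z z)" using Zz(1) by (rule gap_pos)
          have nr: "gap (Z z) \<le> 4 * K * gap \<zeta>" "gap \<zeta> \<le> gap (Z z)" using Zz(2) unfolding near_def by auto
          have "cmod (\<zeta> - z) \<le> cmod (Z z - \<zeta>) + gap (Z z)"
            using norm_triangle_ineq[of "\<zeta> - Z z" "Z z - z"] Zz(3) by (simp add: norm_minus_commute)
          then have "gap \<zeta> + cmod (\<zeta> - z) \<le> 2 * (gap (Z z) + cmod (Z z - \<zeta>))"
            using nr(2) norm_ge_zero[of "Z z - \<zeta>"] by argo
          then have "kap (Z z) \<zeta> \<le> (4 * K * 2) * kap \<zeta> z" by (rule kap_le_kap[OF gZ g\<zeta> nr(1)])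
          then have "kap (Z z) \<zeta> ^ expo \<le> (8 * K * kap \<zeta> z) ^ expo"
            using kap_bounds(1)[OF gZ, of \<zeta>] by (intro power_mono) auto
          also have "\<dots> = C * kap \<zeta> z ^ expo" unfolding C_def by (rule power_mult_distrib)
          finally have "kap (Z z) \<zeta> ^ expo * (gap \<zeta> / gap z) powr eps \<le> C * kap \<zeta> z ^ expo * (gap \<zeta> / gap z) powr eps"
            by (intro mult_right_mono) auto
          then have "ennreal (kap (Z z) \<zeta> ^ expo * (gap \<zeta> / gap z) powr eps) \<le> ennreal (C * (kap \<zeta> z ^ expo * (gap \<zeta> / gap z) powr eps))"
            by (intro ennreal_leI) (simp only: mult.assoc)
          also have "\<dots> = ennreal C * ennreal (kap \<zeta> z ^ expo * (gap \<zeta> / gap z) powr eps)"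
            using C by (intro ennreal_mult') simp
          finally show ?thesis using True by simp
        qed simp
      qed
    qed
    also have "\<dots> = ennreal C * W \<zeta>" unfolding W_def by (rule nn_integral_cmult) measurable
    finally show ?thesis .
  qed
  with C show ?thesis by blast
qed

lemma near_borel[measurable]: "near z \<in> sets borel"
  unfolding near_def by measurable

lemma Phi_measurable:
  assumes g[measurable]: "g \<in> borel_measurable borel" and Z[measurable]: "Z \<in> borel_measurable borel"
  shows "(\<lambda>x. J p expo g (Z (fst x)) (snd x) * indicator (near (Z (fst x))) (snd x)) \<in> borel_measurable (\<mu> \<Otimes>\<^sub>M \<mu>)"
    and "(\<lambda>z. Phi p g (Z z)) \<in> borel_measurable borel"
proof -
  note [measurable] = near_measurable_pair[OF Z]
  show m: "(\<lambda>x. J p expo g (Z (fst x)) (snd x) * indicator (near (Z (fst x))) (snd x)) \<in> borel_measurable (\<mu> \<Otimes>\<^sub>M \<mu>)"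
    unfolding J_def by measurable
  have "(\<lambda>z. \<integral>\<^sup>+\<zeta>. J p expo g (Z z) \<zeta> * indicator (near (Z z)) \<zeta> \<partial>\<mu>) \<in> borel_measurable \<mu>"
    using mu.borel_measurable_nn_integral[of "\<lambda>z \<zeta>. J p expo g (Z z) \<zeta> * indicator (near (Z z)) \<zeta>" \<mu>] m
    by (simp add: case_prod_beta)
  then show "(\<lambda>z. Phi p g (Z z)) \<in> borel_measurable borel"
    unfolding Phi_def by (simp cong: measurable_cong_sets add: sets_mu)
qed

text \<open>
  Tonelli and \<open>kernel_integral_le\<close>, where the factor \<open>W \<zeta>\<close> cancels the denominator in \<open>J\<close>. The
  functions \<open>v\<close> and \<open>b\<close> carry weights from the variable \<open>z\<close> to \<open>\<zeta>\<close>; the quotient \<open>(gap \<zeta> / gap z)\<^sup>\<epsilon>\<close>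
  between them comes for free, since it is part of \<open>W\<close>.
\<close>

lemma Phi_integral_le:
  "\<exists>C>0. \<forall>p g Z E v b. g \<in> borel_measurable borel \<and> Z \<in> borel_measurable borel \<and> E \<in> sets borel \<and> v \<in> borel_measurable borel \<and>
    b \<in> borel_measurable borel \<and> (\<forall>\<zeta>. 0 \<le> b \<zeta>) \<and>
    (\<forall>z\<in>E. z \<in> unit_disc \<longrightarrow> Z z \<in> unit_disc \<and> cmod (Z z - z) \<le> gap (Z z) \<and>
       (\<forall>\<zeta>\<in>near (Z z). v z \<le> b \<zeta> * (gap \<zeta> / gap z) powr eps)) \<longrightarrow>
    (\<integral>\<^sup>+z\<in>E. ennreal (v z) * Phi p g (Z z) \<partial>\<mu>) \<le> ennreal C * (\<integral>\<^sup>+\<zeta>. ennreal (b \<zeta> * cmod (g \<zeta>) powr p) \<partial>\<mu>)"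
proof -
  interpret P: pair_sigma_finite \<mu> \<mu> by unfold_locales
  obtain C where C: "0 < C" and CK: "\<forall>\<zeta>\<in>unit_disc. \<forall>E Z. (\<forall>z\<in>E. z \<in> unit_disc \<longrightarrow> Z z \<in> unit_disc \<and> \<zeta> \<in> near (Z z) \<and> cmod (Z z - z) \<le> gap (Z z)) \<longrightarrow>
    (\<integral>\<^sup>+z\<in>E. ennreal (kap (Z z) \<zeta> ^ expo * (gap \<zeta> / gap z) powr eps) \<partial>\<mu>) \<le> ennreal C * W \<zeta>"
    using kernel_integral_le by (elim exE conjE) (rule that)
  have "(\<integral>\<^sup>+z\<in>E. ennreal (v z) * Phi p g (Z z) \<partial>\<mu>) \<le> ennreal C * (\<integral>\<^sup>+\<zeta>. ennreal (b \<zeta> * cmod (g \<zeta>) powr p) \<partial>\<mu>)"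
    if gm[measurable]: "g \<in> borel_measurable borel" and Zm[measurable]: "Z \<in> borel_measurable borel" and E[measurable]: "E \<in> sets borel"
      and v[measurable]: "v \<in> borel_measurable borel" and b[measurable]: "b \<in> borel_measurable borel" and b0: "\<forall>\<zeta>. 0 \<le> b \<zeta>"
      and Z: "\<forall>z\<in>E. z \<in> unit_disc \<longrightarrow> Z z \<in> unit_disc \<and> cmod (Z z - z) \<le> gap (Z z) \<and>
       (\<forall>\<zeta>\<in>near (Z z). v z \<le> b \<zeta> * (gap \<zeta> / gap z) powr eps)" for p g Z E v b
  proof -
    note [measurable] = Phi_measurable[OF gm Zm, of p] near_measurable_pair[OF Zm]
    define j where "j z \<zeta> = ennreal (v z) * indicator E z * (J p expo g (Z z) \<zeta> * indicator (near (Z z)) \<zeta>)" for z \<zeta>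
    have jm: "(\<lambda>(z, \<zeta>). j z \<zeta>) \<in> borel_measurable (\<mu> \<Otimes>\<^sub>M \<mu>)"
      unfolding j_def case_prod_beta by measurable
    have "(\<integral>\<^sup>+z\<in>E. ennreal (v z) * Phi p g (Z z) \<partial>\<mu>) = (\<integral>\<^sup>+z. (\<integral>\<^sup>+\<zeta>. j z \<zeta> \<partial>\<mu>) \<partial>\<mu>)"
    proof (rule nn_integral_cong)
      fix z
      have "(\<integral>\<^sup>+\<zeta>. j z \<zeta> \<partial>\<mu>) = ennreal (v z) * indicator E z * Phi p g (Z z)"
        unfolding j_def Phi_def
      proof (rule nn_integral_cmult)
        show "(\<lambda>\<zeta>. J p expo g (Z z) \<zeta> * indicator (near (Z z)) \<zeta>) \<in> borel_measurable \<mu>"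
          using J_measurable[OF gm, of p expo "Z z"] by measurable
      qed
      then show "ennreal (v z) * Phi p g (Z z) * indicator E z = (\<integral>\<^sup>+\<zeta>. j z \<zeta> \<partial>\<mu>)"
        by (simp only: mult_ac)
    qed
    also have "\<dots> = (\<integral>\<^sup>+\<zeta>. (\<integral>\<^sup>+z. j z \<zeta> \<partial>\<mu>) \<partial>\<mu>)" by (rule P.Fubini'[OF jm, symmetric])
    also have "\<dots> \<le> (\<integral>\<^sup>+\<zeta>. ennreal C * ennreal (b \<zeta> * cmod (g \<zeta>) powr p) \<partial>\<mu>)"
    proof (rule nn_integral_mono_AE)
      show "AE \<zeta> in \<mu>. (\<integral>\<^sup>+z. j z \<zeta> \<partial>\<mu>) \<le> ennreal C * ennreal (b \<zeta> * cmod (g \<zeta>) powr p)"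
        using mu_disc
      proof eventually_elim
        fix \<zeta> assume \<zeta>: "\<zeta> \<in> unit_disc"
        obtain w where w: "W \<zeta> = ennreal w" "0 < w"
          using W_finite[OF \<zeta>] W_pos[OF \<zeta>] by (cases "W \<zeta>") auto
        define a where "a = b \<zeta> * cmod (g \<zeta>) powr p"
        have a: "0 \<le> a" unfolding a_def using b0 by simp
        define E' where "E' = {z \<in> E. \<zeta> \<in> near (Z z)}"
        have E': "E' = E \<inter> {z. gap (Z z) \<le> 4 * K * gap \<zeta> \<and> gap \<zeta> \<le> gap (Z z)}"
          unfolding E'_def near_def by auto
        have E'm[measurable]: "E' \<in> sets borel" unfolding E' by measurable
        have "(\<integral>\<^sup>+z. j z \<zeta> \<partial>\<mu>) \<le> (\<integral>\<^sup>+z. ennreal (a / w) * (ennreal (kap (Z z) \<zeta> ^ expo * (gap \<zeta> / gap z) powr eps) * indicator E' z) \<partial>\<mu>)"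
        proof (rule nn_integral_mono_AE)
          show "AE z in \<mu>. j z \<zeta> \<le> ennreal (a / w) * (ennreal (kap (Z z) \<zeta> ^ expo * (gap \<zeta> / gap z) powr eps) * indicator E' z)"
            using mu_disc
          proof eventually_elim
            fix z assume z: "z \<in> unit_disc"
            show "j z \<zeta> \<le> ennreal (a / w) * (ennreal (kap (Z z) \<zeta> ^ expo * (gap \<zeta> / gap z) powr eps) * indicator E' z)"
            proof (cases "z \<in> E'")
              case True
              then have zE: "z \<in> E" "\<zeta> \<in> near (Z z)" unfolding E'_def by auto
              have vb: "v z \<le> b \<zeta> * (gap \<zeta> / gap z) powr eps" using Z zE z by blast
              have "Z z \<in> unit_disc" using Z zE z by blast
              then have k: "0 \<le> kap (Z z) \<zeta>" using kap_bounds(1)[OF gap_pos] by (auto intro: less_imp_le)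
              define x where "x = kap (Z z) \<zeta> ^ expo * cmod (g \<zeta>) powr p / w"
              have x: "0 \<le> x" unfolding x_def using k w by simp
              have "J p expo g (Z z) \<zeta> = ennreal x"
                unfolding J_def w(1) x_def using k w(2) by (intro divide_ennreal) auto
              then have "j z \<zeta> = ennreal (v z) * ennreal x" unfolding j_def using zE by simp
              also have "\<dots> \<le> ennreal (b \<zeta> * (gap \<zeta> / gap z) powr eps) * ennreal x"
                by (rule mult_right_mono[OF ennreal_leI[OF vb]]) simp
              also have "\<dots> = ennreal (b \<zeta> * (gap \<zeta> / gap z) powr eps * x)"
                using b0 by (intro ennreal_mult'[symmetric]) simp
              also have "b \<zeta> * (gap \<zeta> / gap z) powr eps * x = (a / w) * (kap (Z z) \<zeta> ^ expo * (gap \<zeta> / gap z) powr eps)"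
                unfolding a_def x_def by (simp add: mult_ac)
              also have "ennreal \<dots> = ennreal (a / w) * ennreal (kap (Z z) \<zeta> ^ expo * (gap \<zeta> / gap z) powr eps)"
                using a w by (intro ennreal_mult') simp
              finally show ?thesis using True by simp
            next
              case False
              then have "z \<notin> E \<or> \<zeta> \<notin> near (Z z)" unfolding E'_def by blast
              then have "j z \<zeta> = 0" unfolding j_def by auto
              then show ?thesis by simp
            qed
          qed
        qed
        also have "\<dots> = ennreal (a / w) * (\<integral>\<^sup>+z\<in>E'. ennreal (kap (Z z) \<zeta> ^ expo * (gap \<zeta> / gap z) powr eps) \<partial>\<mu>)"
          by (rule nn_integral_cmult) measurable
        also have "\<dots> \<le> ennreal (a / w) * (ennreal C * W \<zeta>)"
        proof (rule mult_left_mono)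
          have "\<forall>z\<in>E'. z \<in> unit_disc \<longrightarrow> Z z \<in> unit_disc \<and> \<zeta> \<in> near (Z z) \<and> cmod (Z z - z) \<le> gap (Z z)"
            unfolding E'_def using Z by blast
          then show "(\<integral>\<^sup>+z\<in>E'. ennreal (kap (Z z) \<zeta> ^ expo * (gap \<zeta> / gap z) powr eps) \<partial>\<mu>) \<le> ennreal C * W \<zeta>"
            using CK \<zeta> by blast
        qed simp
        also have "\<dots> = ennreal (a / w * (C * w))"
          unfolding w(1) using C w a by (simp add: ennreal_mult'[symmetric])
        also have "a / w * (C * w) = C * a" using w by simp
        also have "ennreal (C * a) = ennreal C * ennreal a" using C by (intro ennreal_mult') simp
        finally show "(\<integral>\<^sup>+z. j z \<zeta> \<partial>\<mu>) \<le> ennreal C * ennreal (b \<zeta> * cmod (g \<zeta>) powr p)" unfolding a_def .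
      qed
    qed
    also have "\<dots> = ennreal C * (\<integral>\<^sup>+\<zeta>. ennreal (b \<zeta> * cmod (g \<zeta>) powr p) \<partial>\<mu>)"
      by (rule nn_integral_cmult) measurable
    finally show ?thesis .
  qed
  with C show ?thesis by (intro exI[of _ C] conjI allI impI) (assumption, blast)
qed

lemma integral_Phi_le: "\<exists>C>0. \<forall>p g. g \<in> borel_measurable borel \<longrightarrow>
  (\<integral>\<^sup>+z. Phi p g z \<partial>\<mu>) \<le> ennreal C * (\<integral>\<^sup>+\<zeta>. ennreal (cmod (g \<zeta>) powr p) \<partial>\<mu>)"
proof -
  obtain C where C: "0 < C" and CP: "\<forall>p g Z E v b. g \<in> borel_measurable borel \<and> Z \<in> borel_measurable borel \<and> E \<in> sets borel \<and> v \<in> borel_measurable borel \<and>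
    b \<in> borel_measurable borel \<and> (\<forall>\<zeta>. 0 \<le> b \<zeta>) \<and>
    (\<forall>z\<in>E. z \<in> unit_disc \<longrightarrow> Z z \<in> unit_disc \<and> cmod (Z z - z) \<le> gap (Z z) \<and>
       (\<forall>\<zeta>\<in>near (Z z). v z \<le> b \<zeta> * (gap \<zeta> / gap z) powr eps)) \<longrightarrow>
    (\<integral>\<^sup>+z\<in>E. ennreal (v z) * Phi p g (Z z) \<partial>\<mu>) \<le> ennreal C * (\<integral>\<^sup>+\<zeta>. ennreal (b \<zeta> * cmod (g \<zeta>) powr p) \<partial>\<mu>)"
    using Phi_integral_le by (elim exE conjE) (rule that)
  define B where "B = (4 * K) powr eps"
  have B: "0 < B" unfolding B_def using K by simp
  have "(\<integral>\<^sup>+z. Phi p g z \<partial>\<mu>) \<le> ennreal (C * B) * (\<integral>\<^sup>+\<zeta>. ennreal (cmod (g \<zeta>) powr p) \<partial>\<mu>)"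
    if gm[measurable]: "g \<in> borel_measurable borel" for p g
  proof -
    have *: "\<forall>z\<in>UNIV. z \<in> unit_disc \<longrightarrow> z \<in> unit_disc \<and> cmod (z - z) \<le> gap z \<and>
       (\<forall>\<zeta>\<in>near z. 1 \<le> B * (gap \<zeta> / gap z) powr eps)"
    proof (intro ballI impI conjI)
      fix z \<zeta> assume z: "z \<in> unit_disc" and \<zeta>: "\<zeta> \<in> near z"
      have g: "0 < gap z" using z by (rule gap_pos)
      have "gap z \<le> 4 * K * gap \<zeta>" using \<zeta> unfolding near_def by simp
      then have "1 \<le> 4 * K * (gap \<zeta> / gap z)" using g by simp
      then have "1 \<le> (4 * K * (gap \<zeta> / gap z)) powr eps" using eps_pos by (intro ge_one_powr_ge_zero) auto
      also have "\<dots> = B * (gap \<zeta> / gap z) powr eps" unfolding B_def by (rule powr_mult)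
      finally show "1 \<le> B * (gap \<zeta> / gap z) powr eps" .
    qed (use gap_pos in \<open>auto intro: less_imp_le\<close>)
    have "(\<integral>\<^sup>+z. Phi p g z \<partial>\<mu>) = (\<integral>\<^sup>+z\<in>UNIV. ennreal 1 * Phi p g z \<partial>\<mu>)" by simp
    also have "\<dots> \<le> ennreal C * (\<integral>\<^sup>+\<zeta>. ennreal (B * cmod (g \<zeta>) powr p) \<partial>\<mu>)"
      using CP[rule_format, of g "\<lambda>z. z" UNIV "\<lambda>_. 1" "\<lambda>_. B" p] * gm B by simp
    also have "(\<integral>\<^sup>+\<zeta>. ennreal (B * cmod (g \<zeta>) powr p) \<partial>\<mu>) = (\<integral>\<^sup>+\<zeta>. ennreal B * ennreal (cmod (g \<zeta>) powr p) \<partial>\<mu>)"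
      using B by (intro nn_integral_cong ennreal_mult') simp
    also have "\<dots> = ennreal B * (\<integral>\<^sup>+\<zeta>. ennreal (cmod (g \<zeta>) powr p) \<partial>\<mu>)"
      by (rule nn_integral_cmult) measurable
    finally show ?thesis using C by (subst ennreal_mult') (auto simp: mult.assoc)
  qed
  moreover have "0 < C * B" using C B by simp
  ultimately show ?thesis by blast
qed

text \<open>
  At the origin the averaging is over a set at a fixed distance from the boundary, where \<open>W\<close> is
  bounded below.
\<close>

lemma Phi_0_le: "\<exists>C>0. \<forall>p g. g \<in> borel_measurable borel \<longrightarrow>
  Phi p g 0 \<le> ennreal C * (\<integral>\<^sup>+\<zeta>. ennreal (cmod (g \<zeta>) powr p) \<partial>\<mu>)"
proof -
  define b where "b = 1 / (4 * K)"
  have b: "0 < b" unfolding b_def using K by simp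
  define c where "c = (b / 3) ^ expo * b powr eps * measure \<mu> UNIV"
  have c: "0 < c" unfolding c_def using b mu_UNIV_pos by simp
  have g0: "gap 0 = 1" unfolding gap_def by simp
  have "Phi p g 0 \<le> ennreal (1 / c) * (\<integral>\<^sup>+\<zeta>. ennreal (cmod (g \<zeta>) powr p) \<partial>\<mu>)"
    if gm[measurable]: "g \<in> borel_measurable borel" for p g
  proof -
    have "Phi p g 0 \<le> (\<integral>\<^sup>+\<zeta>. ennreal (1 / c) * ennreal (cmod (g \<zeta>) powr p) \<partial>\<mu>)"
      unfolding Phi_def
    proof (rule nn_integral_mono_AE)
      show "AE \<zeta> in \<mu>. J p expo g 0 \<zeta> * indicator (near 0) \<zeta> \<le> ennreal (1 / c) * ennreal (cmod (g \<zeta>) powr p)"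
        using mu_disc
      proof eventually_elim
        fix \<zeta> assume \<zeta>: "\<zeta> \<in> unit_disc"
        show "J p expo g 0 \<zeta> * indicator (near 0) \<zeta> \<le> ennreal (1 / c) * ennreal (cmod (g \<zeta>) powr p)"
        proof (cases "\<zeta> \<in> near 0")
          case True
          then have "b \<le> gap \<zeta>" unfolding near_def g0 b_def using K by (simp add: field_simps)
          then have "c \<le> (gap \<zeta> / 3) ^ expo * gap \<zeta> powr eps * measure \<mu> UNIV"
            unfolding c_def using b eps_pos by (intro mult_right_mono mult_mono power_mono powr_mono2) auto
          then have "ennreal c \<le> W \<zeta>" using W_ge[OF \<zeta>] by (meson ennreal_leI order_trans)
          moreover obtain w where w: "W \<zeta> = ennreal w" "0 < w"
            using W_finite[OF \<zeta>] W_pos[OF \<zeta>] by (cases "W \<zeta>") auto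
          ultimately have cw: "c \<le> w" by simp
          have k: "0 \<le> kap 0 \<zeta>" "kap 0 \<zeta> \<le> 1" using kap_bounds[of 0 \<zeta>] g0 by auto
          have "kap 0 \<zeta> ^ expo * cmod (g \<zeta>) powr p / w \<le> 1 * cmod (g \<zeta>) powr p / c"
            using k cw c by (intro frac_le mult_right_mono power_le_one) auto
          then have "J p expo g 0 \<zeta> \<le> ennreal (1 / c * cmod (g \<zeta>) powr p)"
            unfolding J_def w(1) using k w(2) by (subst divide_ennreal) (auto intro!: ennreal_leI)
          also have "\<dots> = ennreal (1 / c) * ennreal (cmod (g \<zeta>) powr p)" using c by (intro ennreal_mult') simp
          finally show ?thesis using True by simp
        qed simp
      qed
    qed
    also have "\<dots> = ennreal (1 / c) * (\<integral>\<^sup>+\<zeta>. ennreal (cmod (g \<zeta>) powr p) \<partial>\<mu>)"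
      by (rule nn_integral_cmult) measurable
    finally show ?thesis .
  qed
  moreover have "0 < 1 / c" using c by simp
  ultimately show ?thesis by blast
qed

end

section \<open>Estimates between a function and its derivatives\<close>

lemma holomorphic_increment_bound:
  assumes "\<And>x. x \<in> S \<Longrightarrow> (f has_field_derivative g x) (at x)" "convex S" "\<And>x. x \<in> S \<Longrightarrow> cmod (g x) \<le> B" "x \<in> S" "y \<in> S"
  shows "cmod (f y - f x) \<le> B * cmod (y - x)"
  using assms by (intro field_differentiable_bound[where f'=g and S=S]) (auto intro: has_field_derivative_at_within)

lemma ennreal_sum_le_suminf:
  fixes f :: "nat \<Rightarrow> ennreal"
  assumes "finite I" shows "(\<Sum>n\<in>I. f n) \<le> (\<Sum>n. f n)"
  using assms by (intro sum_le_suminf summableI) auto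

context regular_pair
begin

text \<open>
  Cauchy's inequality on the disc on which \<open>local_bound\<close> controls \<open>f\<close>.
\<close>

lemma Cauchy_local:
  assumes p: "0 < p"
  shows "\<exists>C>0. \<forall>f z. f holomorphic_on unit_disc \<and> f \<in> borel_measurable borel \<and> z \<in> unit_disc \<longrightarrow>
    ennreal (cmod ((deriv ^^ k) f z) powr p * gap z powr (real k * p)) \<le> ennreal C * Phi p f z"
proof -
  obtain C where C: "0 < C" and CB: "\<forall>g z w. g holomorphic_on unit_disc \<and> g \<in> borel_measurable borel \<and> z \<in> unit_disc \<and> w \<in> cball z (gap z / 2)
    \<longrightarrow> ennreal (cmod (g w) powr p) \<le> ennreal C * Phi p g z"
    using local_bound[OF p] by (elim exE conjE) (rule that)
  define c where "c = (fact k * 2 ^ k :: real) powr p"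
  have c: "0 < c" unfolding c_def by simp
  have "ennreal (cmod ((deriv ^^ k) f z) powr p * gap z powr (real k * p)) \<le> ennreal (c * C) * Phi p f z"
    if f: "f holomorphic_on unit_disc" and fm: "f \<in> borel_measurable borel" and z: "z \<in> unit_disc" for f z
  proof -
    have g: "0 < gap z" using z by (rule gap_pos)
    have sub: "cball z (gap z / 2) \<subseteq> unit_disc"
    proof
      fix w assume "w \<in> cball z (gap z / 2)"
      then have "cmod (z - w) \<le> gap z / 2" by (simp add: dist_norm)
      then have "0 < gap w" using gap_lipschitz[of z w] g by linarith
      then show "w \<in> unit_disc" unfolding gap_def by simp
    qed
    show ?thesis
    proof (cases "Phi p f z = \<infinity>")
      case True
      then show ?thesis using c C by (simp add: ennreal_mult_top)
    next
      case False
      then obtain v where v: "Phi p f z = ennreal v" "0 \<le> v" by (cases "Phi p f z") auto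
      define B where "B = (C * v) powr (1 / p)"
      have fB: "cmod (f w) \<le> B" if w: "w \<in> cball z (gap z / 2)" for w
      proof -
        have "ennreal (cmod (f w) powr p) \<le> ennreal (C * v)"
          using CB[rule_format, of f z w] f fm z w C v by (simp add: ennreal_mult')
        then have "cmod (f w) powr p \<le> C * v" using C v(2) by (subst (asm) ennreal_le_iff) auto
        then have "(cmod (f w) powr p) powr (1 / p) \<le> B" unfolding B_def using p by (intro powr_mono2) auto
        then show ?thesis using p by (simp add: powr_powr)
      qed
      have "cmod ((deriv ^^ k) f z) \<le> fact k * B / (gap z / 2) ^ k"
      proof (rule Cauchy_inequality)
        show "f holomorphic_on ball z (gap z / 2)" using f sub ball_subset_cball holomorphic_on_subset by blast
        show "continuous_on (cball z (gap z / 2)) f"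
          using f sub holomorphic_on_imp_continuous_on holomorphic_on_subset by blast
        show "cmod (f x) \<le> B" if "cmod (z - x) = gap z / 2" for x using that by (intro fB) (simp add: dist_norm)
      qed (use g in simp)
      then have "cmod ((deriv ^^ k) f z) * gap z ^ k \<le> fact k * 2 ^ k * B"
        using g by (simp add: field_simps power_divide)
      then have "(cmod ((deriv ^^ k) f z) * gap z ^ k) powr p \<le> (fact k * 2 ^ k * B) powr p"
        using p g by (intro powr_mono2) auto
      also have "\<dots> = c * B powr p" unfolding c_def by (rule powr_mult)
      also have "B powr p = C * v" unfolding B_def using p C v(2) by (simp add: powr_powr)
      also have "(cmod ((deriv ^^ k) f z) * gap z ^ k) powr p = cmod ((deriv ^^ k) f z) powr p * (gap z ^ k) powr p"
        by (rule powr_mult)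
      also have "(gap z ^ k) powr p = gap z powr (real k * p)"
        using powr_realpow[OF g, of k] by (metis powr_powr)
      finally have "ennreal (cmod ((deriv ^^ k) f z) powr p * gap z powr (real k * p)) \<le> ennreal (c * C * v)"
        by (intro ennreal_leI) (simp add: mult.assoc)
      also have "\<dots> = ennreal (c * C) * Phi p f z" unfolding v(1) using c C by (intro ennreal_mult') simp
      finally show ?thesis .
    qed
  qed
  moreover have "0 < c * C" using c C by simp
  ultimately show ?thesis by blast
qed

definition dyadic_pt :: "nat \<Rightarrow> complex \<Rightarrow> complex" where
  "dyadic_pt n z = of_real (1 - (1/2) ^ n) * z"

lemma dyadic_pt_norm: "cmod (dyadic_pt n z) = (1 - (1/2) ^ n) * cmod z"
  unfolding dyadic_pt_def norm_mult norm_of_real by (simp add: power_le_one)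

lemma dyadic_pt_gap: "gap (dyadic_pt n z) = gap z + (1/2) ^ n * cmod z"
  unfolding gap_def dyadic_pt_norm by (simp add: algebra_simps)

lemma dyadic_pt_in: "z \<in> unit_disc \<Longrightarrow> dyadic_pt n z \<in> unit_disc"
proof -
  assume "z \<in> unit_disc"
  then have "0 < gap (dyadic_pt n z)" unfolding dyadic_pt_gap by (intro add_pos_nonneg gap_pos) auto
  then show ?thesis unfolding gap_def by simp
qed

lemma dyadic_pt_gap_ge: "z \<in> unit_disc \<Longrightarrow> (1/2) ^ n \<le> gap (dyadic_pt n z)"
proof -
  assume z: "z \<in> unit_disc"
  have "(1/2::real) ^ n * gap z \<le> 1 * gap z" using gap_pos[OF z] by (intro mult_right_mono) (auto simp: power_le_one)
  then show ?thesis unfolding dyadic_pt_gap by (simp add: gap_def algebra_simps)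
qed

text \<open>
  Consecutive points of the sequence \<open>(1 - 2\<^sup>-\<^sup>n) z\<close> are within half their distance to the boundary
  of each other, and so are its \<open>N\<close>-th member and \<open>z\<close> once \<open>2\<^sup>-\<^sup>N \<le> 1 - |z|\<close>.
\<close>

lemma radial_telescope:
  assumes der: "\<And>x. x \<in> unit_disc \<Longrightarrow> (f has_field_derivative g x) (at x)"
    and z: "z \<in> unit_disc" and N: "(1/2) ^ N \<le> gap z"
    and B: "\<And>n w. n \<le> N \<Longrightarrow> w \<in> cball (dyadic_pt n z) (gap (dyadic_pt n z) / 2) \<Longrightarrow> cmod (g w) \<le> B n"
  shows "cmod (f z) \<le> cmod (f 0) + (\<Sum>n\<le>N. (1/2) ^ n * B n)"
proof -
  have z1: "cmod z < 1" using z by simp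
  have step: "cmod (f y - f (dyadic_pt n z)) \<le> (1/2) ^ n * B n"
    if n: "n \<le> N" and y: "cmod (y - dyadic_pt n z) \<le> gap (dyadic_pt n z) / 2" "cmod (y - dyadic_pt n z) \<le> (1/2) ^ n" for y n
  proof -
    define a where "a = dyadic_pt n z"
    have ga: "0 < gap a" unfolding a_def by (rule gap_pos[OF dyadic_pt_in[OF z]])
    have sub: "w \<in> unit_disc" if "w \<in> cball a (gap a / 2)" for w
    proof -
      have "cmod (a - w) \<le> gap a / 2" using that by (simp add: dist_norm)
      then have "0 < gap w" using gap_lipschitz[of a w] ga by linarith
      then show ?thesis unfolding gap_def by simp
    qed
    have "0 \<le> cmod (g a)" by simp
    also have "\<dots> \<le> B n" using B[OF n, of a] ga unfolding a_def by simp
    finally have B0: "0 \<le> B n" .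
    have "cmod (f y - f a) \<le> B n * cmod (y - a)"
    proof (rule holomorphic_increment_bound[where S="cball a (gap a / 2)"])
      show "y \<in> cball a (gap a / 2)" using y(1) unfolding a_def by (simp add: dist_norm norm_minus_commute)
      show "a \<in> cball a (gap a / 2)" using ga by simp
      show "\<And>x. x \<in> cball a (gap a / 2) \<Longrightarrow> (f has_field_derivative g x) (at x)" using der sub by blast
      show "\<And>x. x \<in> cball a (gap a / 2) \<Longrightarrow> cmod (g x) \<le> B n" using B[OF n] unfolding a_def by blast
    qed simp
    also have "\<dots> \<le> B n * (1/2) ^ n" using y(2) B0 unfolding a_def by (intro mult_left_mono) auto
    finally show ?thesis unfolding a_def by (simp add: mult.commute)
  qed
  have d1: "cmod (dyadic_pt (Suc n) z - dyadic_pt n z) = (1/2) ^ Suc n * cmod z" for n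
  proof -
    have "dyadic_pt (Suc n) z - dyadic_pt n z = of_real ((1/2) ^ Suc n) * z"
      unfolding dyadic_pt_def left_diff_distrib[symmetric] of_real_diff[symmetric] by (simp add: field_simps)
    then show ?thesis by (simp only: norm_mult norm_of_real) simp
  qed
  have s1: "cmod (f (dyadic_pt (Suc n) z) - f (dyadic_pt n z)) \<le> (1/2) ^ n * B n" if n: "n < N" for n
  proof (rule step)
    have "(1/2) ^ Suc n * cmod z \<le> (1/2) ^ Suc n * 1" using z1 by (intro mult_left_mono) auto
    also have "\<dots> \<le> gap (dyadic_pt n z) / 2" using dyadic_pt_gap_ge[OF z, of n] by simp
    finally show "cmod (dyadic_pt (Suc n) z - dyadic_pt n z) \<le> gap (dyadic_pt n z) / 2" unfolding d1 .
    have "(1/2) ^ Suc n * cmod z \<le> (1/2) ^ n * 1" using z1 by (intro mult_mono power_decreasing) auto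
    then show "cmod (dyadic_pt (Suc n) z - dyadic_pt n z) \<le> (1/2) ^ n" unfolding d1 by simp
  qed (use n in simp)
  have d2: "cmod (z - dyadic_pt N z) = (1/2) ^ N * cmod z"
  proof -
    have "z - dyadic_pt N z = of_real ((1/2) ^ N) * z" unfolding dyadic_pt_def by (simp add: algebra_simps)
    then show ?thesis by (simp only: norm_mult norm_of_real) simp
  qed
  have s2: "cmod (f z - f (dyadic_pt N z)) \<le> (1/2) ^ N * B N"
  proof (rule step)
    have le: "(1/2) ^ N * cmod z \<le> (1/2) ^ N * 1" using z1 by (intro mult_left_mono) auto
    then show "cmod (z - dyadic_pt N z) \<le> (1/2) ^ N" unfolding d2 by simp
    show "cmod (z - dyadic_pt N z) \<le> gap (dyadic_pt N z) / 2"
      unfolding d2 dyadic_pt_gap using order_trans[OF le[unfolded mult_1_right] N] by argo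
  qed simp
  have z0: "dyadic_pt 0 z = 0" unfolding dyadic_pt_def by simp
  have "f z - f 0 = (f z - f (dyadic_pt N z)) + (\<Sum>n<N. f (dyadic_pt (Suc n) z) - f (dyadic_pt n z))"
    using sum_lessThan_telescope[of "\<lambda>n. f (dyadic_pt n z)" N] z0 by simp
  then have "cmod (f z - f 0) \<le> cmod (f z - f (dyadic_pt N z)) + cmod (\<Sum>n<N. f (dyadic_pt (Suc n) z) - f (dyadic_pt n z))"
    by (metis norm_triangle_ineq)
  also have "\<dots> \<le> (1/2) ^ N * B N + (\<Sum>n<N. (1/2) ^ n * B n)"
    using s2 s1 by (intro add_mono sum_norm_le) auto
  also have "\<dots> = (\<Sum>n\<le>N. (1/2) ^ n * B n)"
    by (simp add: lessThan_Suc_atMost[symmetric])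
  finally show ?thesis using norm_triangle_ineq2[of "f z" "f 0"] by linarith
qed

text \<open>
  \<open>radial_telescope\<close> with the bounds from \<open>local_bound\<close>. The power \<open>p\<close> is taken inside the sum at
  the price of the weights \<open>2\<^sup>(\<^sup>N\<^sup>-\<^sup>n\<^sup>)\<^sup>\<epsilon>\<close>, which are comparable to \<open>(2\<^sup>-\<^sup>n / (1 - |z|))\<^sup>\<epsilon>\<close>. The
  indicator encodes \<open>n \<le> N\<close> in a form that does not mention \<open>N\<close>, which depends on \<open>z\<close>.
\<close>

lemma pointwise_by_derivative:
  assumes p: "0 < p"
  shows "\<exists>C>0. \<forall>f g z. (\<forall>x\<in>unit_disc. (f has_field_derivative g x) (at x)) \<and> g holomorphic_on unit_disc \<and>
    g \<in> borel_measurable borel \<and> z \<in> unit_disc \<longrightarrow>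
    ennreal (cmod (f z) powr p) \<le> ennreal C * (ennreal (cmod (f 0) powr p) +
      (\<Sum>n. ennreal (((1/2) ^ n / gap z) powr eps * ((1/2) ^ n) powr p) * Phi p g (dyadic_pt n z)
        * indicator {z. gap z \<le> 2 * (1/2) ^ n} z))"
proof -
  obtain C where C: "0 < C" and CB: "\<forall>g z w. g holomorphic_on unit_disc \<and> g \<in> borel_measurable borel \<and> z \<in> unit_disc \<and> w \<in> cball z (gap z / 2)
    \<longrightarrow> ennreal (cmod (g w) powr p) \<le> ennreal C * Phi p g z"
    using local_bound[OF p] by (elim exE conjE) (rule that)
  obtain c where c: "0 < c" and cs: "\<forall>(N::nat) x. (\<forall>n. 0 \<le> x n) \<longrightarrow>
    (\<Sum>n\<le>N. x n) powr p \<le> c * (\<Sum>n\<le>N. (2 ^ (N - n)) powr eps * x n powr p)"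
    using powr_sum_le_geometric_weights[OF p eps_pos] by (elim exE conjE) (rule that)
  define D where "D = 2 powr p * (1 + c * 2 powr eps * C)"
  have D: "0 < D" unfolding D_def using c C by (intro mult_pos_pos add_pos_pos) auto
  have "ennreal (cmod (f z) powr p) \<le> ennreal D * (ennreal (cmod (f 0) powr p) +
      (\<Sum>n. ennreal (((1/2) ^ n / gap z) powr eps * ((1/2) ^ n) powr p) * Phi p g (dyadic_pt n z)
        * indicator {z. gap z \<le> 2 * (1/2) ^ n} z))"
    if der: "\<forall>x\<in>unit_disc. (f has_field_derivative g x) (at x)" and gh: "g holomorphic_on unit_disc" and gm: "g \<in> borel_measurable borel" and z: "z \<in> unit_disc" for f g z
  proof -
    have gz: "0 < gap z" using z by (rule gap_pos)
    define a where "a n = ((1/2) ^ n / gap z) powr eps * ((1/2) ^ n) powr p" for n :: nat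
    have a: "0 < a n" for n unfolding a_def using gz by simp
    define T where "T n = ennreal (a n) * Phi p g (dyadic_pt n z) * indicator {z. gap z \<le> 2 * (1/2) ^ n} z" for n
    (* Thus \<open>m + 1\<close> is the first index \<open>N\<close> with \<open>2\<^sup>-\<^sup>N < 1 - |z|\<close>. *)
    obtain m where m: "2 ^ m \<le> 1 / gap z" "1 / gap z < 2 ^ Suc m"
      using dyadic_scale[of 2 "1 / gap z"] gz gap_le_1[of z] by auto
    define N where "N = Suc m"
    have N1: "(1/2) ^ N \<le> gap z" using m(2) gz unfolding N_def by (simp add: field_simps power_one_over)
    have N2: "2 ^ N * gap z \<le> 2" using m(1) gz unfolding N_def by (simp add: field_simps)
    have ind: "gap z \<le> 2 * (1/2) ^ n" if "n \<le> N" for n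
    proof -
      have "gap z \<le> 2 * (1/2) ^ N" using N2 by (simp add: field_simps power_one_over)
      also have "\<dots> \<le> 2 * (1/2) ^ n" using that by (intro mult_left_mono power_decreasing) auto
      finally show ?thesis .
    qed
    have T: "T n = ennreal (a n) * Phi p g (dyadic_pt n z)" if "n \<le> N" for n
      unfolding T_def using ind[OF that] by simp
    show ?thesis
    proof (cases "(\<Sum>n. T n) = \<infinity>")
      case True
      then show ?thesis unfolding T_def[symmetric] a_def[symmetric] using D by (simp add: ennreal_mult_top)
    next
      case False
      define v where "v n = enn2real (Phi p g (dyadic_pt n z))" for n
      have v: "Phi p g (dyadic_pt n z) = ennreal (v n)" if n: "n \<le> N" for n
      proof -
        have "T n \<noteq> \<infinity>" using False ennreal_le_suminf[of T n] by (metis infinity_ennreal_def top.extremum_uniqueI)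
        then have "Phi p g (dyadic_pt n z) \<noteq> \<infinity>" unfolding T[OF n] using a[of n] by (auto simp: ennreal_mult_eq_top_iff)
        then show ?thesis unfolding v_def by (simp add: less_top)
      qed
      have v0: "0 \<le> v n" for n unfolding v_def by simp
      define B where "B n = (C * v n) powr (1 / p)" for n
      have Bp: "B n powr p = C * v n" for n unfolding B_def using p C v0[of n] by (simp add: powr_powr)
      have "cmod (f z) \<le> cmod (f 0) + (\<Sum>n\<le>N. (1/2) ^ n * B n)"
      proof (rule radial_telescope[OF _ z N1])
        fix n w assume n: "n \<le> N" and w: "w \<in> cball (dyadic_pt n z) (gap (dyadic_pt n z) / 2)"
        have "ennreal (cmod (g w) powr p) \<le> ennreal (C * v n)"
          using CB[rule_format, of g "dyadic_pt n z" w] gh gm dyadic_pt_in[OF z, of n] w C v[OF n] by (simp add: ennreal_mult')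
        then have "cmod (g w) powr p \<le> C * v n" using C v0 by (subst (asm) ennreal_le_iff) auto
        then have "(cmod (g w) powr p) powr (1 / p) \<le> B n" unfolding B_def using p by (intro powr_mono2) auto
        then show "cmod (g w) \<le> B n" using p by (simp add: powr_powr)
      qed (use der in blast)
      then have "cmod (f z) powr p \<le> (cmod (f 0) + (\<Sum>n\<le>N. (1/2) ^ n * B n)) powr p"
        using p by (intro powr_mono2) auto
      also have "\<dots> \<le> 2 powr p * (cmod (f 0) powr p + (\<Sum>n\<le>N. (1/2) ^ n * B n) powr p)"
        using p unfolding B_def by (intro powr_add_le sum_nonneg) auto
      also have "\<dots> \<le> 2 powr p * (cmod (f 0) powr p + c * 2 powr eps * C * (\<Sum>n\<le>N. a n * v n))"
      proof (intro mult_left_mono add_left_mono)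
        have "(\<Sum>n\<le>N. (1/2) ^ n * B n) powr p \<le> c * (\<Sum>n\<le>N. (2 ^ (N - n)) powr eps * ((1/2) ^ n * B n) powr p)"
          using cs[rule_format, of "\<lambda>n. (1/2) ^ n * B n" N] unfolding B_def by simp
        also have "\<dots> \<le> c * (\<Sum>n\<le>N. 2 powr eps * C * (a n * v n))"
        proof (intro mult_left_mono sum_mono)
          fix n assume "n \<in> {..N}"
          then have n: "n \<le> N" by simp
          have "(2::real) ^ (N - n) = 2 ^ N * (1/2) ^ n" using n by (simp add: power_diff power_one_over)
          also have "\<dots> \<le> 2 / gap z * (1/2) ^ n"
            using N2 gz by (intro mult_right_mono) (auto simp: field_simps)
          finally have "(2 ^ (N - n)) powr eps \<le> (2 * ((1/2) ^ n / gap z)) powr eps"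
            using eps_pos by (intro powr_mono2) auto
          also have "\<dots> = 2 powr eps * ((1/2) ^ n / gap z) powr eps" by (rule powr_mult)
          finally have e: "(2 ^ (N - n)) powr eps \<le> 2 powr eps * ((1/2) ^ n / gap z) powr eps" .
          have "((1/2) ^ n * B n) powr p = ((1/2) ^ n) powr p * (C * v n)"
            unfolding Bp[symmetric] by (rule powr_mult)
          then have "(2 ^ (N - n)) powr eps * ((1/2) ^ n * B n) powr p
              \<le> 2 powr eps * ((1/2) ^ n / gap z) powr eps * (((1/2) ^ n) powr p * (C * v n))"
            using e C v0[of n] by (simp add: mult_right_mono)
          also have "\<dots> = 2 powr eps * C * (a n * v n)" unfolding a_def by (simp only: mult_ac)
          finally show "(2 ^ (N - n)) powr eps * ((1/2) ^ n * B n) powr p \<le> 2 powr eps * C * (a n * v n)" .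
        qed (use c in simp)
        also have "\<dots> = c * 2 powr eps * C * (\<Sum>n\<le>N. a n * v n)"
          by (simp only: sum_distrib_left mult.assoc)
        finally show "(\<Sum>n\<le>N. (1/2) ^ n * B n) powr p \<le> c * 2 powr eps * C * (\<Sum>n\<le>N. a n * v n)" .
      qed simp
      also have "\<dots> \<le> D * (cmod (f 0) powr p + (\<Sum>n\<le>N. a n * v n))"
      proof -
        define X where "X = (\<Sum>n\<le>N. a n * v n)"
        have "0 \<le> X" unfolding X_def using a v0 by (intro sum_nonneg) (simp add: less_imp_le)
        moreover have "0 \<le> c * 2 powr eps * C * cmod (f 0) powr p" using c C by simp
        ultimately have "cmod (f 0) powr p + c * 2 powr eps * C * X \<le> (1 + c * 2 powr eps * C) * (cmod (f 0) powr p + X)"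
          by (simp add: algebra_simps)
        then show ?thesis unfolding X_def[symmetric] D_def mult.assoc[of "2 powr p"] by (intro mult_left_mono) auto
      qed
      finally have "ennreal (cmod (f z) powr p) \<le> ennreal (D * (cmod (f 0) powr p + (\<Sum>n\<le>N. a n * v n)))"
        by (rule ennreal_leI)
      also have "\<dots> = ennreal D * (ennreal (cmod (f 0) powr p) + (\<Sum>n\<le>N. ennreal (a n * v n)))"
      proof -
        have nn: "0 \<le> a n * v n" for n using a[of n] v0[of n] by simp
        then have "(\<Sum>n\<le>N. ennreal (a n * v n)) = ennreal (\<Sum>n\<le>N. a n * v n)" by (intro sum_ennreal) auto
        then show ?thesis using D nn by (simp add: ennreal_mult' sum_nonneg)
      qed
      also have "(\<Sum>n\<le>N. ennreal (a n * v n)) = (\<Sum>n\<le>N. T n)"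
      proof (rule sum.cong)
        fix n assume "n \<in> {..N}"
        then show "ennreal (a n * v n) = T n" using T[of n] v[of n] a[of n] by (simp add: ennreal_mult')
      qed simp
      also have "ennreal D * (ennreal (cmod (f 0) powr p) + (\<Sum>n\<le>N. T n)) \<le> ennreal D * (ennreal (cmod (f 0) powr p) + (\<Sum>n. T n))"
        by (intro mult_left_mono add_left_mono ennreal_sum_le_suminf) auto
      finally show ?thesis unfolding T_def a_def .
    qed
  qed
  with D show ?thesis by (intro exI[of _ D] conjI allI impI) (assumption, blast)
qed

text \<open>
  Each term of \<open>pointwise_by_derivative\<close> is integrated by \<open>Phi_integral_le\<close> with
  \<open>Z z = (1 - 2\<^sup>-\<^sup>n) z\<close>. Only points \<open>\<zeta>\<close> with \<open>2\<^sup>-\<^sup>n \<le> 4K (1 - |\<zeta>|)\<close> contribute to the \<open>n\<close>-th term,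
  so that the sum of \<open>2\<^sup>-\<^sup>n\<^sup>p\<close> over \<open>n\<close> yields the additional factor \<open>(1 - |\<zeta>|)\<^sup>p\<close>.
\<close>

lemma integral_le_by_derivative:
  assumes p: "0 < p" and s: "0 \<le> s"
  shows "\<exists>C>0. \<forall>f g. (\<forall>x\<in>unit_disc. (f has_field_derivative g x) (at x)) \<and> g holomorphic_on unit_disc \<and>
    g \<in> borel_measurable borel \<and> f \<in> borel_measurable borel \<longrightarrow>
    (\<integral>\<^sup>+z. ennreal (cmod (f z) powr p * gap z powr s) \<partial>\<mu>) \<le> ennreal C *
      ((\<integral>\<^sup>+z. ennreal (cmod (g z) powr p * gap z powr (s + p)) \<partial>\<mu>) + ennreal (cmod (f 0) powr p))"
proof -
  obtain C where C: "0 < C" and CP: "\<forall>p g Z E v b. g \<in> borel_measurable borel \<and> Z \<in> borel_measurable borel \<and> E \<in> sets borel \<and> v \<in> borel_measurable borel \<and>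
    b \<in> borel_measurable borel \<and> (\<forall>\<zeta>. 0 \<le> b \<zeta>) \<and>
    (\<forall>z\<in>E. z \<in> unit_disc \<longrightarrow> Z z \<in> unit_disc \<and> cmod (Z z - z) \<le> gap (Z z) \<and>
       (\<forall>\<zeta>\<in>near (Z z). v z \<le> b \<zeta> * (gap \<zeta> / gap z) powr eps)) \<longrightarrow>
    (\<integral>\<^sup>+z\<in>E. ennreal (v z) * Phi p g (Z z) \<partial>\<mu>) \<le> ennreal C * (\<integral>\<^sup>+\<zeta>. ennreal (b \<zeta> * cmod (g \<zeta>) powr p) \<partial>\<mu>)"
    using Phi_integral_le by (elim exE conjE) (rule that)
  obtain D where D: "0 < D" and DP: "\<forall>f g z. (\<forall>x\<in>unit_disc. (f has_field_derivative g x) (at x)) \<and> g holomorphic_on unit_disc \<and>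
    g \<in> borel_measurable borel \<and> z \<in> unit_disc \<longrightarrow>
    ennreal (cmod (f z) powr p) \<le> ennreal D * (ennreal (cmod (f 0) powr p) +
      (\<Sum>n. ennreal (((1/2) ^ n / gap z) powr eps * ((1/2) ^ n) powr p) * Phi p g (dyadic_pt n z)
        * indicator {z. gap z \<le> 2 * (1/2) ^ n} z))"
    using pointwise_by_derivative[OF p] by (elim exE conjE) (rule that)
  define c where "c = (8 * K) powr s * (4 * K) powr eps"
  have c: "0 < c" unfolding c_def using K by simp
  define m where "m = measure \<mu> UNIV"
  have m: "0 < m" unfolding m_def by (rule mu_UNIV_pos)
  define r where "r = 1 / (1 - (1/2) powr p)"
  have r: "0 < r" unfolding r_def using half_powr_less_one[OF p] by simp
  define e where "e = C * (c * r * (4 * K) powr p)"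
  have e: "0 < e" unfolding e_def using C c r K by simp
  have "(\<integral>\<^sup>+z. ennreal (cmod (f z) powr p * gap z powr s) \<partial>\<mu>) \<le> ennreal (D * (m + e)) *
      ((\<integral>\<^sup>+z. ennreal (cmod (g z) powr p * gap z powr (s + p)) \<partial>\<mu>) + ennreal (cmod (f 0) powr p))"
    if der: "\<forall>x\<in>unit_disc. (f has_field_derivative g x) (at x)" and gh: "g holomorphic_on unit_disc" and gm[measurable]: "g \<in> borel_measurable borel"
      and fm[measurable]: "f \<in> borel_measurable borel" for f g
  proof -
    define I where "I = (\<integral>\<^sup>+z. ennreal (cmod (g z) powr p * gap z powr (s + p)) \<partial>\<mu>)"
    define E where "E n = {z. gap z \<le> 2 * (1/2) ^ n}" for n :: nat
    have Em[measurable]: "E n \<in> sets borel" for n unfolding E_def by measurable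
    define v where "v n z = gap z powr s * (((1/2) ^ n / gap z) powr eps * ((1/2) ^ n) powr p)" for n :: nat and z
    have vm[measurable]: "v n \<in> borel_measurable borel" for n unfolding v_def by measurable
    have dm[measurable]: "dyadic_pt n \<in> borel_measurable borel" for n unfolding dyadic_pt_def[abs_def] by measurable
    (* On \<open>near (dyadic_pt n z)\<close> one has \<open>2\<^sup>-\<^sup>n \<le> 4K gap \<zeta>\<close>, and \<open>gap z\<close> is at most \<open>2 \<cdot> 2\<^sup>-\<^sup>n\<close> on \<open>E n\<close>: this moves the weight from \<open>z\<close> to \<open>\<zeta>\<close>. *)
    define b where "b n \<zeta> = c * gap \<zeta> powr s * (((1/2) ^ n) powr p * indicator {..4 * K * gap \<zeta>} ((1/2) ^ n))" for n :: nat and \<zeta>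
    have b_alt: "b n = (\<lambda>\<zeta>. c * gap \<zeta> powr s * (((1/2) ^ n) powr p * (if (1/2) ^ n \<le> 4 * K * gap \<zeta> then 1 else 0)))" for n
      unfolding b_def by (auto simp: fun_eq_iff indicator_def)
    have bm[measurable]: "b n \<in> borel_measurable borel" for n unfolding b_alt by measurable
    have b0: "0 \<le> b n \<zeta>" for n \<zeta> unfolding b_def using c by simp
    have Pm[measurable]: "(\<lambda>z. Phi p g (dyadic_pt n z)) \<in> borel_measurable borel" for n by (rule Phi_measurable(2)[OF gm dm])
    have step: "(\<integral>\<^sup>+z\<in>E n. ennreal (v n z) * Phi p g (dyadic_pt n z) \<partial>\<mu>) \<le> ennreal C * (\<integral>\<^sup>+\<zeta>. ennreal (b n \<zeta> * cmod (g \<zeta>) powr p) \<partial>\<mu>)" for n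
    proof (rule CP[rule_format], intro conjI gm dm Em vm bm allI b0 ballI impI)
      fix z assume zE: "z \<in> E n" and z: "z \<in> unit_disc"
      have gz: "0 < gap z" using z by (rule gap_pos)
      define h where "h = (1/2::real) ^ n"
      have h: "0 < h" unfolding h_def by simp
      have zh: "gap z \<le> 2 * h" using zE unfolding E_def h_def by simp
      have hg: "h \<le> gap (dyadic_pt n z)" unfolding h_def by (rule dyadic_pt_gap_ge[OF z])
      show "dyadic_pt n z \<in> unit_disc" by (rule dyadic_pt_in[OF z])
      have "dyadic_pt n z - z = - (of_real h * z)" unfolding dyadic_pt_def h_def by (simp add: algebra_simps)
      then have "cmod (dyadic_pt n z - z) = h * cmod z" using h by (simp only: norm_minus_cancel norm_mult norm_of_real abs_of_pos)
      also have "\<dots> \<le> h * 1" using z h by (intro mult_left_mono) auto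
      finally show "cmod (dyadic_pt n z - z) \<le> gap (dyadic_pt n z)" using hg by simp
      fix \<zeta> assume "\<zeta> \<in> near (dyadic_pt n z)"
      then have nr: "gap (dyadic_pt n z) \<le> 4 * K * gap \<zeta>" unfolding near_def by simp
      then have hz: "h \<le> 4 * K * gap \<zeta>" using hg by linarith
      then have g\<zeta>: "0 < gap \<zeta>" 
      proof -
        have "0 < 4 * K * gap \<zeta>" using h hz by linarith
        then show ?thesis using K by (simp add: zero_less_mult_iff)
      qed
      have "gap z powr s \<le> (8 * K * gap \<zeta>) powr s" using gz zh hz s by (intro powr_mono2) auto
      also have "\<dots> = (8 * K) powr s * gap \<zeta> powr s" by (rule powr_mult)
      finally have 1: "gap z powr s \<le> (8 * K) powr s * gap \<zeta> powr s" .
      have "(h / gap z) powr eps \<le> (4 * K * (gap \<zeta> / gap z)) powr eps"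
        using h gz hz eps_pos by (intro powr_mono2) (auto simp: divide_right_mono)
      also have "\<dots> = (4 * K) powr eps * (gap \<zeta> / gap z) powr eps" by (rule powr_mult)
      finally have 2: "(h / gap z) powr eps \<le> (4 * K) powr eps * (gap \<zeta> / gap z) powr eps" .
      have "gap z powr s * ((h / gap z) powr eps * h powr p)
          \<le> ((8 * K) powr s * gap \<zeta> powr s) * ((4 * K) powr eps * (gap \<zeta> / gap z) powr eps * h powr p)"
        by (rule mult_mono[OF 1 mult_right_mono[OF 2]]) auto
      also have "\<dots> = c * gap \<zeta> powr s * h powr p * (gap \<zeta> / gap z) powr eps"
        unfolding c_def by (simp only: mult_ac)
      also have "c * gap \<zeta> powr s * h powr p = b n \<zeta>" unfolding b_def h_def[symmetric] using hz by simp
      finally show "v n z \<le> b n \<zeta> * (gap \<zeta> / gap z) powr eps" unfolding v_def h_def .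
    qed
    have "(\<integral>\<^sup>+z. ennreal (cmod (f z) powr p * gap z powr s) \<partial>\<mu>)
       \<le> (\<integral>\<^sup>+z. ennreal D * (ennreal (cmod (f 0) powr p) + (\<Sum>n. ennreal (v n z) * Phi p g (dyadic_pt n z) * indicator (E n) z)) \<partial>\<mu>)"
    proof (rule nn_integral_mono_AE)
      show "AE z in \<mu>. ennreal (cmod (f z) powr p * gap z powr s)
        \<le> ennreal D * (ennreal (cmod (f 0) powr p) + (\<Sum>n. ennreal (v n z) * Phi p g (dyadic_pt n z) * indicator (E n) z))"
        using mu_disc
      proof eventually_elim
        fix z assume z: "z \<in> unit_disc"
        have gz: "0 < gap z" using z by (rule gap_pos)
        define S where "S = (\<Sum>n. ennreal (((1/2) ^ n / gap z) powr eps * ((1/2) ^ n) powr p) * Phi p g (dyadic_pt n z) * indicator (E n) z)"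
        have G1: "gap z powr s \<le> 1" using gz gap_le_1[of z] s by (intro powr_le1) auto
        have fS: "ennreal (cmod (f z) powr p) \<le> ennreal D * (ennreal (cmod (f 0) powr p) + S)"
          unfolding S_def E_def using DP der gh gm z by blast
        have "ennreal (cmod (f z) powr p * gap z powr s) = ennreal (gap z powr s) * ennreal (cmod (f z) powr p)"
          by (subst mult.commute) (rule ennreal_mult', simp)
        also have "\<dots> \<le> ennreal (gap z powr s) * (ennreal D * (ennreal (cmod (f 0) powr p) + S))"
          by (rule mult_left_mono[OF fS]) simp
        also have "\<dots> = ennreal D * (ennreal (gap z powr s) * ennreal (cmod (f 0) powr p) + ennreal (gap z powr s) * S)"
          by (simp only: mult.left_commute distrib_left)
        also have "ennreal (gap z powr s) * S = (\<Sum>n. ennreal (v n z) * Phi p g (dyadic_pt n z) * indicator (E n) z)"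
        proof -
          have "ennreal (v n z) = ennreal (gap z powr s) * ennreal (((1/2) ^ n / gap z) powr eps * ((1/2) ^ n) powr p)" for n
            unfolding v_def by (rule ennreal_mult') simp
          then show ?thesis unfolding S_def by (simp only: ennreal_suminf_cmult[symmetric] mult.assoc)
        qed
        also have "ennreal D * (ennreal (gap z powr s) * ennreal (cmod (f 0) powr p) + (\<Sum>n. ennreal (v n z) * Phi p g (dyadic_pt n z) * indicator (E n) z))
           \<le> ennreal D * (1 * ennreal (cmod (f 0) powr p) + (\<Sum>n. ennreal (v n z) * Phi p g (dyadic_pt n z) * indicator (E n) z))"
          using G1 by (intro mult_left_mono add_right_mono mult_right_mono) (auto simp: ennreal_le_1)
        finally show "ennreal (cmod (f z) powr p * gap z powr s)
          \<le> ennreal D * (ennreal (cmod (f 0) powr p) + (\<Sum>n. ennreal (v n z) * Phi p g (dyadic_pt n z) * indicator (E n) z))" by simp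
      qed
    qed
    also have "\<dots> = ennreal D * (ennreal (cmod (f 0) powr p) * ennreal m + (\<Sum>n. \<integral>\<^sup>+z\<in>E n. ennreal (v n z) * Phi p g (dyadic_pt n z) \<partial>\<mu>))"
    proof -
      have tm: "(\<lambda>z. ennreal (v n z) * Phi p g (dyadic_pt n z) * indicator (E n) z) \<in> borel_measurable \<mu>" for n
        by measurable
      have "(\<integral>\<^sup>+z. ennreal (cmod (f 0) powr p) + (\<Sum>n. ennreal (v n z) * Phi p g (dyadic_pt n z) * indicator (E n) z) \<partial>\<mu>)
         = (\<integral>\<^sup>+z. ennreal (cmod (f 0) powr p) \<partial>\<mu>) + (\<integral>\<^sup>+z. (\<Sum>n. ennreal (v n z) * Phi p g (dyadic_pt n z) * indicator (E n) z) \<partial>\<mu>)"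
        using tm by (intro nn_integral_add borel_measurable_suminf) auto
      also have "(\<integral>\<^sup>+z. ennreal (cmod (f 0) powr p) \<partial>\<mu>) = ennreal (cmod (f 0) powr p) * ennreal m"
        unfolding m_def using sets_eq_imp_space_eq[OF sets_mu] by (simp add: mu.emeasure_eq_measure)
      also have "(\<integral>\<^sup>+z. (\<Sum>n. ennreal (v n z) * Phi p g (dyadic_pt n z) * indicator (E n) z) \<partial>\<mu>)
         = (\<Sum>n. \<integral>\<^sup>+z\<in>E n. ennreal (v n z) * Phi p g (dyadic_pt n z) \<partial>\<mu>)"
        by (rule nn_integral_suminf[OF tm])
      finally show ?thesis using tm by (subst nn_integral_cmult) (auto intro!: borel_measurable_add borel_measurable_suminf)
    qed
    also have "\<dots> \<le> ennreal D * (ennreal m * ennreal (cmod (f 0) powr p) + ennreal e * I)"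
    proof (intro mult_left_mono add_mono)
      have "(\<Sum>n. \<integral>\<^sup>+z\<in>E n. ennreal (v n z) * Phi p g (dyadic_pt n z) \<partial>\<mu>)
         \<le> (\<Sum>n. ennreal C * (\<integral>\<^sup>+\<zeta>. ennreal (b n \<zeta> * cmod (g \<zeta>) powr p) \<partial>\<mu>))"
        using step by (intro suminf_le summableI)
      also have "\<dots> = ennreal C * (\<Sum>n. \<integral>\<^sup>+\<zeta>. ennreal (b n \<zeta> * cmod (g \<zeta>) powr p) \<partial>\<mu>)"
        by (rule ennreal_suminf_cmult)
      also have "(\<Sum>n. \<integral>\<^sup>+\<zeta>. ennreal (b n \<zeta> * cmod (g \<zeta>) powr p) \<partial>\<mu>) = (\<integral>\<^sup>+\<zeta>. (\<Sum>n. ennreal (b n \<zeta> * cmod (g \<zeta>) powr p)) \<partial>\<mu>)"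
        by (rule nn_integral_suminf[symmetric]) measurable
      also have "ennreal C * (\<integral>\<^sup>+\<zeta>. (\<Sum>n. ennreal (b n \<zeta> * cmod (g \<zeta>) powr p)) \<partial>\<mu>)
         \<le> ennreal C * (\<integral>\<^sup>+\<zeta>. ennreal (c * r * (4 * K) powr p) * ennreal (cmod (g \<zeta>) powr p * gap \<zeta> powr (s + p)) \<partial>\<mu>)"
      proof (intro mult_left_mono nn_integral_mono_AE)
        show "AE \<zeta> in \<mu>. (\<Sum>n. ennreal (b n \<zeta> * cmod (g \<zeta>) powr p)) \<le> ennreal (c * r * (4 * K) powr p) * ennreal (cmod (g \<zeta>) powr p * gap \<zeta> powr (s + p))"
          using mu_disc
        proof eventually_elim
          fix \<zeta> assume \<zeta>: "\<zeta> \<in> unit_disc"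
          define y where "y = c * gap \<zeta> powr s * cmod (g \<zeta>) powr p"
          have y: "0 \<le> y" unfolding y_def using c by simp
          have "ennreal (b n \<zeta> * cmod (g \<zeta>) powr p) = ennreal y * (ennreal (((1/2) ^ n) powr p) * indicator {..4 * K * gap \<zeta>} ((1/2) ^ n))" for n
          proof -
            have "b n \<zeta> * cmod (g \<zeta>) powr p = y * (((1/2) ^ n) powr p * indicator {..4 * K * gap \<zeta>} ((1/2) ^ n))"
              unfolding b_def y_def by (simp only: mult_ac)
            then show ?thesis using y by (simp add: ennreal_mult' ennreal_indicator)
          qed
          then have "(\<Sum>n. ennreal (b n \<zeta> * cmod (g \<zeta>) powr p))
              = ennreal y * (\<Sum>n. ennreal (((1/2) ^ n) powr p) * indicator {..4 * K * gap \<zeta>} ((1/2) ^ n))"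
            by (simp only: ennreal_suminf_cmult)
          also have "\<dots> \<le> ennreal y * (ennreal r * ennreal ((4 * K * gap \<zeta>) powr p))"
            unfolding r_def by (intro mult_left_mono suminf_dyadic_powr_le[OF p]) simp
          also have "\<dots> = ennreal (y * (r * (4 * K * gap \<zeta>) powr p))"
            using y r by (simp add: ennreal_mult'[symmetric])
          also have "y * (r * (4 * K * gap \<zeta>) powr p) = (c * r * (4 * K) powr p) * (cmod (g \<zeta>) powr p * gap \<zeta> powr (s + p))"
            unfolding y_def powr_mult[of "4 * K"] powr_add by (simp only: mult_ac)
          also have "ennreal \<dots> = ennreal (c * r * (4 * K) powr p) * ennreal (cmod (g \<zeta>) powr p * gap \<zeta> powr (s + p))"
            using c r by (intro ennreal_mult') simp
          finally show "(\<Sum>n. ennreal (b n \<zeta> * cmod (g \<zeta>) powr p)) \<le> ennreal (c * r * (4 * K) powr p) * ennreal (cmod (g \<zeta>) powr p * gap \<zeta> powr (s + p))" .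
        qed
      qed simp
      also have "(\<integral>\<^sup>+\<zeta>. ennreal (c * r * (4 * K) powr p) * ennreal (cmod (g \<zeta>) powr p * gap \<zeta> powr (s + p)) \<partial>\<mu>) = ennreal (c * r * (4 * K) powr p) * I"
        unfolding I_def by (rule nn_integral_cmult) measurable
      also have "ennreal C * (ennreal (c * r * (4 * K) powr p) * I) = ennreal e * I"
        unfolding e_def using C by (subst ennreal_mult'[of C]) (auto simp: mult.assoc)
      finally show "(\<Sum>n. \<integral>\<^sup>+z\<in>E n. ennreal (v n z) * Phi p g (dyadic_pt n z) \<partial>\<mu>) \<le> ennreal e * I" .
    qed (auto simp: mult.commute)
    also have "\<dots> \<le> ennreal D * (ennreal (m + e) * ennreal (cmod (f 0) powr p) + ennreal (m + e) * I)"
      using m e by (intro mult_left_mono add_mono mult_right_mono ennreal_leI) auto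
    also have "\<dots> = ennreal D * ennreal (m + e) * (I + ennreal (cmod (f 0) powr p))"
      by (simp only: distrib_left mult.assoc add.commute)
    also have "ennreal D * ennreal (m + e) = ennreal (D * (m + e))" using D by (intro ennreal_mult'[symmetric]) simp
    finally show ?thesis unfolding I_def .
  qed
  moreover have "0 < D * (m + e)" using D m e by simp
  ultimately show ?thesis by (intro exI[of _ "D * (m + e)"] conjI allI impI) (assumption, blast)
qed

lemma integral_le_by_higher_derivative:
  assumes p: "0 < p"
  shows "\<exists>C>0. \<forall>F. (\<forall>j. F j holomorphic_on unit_disc \<and> F j \<in> borel_measurable borel \<and>
      (\<forall>x\<in>unit_disc. (F j has_field_derivative F (Suc j) x) (at x))) \<longrightarrow>
    (\<integral>\<^sup>+z. ennreal (cmod (F 0 z) powr p) \<partial>\<mu>) \<le> ennreal C *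
      ((\<integral>\<^sup>+z. ennreal (cmod (F k z) powr p * gap z powr (real k * p)) \<partial>\<mu>) + ennreal (\<Sum>j<k. cmod (F j 0) powr p))"
proof (induction k)
  case 0
  have "(\<integral>\<^sup>+z. ennreal (cmod (F 0 z) powr p) \<partial>\<mu>) = (\<integral>\<^sup>+z. ennreal (cmod (F 0 z) powr p * gap z powr (real 0 * p)) \<partial>\<mu>)"
    for F :: "nat \<Rightarrow> complex \<Rightarrow> complex"
  proof (rule nn_integral_cong_AE)
    show "AE z in \<mu>. ennreal (cmod (F 0 z) powr p) = ennreal (cmod (F 0 z) powr p * gap z powr (real 0 * p))"
      using mu_disc by eventually_elim (drule gap_pos, simp)
  qed
  then show ?case by (intro exI[of _ 1]) simp
next
  case (Suc k)
  then obtain C where C: "0 < C" and IH: "\<forall>F. (\<forall>j. F j holomorphic_on unit_disc \<and> F j \<in> borel_measurable borel \<and>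
      (\<forall>x\<in>unit_disc. (F j has_field_derivative F (Suc j) x) (at x))) \<longrightarrow>
    (\<integral>\<^sup>+z. ennreal (cmod (F 0 z) powr p) \<partial>\<mu>) \<le> ennreal C *
      ((\<integral>\<^sup>+z. ennreal (cmod (F k z) powr p * gap z powr (real k * p)) \<partial>\<mu>) + ennreal (\<Sum>j<k. cmod (F j 0) powr p))"
    by (elim exE conjE) (rule that)
  have kp: "0 \<le> real k * p" using p by simp
  obtain D where D: "0 < D" and step: "\<forall>f g. (\<forall>x\<in>unit_disc. (f has_field_derivative g x) (at x)) \<and> g holomorphic_on unit_disc \<and>
    g \<in> borel_measurable borel \<and> f \<in> borel_measurable borel \<longrightarrow>
    (\<integral>\<^sup>+z. ennreal (cmod (f z) powr p * gap z powr (real k * p)) \<partial>\<mu>) \<le> ennreal D *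
      ((\<integral>\<^sup>+z. ennreal (cmod (g z) powr p * gap z powr (real k * p + p)) \<partial>\<mu>) + ennreal (cmod (f 0) powr p))"
    using integral_le_by_derivative[OF p kp] by (elim exE conjE) (rule that)
  show ?case
  proof (intro exI[of _ "C * (D + 1)"] conjI allI impI)
    show "0 < C * (D + 1)" using C D by simp
    fix F :: "nat \<Rightarrow> complex \<Rightarrow> complex"
    assume F: "\<forall>j. F j holomorphic_on unit_disc \<and> F j \<in> borel_measurable borel \<and>
      (\<forall>x\<in>unit_disc. (F j has_field_derivative F (Suc j) x) (at x))"
    define s where "s = (\<Sum>j<k. cmod (F j 0) powr p)"
    define b where "b = cmod (F k 0) powr p"
    have s: "0 \<le> s" "0 \<le> b" unfolding s_def b_def by (auto intro: sum_nonneg)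
    define I where "I = (\<integral>\<^sup>+z. ennreal (cmod (F (Suc k) z) powr p * gap z powr (real (Suc k) * p)) \<partial>\<mu>)"
    have e: "real k * p + p = real (Suc k) * p" by (simp add: algebra_simps)
    have k1: "(\<integral>\<^sup>+z. ennreal (cmod (F k z) powr p * gap z powr (real k * p)) \<partial>\<mu>) \<le> ennreal D * (I + ennreal b)"
      using step[rule_format, of "F k" "F (Suc k)"] F unfolding I_def b_def e by blast
    have "(\<integral>\<^sup>+z. ennreal (cmod (F 0 z) powr p) \<partial>\<mu>)
        \<le> ennreal C * ((\<integral>\<^sup>+z. ennreal (cmod (F k z) powr p * gap z powr (real k * p)) \<partial>\<mu>) + ennreal s)"
      unfolding s_def by (rule IH[rule_format]) (use F in blast)
    also have "\<dots> \<le> ennreal C * (ennreal D * (I + ennreal b) + ennreal s)"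
      by (intro mult_left_mono add_right_mono k1) simp
    also have "\<dots> \<le> ennreal C * (ennreal (D + 1) * (I + ennreal b) + ennreal (D + 1) * ennreal s)"
    proof (intro mult_left_mono add_mono mult_right_mono)
      have "1 * ennreal s \<le> ennreal (D + 1) * ennreal s" using D by (intro mult_right_mono) auto
      then show "ennreal s \<le> ennreal (D + 1) * ennreal s" by simp
    qed (use D in \<open>auto intro: ennreal_leI\<close>)
    also have "\<dots> = ennreal C * ennreal (D + 1) * (I + (ennreal b + ennreal s))"
      by (simp only: distrib_left mult.assoc add.assoc)
    also have "ennreal C * ennreal (D + 1) = ennreal (C * (D + 1))" using C by (intro ennreal_mult'[symmetric]) simp
    also have "ennreal b + ennreal s = ennreal (\<Sum>j<Suc k. cmod (F j 0) powr p)"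
      using s unfolding b_def s_def by (simp add: ennreal_plus[symmetric] add.commute del: ennreal_plus)
    finally show "(\<integral>\<^sup>+z. ennreal (cmod (F 0 z) powr p) \<partial>\<mu>) \<le> ennreal (C * (D + 1)) *
      ((\<integral>\<^sup>+z. ennreal (cmod (F (Suc k) z) powr p * gap z powr (real (Suc k) * p)) \<partial>\<mu>) + ennreal (\<Sum>j<Suc k. cmod (F j 0) powr p))"
      unfolding I_def .
  qed
qed

lemma higher_derivative_le_integral:
  assumes p: "0 < p"
  shows "\<exists>C>0. \<forall>f. f holomorphic_on unit_disc \<and> f \<in> borel_measurable borel \<longrightarrow>
      (\<integral>\<^sup>+z. ennreal (cmod ((deriv ^^ k) f z) powr p * gap z powr (real k * p)) \<partial>\<mu>) \<le> ennreal C * (\<integral>\<^sup>+z. ennreal (cmod (f z) powr p) \<partial>\<mu>)"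
proof -
  obtain C where C: "0 < C" and CB: "\<forall>f z. f holomorphic_on unit_disc \<and> f \<in> borel_measurable borel \<and> z \<in> unit_disc \<longrightarrow>
    ennreal (cmod ((deriv ^^ k) f z) powr p * gap z powr (real k * p)) \<le> ennreal C * Phi p f z"
    using Cauchy_local[OF p, of k] by (elim exE conjE) (rule that)
  obtain D where D: "0 < D" and DB: "\<forall>p g. g \<in> borel_measurable borel \<longrightarrow>
    (\<integral>\<^sup>+z. Phi p g z \<partial>\<mu>) \<le> ennreal D * (\<integral>\<^sup>+\<zeta>. ennreal (cmod (g \<zeta>) powr p) \<partial>\<mu>)"
    using integral_Phi_le by (elim exE conjE) (rule that)
  have "(\<integral>\<^sup>+z. ennreal (cmod ((deriv ^^ k) f z) powr p * gap z powr (real k * p)) \<partial>\<mu>) \<le> ennreal (C * D) * (\<integral>\<^sup>+z. ennreal (cmod (f z) powr p) \<partial>\<mu>)"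
    if f: "f holomorphic_on unit_disc" "f \<in> borel_measurable borel" for f
  proof -
    have "(\<integral>\<^sup>+z. ennreal (cmod ((deriv ^^ k) f z) powr p * gap z powr (real k * p)) \<partial>\<mu>) \<le> (\<integral>\<^sup>+z. ennreal C * Phi p f z \<partial>\<mu>)"
    proof (rule nn_integral_mono_AE)
      show "AE z in \<mu>. ennreal (cmod ((deriv ^^ k) f z) powr p * gap z powr (real k * p)) \<le> ennreal C * Phi p f z"
        using mu_disc by eventually_elim (use CB f in blast)
    qed
    also have "\<dots> = ennreal C * (\<integral>\<^sup>+z. Phi p f z \<partial>\<mu>)"
    proof (rule nn_integral_cmult)
      have "(\<lambda>z. z) \<in> borel_measurable (borel :: complex measure)" by simp
      from Phi_measurable(2)[OF f(2) this, of p] show "(\<lambda>z. Phi p f z) \<in> borel_measurable \<mu>"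
        by (simp cong: measurable_cong_sets add: sets_mu)
    qed
    also have "\<dots> \<le> ennreal C * (ennreal D * (\<integral>\<^sup>+z. ennreal (cmod (f z) powr p) \<partial>\<mu>))"
      using DB[rule_format, OF f(2), of p] by (rule mult_left_mono) simp
    also have "\<dots> = ennreal (C * D) * (\<integral>\<^sup>+z. ennreal (cmod (f z) powr p) \<partial>\<mu>)"
      using C by (subst ennreal_mult') (auto simp: mult.assoc)
    finally show ?thesis .
  qed
  moreover have "0 < C * D" using C D by simp
  ultimately show ?thesis by blast
qed

lemma Taylor_coefficients_le_integral:
  assumes p: "0 < p"
  shows "\<exists>C>0. \<forall>f. f holomorphic_on unit_disc \<and> f \<in> borel_measurable borel \<longrightarrow>
      ennreal (\<Sum>j<k. cmod ((deriv ^^ j) f 0) powr p) \<le> ennreal C * (\<integral>\<^sup>+z. ennreal (cmod (f z) powr p) \<partial>\<mu>)"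
proof (induction k)
  case 0
  show ?case by (intro exI[of _ 1]) simp
next
  case (Suc k)
  then obtain C where C: "0 < C" and IH: "\<forall>f. f holomorphic_on unit_disc \<and> f \<in> borel_measurable borel \<longrightarrow>
      ennreal (\<Sum>j<k. cmod ((deriv ^^ j) f 0) powr p) \<le> ennreal C * (\<integral>\<^sup>+z. ennreal (cmod (f z) powr p) \<partial>\<mu>)"
    by (elim exE conjE) (rule that)
  obtain D where D: "0 < D" and DB: "\<forall>f z. f holomorphic_on unit_disc \<and> f \<in> borel_measurable borel \<and> z \<in> unit_disc \<longrightarrow>
    ennreal (cmod ((deriv ^^ k) f z) powr p * gap z powr (real k * p)) \<le> ennreal D * Phi p f z"
    using Cauchy_local[OF p, of k] by (elim exE conjE) (rule that)
  obtain E where E: "0 < E" and EB: "\<forall>p g. g \<in> borel_measurable borel \<longrightarrow>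
    Phi p g 0 \<le> ennreal E * (\<integral>\<^sup>+\<zeta>. ennreal (cmod (g \<zeta>) powr p) \<partial>\<mu>)"
    using Phi_0_le by (elim exE conjE) (rule that)
  show ?case
  proof (intro exI[of _ "C + D * E"] conjI allI impI)
    show "0 < C + D * E" using C D E by (simp add: add_pos_pos)
    fix f assume f: "f holomorphic_on unit_disc \<and> f \<in> borel_measurable borel"
    define X where "X = (\<integral>\<^sup>+z. ennreal (cmod (f z) powr p) \<partial>\<mu>)"
    have g0: "gap 0 = 1" unfolding gap_def by simp
    have "ennreal (cmod ((deriv ^^ k) f 0) powr p) \<le> ennreal D * Phi p f 0"
      using DB[rule_format, of f 0] f g0 by simp
    also have "\<dots> \<le> ennreal D * (ennreal E * X)"
      unfolding X_def using EB f by (intro mult_left_mono) auto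
    also have "\<dots> = ennreal (D * E) * X" using D by (subst ennreal_mult') (auto simp: mult.assoc)
    finally have 1: "ennreal (cmod ((deriv ^^ k) f 0) powr p) \<le> ennreal (D * E) * X" .
    have "ennreal (\<Sum>j<Suc k. cmod ((deriv ^^ j) f 0) powr p)
       = ennreal (\<Sum>j<k. cmod ((deriv ^^ j) f 0) powr p) + ennreal (cmod ((deriv ^^ k) f 0) powr p)"
      by (simp add: sum_nonneg)
    also have "\<dots> \<le> ennreal C * X + ennreal (D * E) * X"
      unfolding X_def by (intro add_mono IH[rule_format, OF f] 1[unfolded X_def])
    also have "\<dots> = ennreal (C + D * E) * X" using C D E by (simp add: distrib_right ennreal_plus)
    finally show "ennreal (\<Sum>j<Suc k. cmod ((deriv ^^ j) f 0) powr p) \<le> ennreal (C + D * E) * (\<integral>\<^sup>+z. ennreal (cmod (f z) powr p) \<partial>\<mu>)"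
      unfolding X_def .
  qed
qed

end

section \<open>Weights as regular pairs of measures\<close>

lemma sets_dA: "sets dA = sets (lebesgue_on unit_disc)" and space_dA: "space dA = unit_disc"
  unfolding dA_def by (auto simp: space_restrict_space)

lemma id_measurable_dA: "(\<lambda>z. z) \<in> measurable dA borel"
proof -
  have "(\<lambda>z::complex. z) \<in> measurable lebesgue borel" by (rule measurable_completion) simp
  then have "(\<lambda>z. z) \<in> measurable (lebesgue_on unit_disc) borel" by (rule measurable_restrict_space1)
  then show ?thesis by (simp cong: measurable_cong_sets add: sets_dA)
qed

lemma borel_imp_dA_measurable: "F \<in> borel_measurable borel \<Longrightarrow> F \<in> borel_measurable dA"
  using measurable_compose[OF id_measurable_dA, of F borel] by blast

lemma nn_integral_dA:
  assumes "G \<in> borel_measurable dA"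
  shows "(\<integral>\<^sup>+z. G z \<partial>dA) = (\<integral>\<^sup>+z. ennreal (1 / pi) * G z * indicator unit_disc z \<partial>lborel)"
proof -
  have "G \<in> borel_measurable (lebesgue_on unit_disc)"
    using assms by (simp cong: measurable_cong_sets add: sets_dA)
  then have "(\<integral>\<^sup>+z. G z \<partial>dA) = (\<integral>\<^sup>+z. ennreal (1 / pi) * G z \<partial>lebesgue_on unit_disc)"
    unfolding dA_def by (subst nn_integral_density) auto
  also have "\<dots> = (\<integral>\<^sup>+z. ennreal (1 / pi) * G z * indicator unit_disc z \<partial>lebesgue)"
    by (rule nn_integral_restrict_space) simp
  finally show ?thesis by (simp add: nn_integral_completion)
qed

text \<open>
  Weights are merely Lebesgue measurable. Restricting the measure to the Borel sets, as a
  distribution under the identity, lets all product measures and Tonelli arguments live on Borel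
  sets without replacing the weight by a Borel version.
\<close>

definition weighted_measure :: "(complex \<Rightarrow> real) \<Rightarrow> complex measure" where
  "weighted_measure \<omega> = distr (density dA (\<lambda>z. ennreal (\<omega> z))) borel (\<lambda>z. z)"

lemma sets_weighted_measure: "sets (weighted_measure \<omega>) = sets borel"
  unfolding weighted_measure_def by simp

lemma nn_integral_weighted_measure:
  assumes \<omega>: "\<omega> \<in> borel_measurable dA" and F: "F \<in> borel_measurable borel"
  shows "(\<integral>\<^sup>+z. F z \<partial>weighted_measure \<omega>) = (\<integral>\<^sup>+z. ennreal (\<omega> z) * F z \<partial>dA)"
proof -
  have "(\<integral>\<^sup>+z. F z \<partial>weighted_measure \<omega>) = (\<integral>\<^sup>+z. F z \<partial>density dA (\<lambda>z. ennreal (\<omega> z)))"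
    unfolding weighted_measure_def using id_measurable_dA F by (intro nn_integral_distr) auto
  also have "\<dots> = (\<integral>\<^sup>+z. ennreal (\<omega> z) * F z \<partial>dA)"
    using \<omega> borel_imp_dA_measurable[OF F] by (intro nn_integral_density) auto
  finally show ?thesis .
qed

lemma emeasure_weighted_measure:
  assumes \<omega>: "\<omega> \<in> borel_measurable dA" and E: "E \<in> sets borel"
  shows "emeasure (weighted_measure \<omega>) E = weighted_area \<omega> E"
  using nn_integral_weighted_measure[OF \<omega>, of "indicator E"] E
  unfolding weighted_area_def by (simp add: sets_weighted_measure)

lemma weight_measurable: "weight \<omega> \<Longrightarrow> \<omega> \<in> borel_measurable dA"
  unfolding weight_def by auto

lemma finite_weighted_measure:
  assumes "weight \<omega>" shows "finite_measure (weighted_measure \<omega>)"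
proof
  have "emeasure (weighted_measure \<omega>) (space (weighted_measure \<omega>)) = (\<integral>\<^sup>+z. ennreal (\<omega> z) \<partial>dA)"
    using nn_integral_weighted_measure[OF weight_measurable[OF assms], of "\<lambda>_. 1"] by simp
  also have "\<dots> \<le> (\<integral>\<^sup>+z. ennreal (norm (\<omega> z)) \<partial>dA)"
    by (intro nn_integral_mono ennreal_leI) auto
  also have "\<dots> < \<infinity>" using assms unfolding weight_def integrable_iff_bounded by auto
  finally show "emeasure (weighted_measure \<omega>) (space (weighted_measure \<omega>)) \<noteq> \<infinity>" by simp
qed

lemma weighted_measure_disc:
  assumes "weight \<omega>" shows "AE z in weighted_measure \<omega>. z \<in> unit_disc"
proof (rule AE_I)
  have "emeasure (weighted_measure \<omega>) (- unit_disc) = (\<integral>\<^sup>+z. ennreal (\<omega> z) * indicator (- unit_disc) z \<partial>dA)"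
    using emeasure_weighted_measure[OF weight_measurable[OF assms], of "- unit_disc"] unfolding weighted_area_def by simp
  also have "\<dots> = (\<integral>\<^sup>+z. 0 \<partial>dA)" by (rule nn_integral_cong) (simp add: space_dA)
  finally show "emeasure (weighted_measure \<omega>) (- unit_disc) = 0" by simp
qed (auto simp: sets_weighted_measure)

lemma weighted_measure_square_pos:
  assumes "weight \<omega>" "a \<in> unit_disc - {0}"
  shows "0 < measure (weighted_measure \<omega>) (carleson_square a)"
proof -
  interpret finite_measure "weighted_measure \<omega>" by (rule finite_weighted_measure[OF assms(1)])
  have "0 < emeasure (weighted_measure \<omega>) (carleson_square a)"
    using assms emeasure_weighted_measure[OF weight_measurable[OF assms(1)] carleson_square_borel[OF assms(2)]]
    unfolding weight_def by auto
  then show ?thesis unfolding emeasure_eq_measure by simp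
qed

text \<open>
  Young's inequality without the optimal constants, by comparing \<open>b\<close> with \<open>x\<^sup>q\<^sup>-\<^sup>1\<close>.
\<close>

lemma mult_le_powr_sum:
  fixes x b q :: real
  assumes "0 \<le> x" "0 \<le> b" "1 < q"
  shows "x * b \<le> x powr q + b powr (q / (q - 1))"
proof (cases "b \<le> x powr (q - 1)")
  case True
  show ?thesis
  proof (cases "x = 0")
    case False
    then have "x * b \<le> x * x powr (q - 1)" using True assms by (intro mult_left_mono) auto
    also have "\<dots> = x powr q" using False assms by (simp add: powr_diff)
    finally show ?thesis by (simp add: add_increasing2)
  qed simp
next
  case False
  then have b: "0 < b" using powr_ge_zero[of x "q - 1"] by linarith
  have "(x powr (q - 1)) powr (1 / (q - 1)) \<le> b powr (1 / (q - 1))"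
    using False assms by (intro powr_mono2) auto
  then have "x \<le> b powr (1 / (q - 1))" using assms by (simp add: powr_powr)
  then have "x * b \<le> b powr (1 / (q - 1)) * b powr 1" using b by (intro mult_mono) auto
  also have "\<dots> = b powr (q / (q - 1))"
    unfolding powr_add[symmetric] using assms by (simp add: field_simps)
  finally show ?thesis by (simp add: add_increasing)
qed

text \<open>
  Young's inequality applied pointwise to \<open>F \<omega>\<^sup>1\<^sup>/\<^sup>q\<close> and \<open>\<nu> \<omega>\<^sup>-\<^sup>1\<^sup>/\<^sup>q\<close>, scaled by \<open>t\<close> and \<open>1/t\<close>.
  With \<open>t\<^sup>q = X\<close> equal to the coefficient wanted for the integral of \<open>F\<^sup>q\<close>, the second Young term
  integrates to at most \<open>C \<nu>(S) y\<close> by the \<open>B\<^sub>q\<close> condition.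
\<close>

lemma B_condition_linear:
  assumes q: "1 < q" and w: "weight \<omega>" and n: "weight \<nu>" and B: "quotient_in_B q \<nu> \<omega>"
  shows "\<exists>C>0. \<forall>a\<in>unit_disc - {0}. \<forall>F y. F \<in> borel_measurable borel \<and> (\<forall>z. 0 \<le> F z) \<and> 0 < y \<longrightarrow>
      (\<integral>\<^sup>+z\<in>carleson_square a. ennreal (F z) \<partial>weighted_measure \<nu>)
        \<le> ennreal (C * measure (weighted_measure \<nu>) (carleson_square a) * y)
          + ennreal (C * measure (weighted_measure \<nu>) (carleson_square a) * y powr (1 - q) / measure (weighted_measure \<omega>) (carleson_square a))
            * (\<integral>\<^sup>+z\<in>carleson_square a. ennreal (F z powr q) \<partial>weighted_measure \<omega>)"
proof -
  interpret mu: finite_measure "weighted_measure \<omega>" by (rule finite_weighted_measure[OF w])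
  interpret eta: finite_measure "weighted_measure \<nu>" by (rule finite_weighted_measure[OF n])
  note wm[measurable] = weight_measurable[OF w] and nm[measurable] = weight_measurable[OF n]
  obtain C1 where C1: "\<And>a. a \<in> unit_disc - {0} \<Longrightarrow>
        epow (weighted_area \<omega> (carleson_square a)) (1 / q) *
        epow (\<integral>\<^sup>+ z \<in> carleson_square a. dual_integrand q \<omega> \<nu> z \<partial>dA) ((q - 1) / q)
        \<le> ennreal C1 * weighted_area \<nu> (carleson_square a)"
    using B unfolding quotient_in_B_def by blast
  define C where "C = max C1 1"
  have C: "0 < C" unfolding C_def by simp
  define q' where "q' = q / (q - 1)"
  define r where "r = 1 / (q - 1)"
  have qr: "q' = 1 + r" "0 < q'" "0 < r" "(1 - q) * (- r) = 1" "q' / q = r"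
    unfolding q'_def r_def using q by (auto simp: field_simps)
  have "(\<integral>\<^sup>+z\<in>carleson_square a. ennreal (F z) \<partial>weighted_measure \<nu>)
        \<le> ennreal (C * measure (weighted_measure \<nu>) (carleson_square a) * y)
          + ennreal (C * measure (weighted_measure \<nu>) (carleson_square a) * y powr (1 - q) / measure (weighted_measure \<omega>) (carleson_square a))
            * (\<integral>\<^sup>+z\<in>carleson_square a. ennreal (F z powr q) \<partial>weighted_measure \<omega>)"
    if a: "a \<in> unit_disc - {0}" and Fm[measurable]: "F \<in> borel_measurable borel" and F0: "\<forall>z. 0 \<le> F z" and y: "0 < y" for a F y
  proof -
    define S where "S = carleson_square a"
    have Sm[measurable]: "S \<in> sets borel" unfolding S_def by (rule carleson_square_borel[OF a])
    define m where "m = measure (weighted_measure \<omega>) S"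
    define e where "e = measure (weighted_measure \<nu>) S"
    have m: "0 < m" unfolding m_def S_def by (rule weighted_measure_square_pos[OF w a])
    have e: "0 < e" unfolding e_def S_def by (rule weighted_measure_square_pos[OF n a])
    have wa: "weighted_area \<omega> S = ennreal m" "weighted_area \<nu> S = ennreal e"
      unfolding m_def e_def using emeasure_weighted_measure[OF wm Sm] emeasure_weighted_measure[OF nm Sm]
      by (simp_all add: mu.emeasure_eq_measure eta.emeasure_eq_measure)
    have dm[measurable]: "dual_integrand q \<omega> \<nu> \<in> borel_measurable dA"
      unfolding dual_integrand_def[abs_def] by measurable
    define Dd where "Dd = (\<integral>\<^sup>+ z \<in> S. dual_integrand q \<omega> \<nu> z \<partial>dA)"
    have "epow (ennreal m) (1 / q) * epow Dd ((q - 1) / q) \<le> ennreal C1 * ennreal e"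
      using C1[OF a] unfolding Dd_def S_def[symmetric] wa .
    also have "\<dots> \<le> ennreal C * ennreal e" unfolding C_def by (intro mult_right_mono ennreal_leI) auto
    finally have main: "epow (ennreal m) (1 / q) * epow Dd ((q - 1) / q) \<le> ennreal (C * e)"
      using C by (simp add: ennreal_mult')
    have em: "epow (ennreal m) (1 / q) = ennreal (m powr (1 / q))" unfolding epow_def using m by simp
    have "Dd \<noteq> \<infinity>"
    proof
      assume "Dd = \<infinity>"
      then have "epow (ennreal m) (1 / q) * epow Dd ((q - 1) / q) = \<infinity>"
        unfolding em using m by (simp add: epow_def ennreal_mult_top)
      with main show False by (simp add: top_unique)
    qed
    then obtain d where d: "Dd = ennreal d" "0 \<le> d" by (cases Dd) auto
    have "epow Dd ((q - 1) / q) = ennreal (d powr ((q - 1) / q))" unfolding epow_def d(1) using d(2) by simp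
    with main em have "ennreal (m powr (1 / q) * d powr ((q - 1) / q)) \<le> ennreal (C * e)" by (simp add: ennreal_mult')
    then have le: "m powr (1 / q) * d powr ((q - 1) / q) \<le> C * e" using C e by (subst (asm) ennreal_le_iff) auto
    have dle: "d \<le> (C * e) powr q' * m powr (- r)"
    proof -
      have "(m powr (1 / q) * d powr ((q - 1) / q)) powr q' \<le> (C * e) powr q'"
        using le qr by (intro powr_mono2) auto
      also have "(m powr (1 / q) * d powr ((q - 1) / q)) powr q' = (m powr (1 / q)) powr q' * (d powr ((q - 1) / q)) powr q'"
        by (rule powr_mult)
      also have "(d powr ((q - 1) / q)) powr q' = d" unfolding powr_powr q'_def using q d(2) by simp
      also have "(m powr (1 / q)) powr q' = m powr r" unfolding powr_powr qr(5)[symmetric] by simp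
      finally have "m powr (- r) * (m powr r * d) \<le> m powr (- r) * (C * e) powr q'" by (intro mult_left_mono) auto
      moreover have "m powr (- r) * (m powr r * d) = d" using m by (simp add: mult.assoc[symmetric] powr_add[symmetric])
      ultimately have "d \<le> m powr (- r) * (C * e) powr q'" by (simp only:)
      then show ?thesis by (simp only: mult.commute)
    qed
    (* The coefficient of the second term in the claim; it fixes the scaling \<open>t\<close> in the inequality of Young. *)
    define X where "X = C * e * y powr (1 - q) / m"
    have X: "0 < X" unfolding X_def using C e y m by simp
    define t where "t = X powr (1 / q)"
    have t: "0 < t" unfolding t_def using X by simp
    have tq: "t powr q = X" unfolding t_def powr_powr using q X by simp
    have tr: "(1 / t) powr q' = X powr (- r)"
      unfolding t_def using X qr(5) by (simp add: powr_minus_divide powr_divide powr_powr)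
    have young: "ennreal (\<nu> z) * ennreal (F z) \<le> ennreal X * (ennreal (\<omega> z) * ennreal (F z powr q)) + ennreal (X powr (- r)) * dual_integrand q \<omega> \<nu> z"
      if z: "z \<in> unit_disc" for z
    proof -
      have nz: "0 \<le> \<nu> z" "0 \<le> \<omega> z" using w n z unfolding weight_def by auto
      consider "\<nu> z = 0" | "\<nu> z \<noteq> 0" "\<omega> z = 0" | "\<nu> z \<noteq> 0" "\<omega> z \<noteq> 0" by blast
      then show ?thesis
      proof cases
        case 2
        then have "ennreal (X powr (- r)) * dual_integrand q \<omega> \<nu> z = \<infinity>"
          unfolding dual_integrand_def using X by (simp add: ennreal_mult_top)
        then show ?thesis by simp
      next
        case 3
        define x where "x = t * (F z * \<omega> z powr (1 / q))"
        define b where "b = (1 / t) * (\<nu> z * \<omega> z powr (- 1 / q))"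
        have "\<omega> z powr (1 / q) * \<omega> z powr (- 1 / q) = 1"
          unfolding powr_add[symmetric] using 3 by simp
        then have "x * b = \<nu> z * F z" unfolding x_def b_def using t by (simp add: field_simps)
        moreover have "x * b \<le> x powr q + b powr q'"
          unfolding q'_def using q t F0 nz by (intro mult_le_powr_sum) (auto simp: x_def b_def)
        moreover have "x powr q = X * (\<omega> z * F z powr q)"
        proof -
          have "x powr q = t powr q * (F z powr q * (\<omega> z powr (1 / q)) powr q)" unfolding x_def by (simp only: powr_mult)
          also have "(\<omega> z powr (1 / q)) powr q = \<omega> z" unfolding powr_powr using q nz by simp
          finally show ?thesis unfolding tq by (simp only: mult_ac)
        qed
        moreover have "b powr q' = X powr (- r) * (\<nu> z * \<omega> z powr (- 1 / q)) powr q'"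
          unfolding b_def tr[symmetric] by (rule powr_mult)
        ultimately have "\<nu> z * F z \<le> X * (\<omega> z * F z powr q) + X powr (- r) * (\<nu> z * \<omega> z powr (- 1 / q)) powr q'" by simp
        then have "ennreal (\<nu> z * F z) \<le> ennreal (X * (\<omega> z * F z powr q) + X powr (- r) * (\<nu> z * \<omega> z powr (- 1 / q)) powr q')"
          by (rule ennreal_leI)
        then show ?thesis
          unfolding dual_integrand_def q'_def[symmetric] using 3 nz X by (simp add: ennreal_mult' ennreal_plus)
      qed simp
    qed
    have "(\<integral>\<^sup>+z\<in>S. ennreal (F z) \<partial>weighted_measure \<nu>) = (\<integral>\<^sup>+z. ennreal (\<nu> z) * (ennreal (F z) * indicator S z) \<partial>dA)"
      by (rule nn_integral_weighted_measure[OF nm]) measurable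
    also have "\<dots> \<le> (\<integral>\<^sup>+z. ennreal X * (ennreal (\<omega> z) * (ennreal (F z powr q) * indicator S z)) + ennreal (X powr (- r)) * (dual_integrand q \<omega> \<nu> z * indicator S z) \<partial>dA)"
      using young by (intro nn_integral_mono) (auto simp: space_dA indicator_def)
    also have "\<dots> = ennreal X * (\<integral>\<^sup>+z. ennreal (\<omega> z) * (ennreal (F z powr q) * indicator S z) \<partial>dA) + ennreal (X powr (- r)) * Dd"
    proof -
      note [measurable] = borel_imp_dA_measurable[OF Fm]
      have iS[measurable]: "(indicator S :: complex \<Rightarrow> ennreal) \<in> borel_measurable dA"
        by (rule borel_imp_dA_measurable) measurable
      have m1: "(\<lambda>z. ennreal (\<omega> z) * (ennreal (F z powr q) * indicator S z)) \<in> borel_measurable dA" by measurable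
      have m2: "(\<lambda>z. dual_integrand q \<omega> \<nu> z * indicator S z) \<in> borel_measurable dA" by measurable
      show ?thesis unfolding Dd_def nn_integral_cmult[OF m1, symmetric] nn_integral_cmult[OF m2, symmetric]
        by (rule nn_integral_add) (intro borel_measurable_times_ennreal borel_measurable_const m1 m2)+
    qed
    also have "(\<integral>\<^sup>+z. ennreal (\<omega> z) * (ennreal (F z powr q) * indicator S z) \<partial>dA) = (\<integral>\<^sup>+z\<in>S. ennreal (F z powr q) \<partial>weighted_measure \<omega>)"
      by (rule nn_integral_weighted_measure[OF wm, symmetric]) measurable
    also have "ennreal (X powr (- r)) * Dd \<le> ennreal (C * e * y)"
    proof -
      have "X powr (- r) * d \<le> X powr (- r) * ((C * e) powr q' * m powr (- r))" using dle by (intro mult_left_mono) auto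
      also have eqX: "X powr (- r) = (C * e) powr (- r) * y / m powr (- r)"
      proof -
        have "X powr (- r) = (C * e * y powr (1 - q)) powr (- r) / m powr (- r)" unfolding X_def by (rule powr_divide)
        also have "(C * e * y powr (1 - q)) powr (- r) = (C * e) powr (- r) * (y powr (1 - q)) powr (- r)" by (rule powr_mult)
        also have "(y powr (1 - q)) powr (- r) = y" unfolding powr_powr qr(4) using y by simp
        finally show ?thesis .
      qed
      also have "(C * e) powr (- r) * y / m powr (- r) * ((C * e) powr q' * m powr (- r)) = (C * e) powr (- r) * (C * e) powr q' * y"
        using m by simp
      also have "(C * e) powr (- r) * (C * e) powr q' = C * e" unfolding powr_add[symmetric] qr(1) using C e by simp
      finally have "X powr (- r) * d \<le> C * e * y" unfolding eqX .
      then show ?thesis unfolding d(1) using d(2) by (simp add: ennreal_mult'[symmetric] ennreal_leI)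
    qed
    finally show ?thesis unfolding X_def m_def e_def S_def by (simp add: add.commute add_right_mono)
  qed
  with C show ?thesis by (intro exI[of _ C] conjI ballI allI impI) (assumption, blast)
qed

text \<open>
  A radial weight is given by a function on \<open>[0, 1)\<close> that is only Lebesgue measurable, and
  composition with the modulus does not preserve Lebesgue measurability for free. The Borel version
  \<open>n\<close> differs from it on a null set \<open>X\<close> of radii, and the points with modulus in \<open>X\<close> form a null set
  of the plane by polar coordinates.
\<close>

lemma radial_weight_profile:
  assumes "radial_weight \<nu>"
  shows "\<exists>n. n \<in> borel_measurable borel \<and> (AE z in lborel. z \<in> unit_disc \<longrightarrow> ennreal (\<nu> z) = ennreal (n (cmod z)))
    \<and> (\<forall>r. 0 \<le> r \<and> r < 1 \<longrightarrow> ennreal (tail \<nu> r) = (\<integral>\<^sup>+s\<in>{r..<1}. ennreal (n s) \<partial>lborel))"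
proof -
  have w: "weight \<nu>" and rad: "\<And>z. z \<in> unit_disc \<Longrightarrow> \<nu> z = \<nu> (of_real (cmod z))"
    and int: "set_integrable lebesgue {0..<1} (\<lambda>s::real. \<nu> (of_real s))"
    using assms unfolding radial_weight_def by blast+
  have nn: "0 \<le> \<nu> (of_real s)" if "0 \<le> s" "s < 1" for s
    using w that unfolding weight_def by auto
  have "(\<lambda>s. indicator {0..<1} s *\<^sub>R \<nu> (of_real s)) \<in> borel_measurable lebesgue"
    using int unfolding set_integrable_def by (rule borel_measurable_integrable)
  from completion_ex_borel_measurable_real[OF this] obtain n where n: "n \<in> borel_measurable lborel"
    and ae: "AE s in lborel. indicator {0..<1} s *\<^sub>R \<nu> (of_real s) = n s" by blast
  have nb: "n \<in> borel_measurable borel" using n by simp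
  obtain X where X0: "{s \<in> space lborel. \<not> indicator {0..<1} s *\<^sub>R \<nu> (of_real s) = n s} \<subseteq> X"
      "emeasure lborel X = 0" "X \<in> sets lborel"
    using AE_E[OF ae] by blast
  have X: "X \<in> null_sets lborel" "{s. indicator {0..<1} s *\<^sub>R \<nu> (of_real s) \<noteq> n s} \<subseteq> X"
    using X0 by (auto intro: null_setsI)
  have Xb[measurable]: "X \<in> sets borel" using X(1) by auto
  have "(\<integral>\<^sup>+z. indicator X (cmod z) * indicator unit_disc z \<partial>(lborel :: complex measure))
      = (\<integral>\<^sup>+r. indicator X r * ennreal (2 * pi * r) * indicator {0..<1} r \<partial>lborel)"
    by (rule nn_integral_radial_unit_disc) measurable
  also have "\<dots> = 0"
  proof (subst nn_integral_0_iff_AE)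
    show "AE r in lborel. indicator X r * ennreal (2 * pi * r) * indicator {0..<1} r = 0"
      using AE_not_in[OF X(1)] by eventually_elim simp
  qed measurable
  finally have z0: "(\<integral>\<^sup>+z. indicator X (cmod z) * indicator unit_disc z \<partial>(lborel :: complex measure)) = 0" .
  have um: "(\<lambda>z. indicator X (cmod z) * indicator unit_disc z :: ennreal) \<in> borel_measurable (lborel :: complex measure)"
  proof -
    have nm: "cmod \<in> borel_measurable borel" by simp
    have "(\<lambda>z::complex. indicator X (cmod z) :: ennreal) \<in> borel_measurable borel"
      by (rule measurable_compose[OF nm borel_measurable_indicator[OF Xb]])
    moreover have "(indicator unit_disc :: complex \<Rightarrow> ennreal) \<in> borel_measurable borel" by (rule borel_measurable_indicator) simp
    ultimately show ?thesis by (simp add: borel_measurable_times_ennreal)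
  qed
  have "AE z in lborel. indicator X (cmod z) * indicator unit_disc (z::complex) = (0::ennreal)"
    using z0 um by (subst (asm) nn_integral_0_iff_AE) auto
  then have 1: "AE z in lborel. z \<in> unit_disc \<longrightarrow> ennreal (\<nu> z) = ennreal (n (cmod z))"
  proof eventually_elim
    fix z :: complex assume *: "indicator X (cmod z) * indicator unit_disc z = (0::ennreal)"
    show "z \<in> unit_disc \<longrightarrow> ennreal (\<nu> z) = ennreal (n (cmod z))"
    proof
      assume z: "z \<in> unit_disc"
      then have "cmod z \<notin> X" using * by (auto simp: indicator_def split: if_splits)
      then have "indicator {0..<1} (cmod z) *\<^sub>R \<nu> (of_real (cmod z)) = n (cmod z)" using X(2) by blast
      then show "ennreal (\<nu> z) = ennreal (n (cmod z))" using z rad[OF z] by simp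
    qed
  qed
  have 2: "ennreal (tail \<nu> r) = (\<integral>\<^sup>+s\<in>{r..<1}. ennreal (n s) \<partial>lborel)" if r: "0 \<le> r" "r < 1" for r
  proof -
    have "set_integrable lebesgue {r..<1} (\<lambda>s::real. \<nu> (of_real s))"
      by (rule set_integrable_subset[OF int]) (use r in auto)
    then have i: "integrable lebesgue (\<lambda>s. indicator {r..<1} s *\<^sub>R \<nu> (of_real s))" unfolding set_integrable_def .
    have "ennreal (tail \<nu> r) = (\<integral>\<^sup>+s. ennreal (indicator {r..<1} s *\<^sub>R \<nu> (of_real s)) \<partial>lebesgue)"
      unfolding tail_def set_lebesgue_integral_def
      by (rule nn_integral_eq_integral[symmetric, OF i]) (use r nn in \<open>auto simp: indicator_def\<close>)
    also have "\<dots> = (\<integral>\<^sup>+s. ennreal (indicator {r..<1} s *\<^sub>R \<nu> (of_real s)) \<partial>lborel)"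
      by (rule nn_integral_completion)
    also have "\<dots> = (\<integral>\<^sup>+s\<in>{r..<1}. ennreal (n s) \<partial>lborel)"
    proof (rule nn_integral_cong_AE)
      show "AE s in lborel. ennreal (indicator {r..<1} s *\<^sub>R \<nu> (of_real s)) = ennreal (n s) * indicator {r..<1} s"
        using ae by eventually_elim (use r in \<open>auto simp: indicator_def\<close>)
    qed
    finally show ?thesis .
  qed
  show ?thesis using nb 1 2 by blast
qed

lemma nn_integral_radial_weight:
  assumes \<nu>: "weight \<nu>" and ae: "AE z in lborel. z \<in> unit_disc \<longrightarrow> ennreal (\<nu> z) = ennreal (n (cmod z))"
    and F: "F \<in> borel_measurable borel"
  shows "(\<integral>\<^sup>+z. F z \<partial>weighted_measure \<nu>) = (\<integral>\<^sup>+z. ennreal (1 / pi) * (ennreal (n (cmod z)) * F z) * indicator unit_disc z \<partial>lborel)"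
proof -
  have "(\<integral>\<^sup>+z. F z \<partial>weighted_measure \<nu>) = (\<integral>\<^sup>+z. ennreal (\<nu> z) * F z \<partial>dA)"
    by (rule nn_integral_weighted_measure[OF weight_measurable[OF \<nu>] F])
  also have "\<dots> = (\<integral>\<^sup>+z. ennreal (1 / pi) * (ennreal (\<nu> z) * F z) * indicator unit_disc z \<partial>lborel)"
    using weight_measurable[OF \<nu>] borel_imp_dA_measurable[OF F] by (intro nn_integral_dA) measurable
  also have "\<dots> = (\<integral>\<^sup>+z. ennreal (1 / pi) * (ennreal (n (cmod z)) * F z) * indicator unit_disc z \<partial>lborel)"
  proof (rule nn_integral_cong_AE)
    show "AE z in lborel. ennreal (1 / pi) * (ennreal (\<nu> z) * F z) * indicator unit_disc z
       = ennreal (1 / pi) * (ennreal (n (cmod z)) * F z) * indicator unit_disc z"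
      using ae by eventually_elim (auto simp: indicator_def)
  qed
  finally show ?thesis .
qed

lemma radial_weight_rotate:
  assumes \<nu>: "radial_weight \<nu>"
  shows "distr (weighted_measure \<nu>) borel (\<lambda>z. cis \<theta> * z) = weighted_measure \<nu>"
proof (rule measure_eqI)
  have w: "weight \<nu>" using \<nu> unfolding radial_weight_def by blast
  obtain n where nb[measurable]: "n \<in> borel_measurable borel"
    and ae: "AE z in lborel. z \<in> unit_disc \<longrightarrow> ennreal (\<nu> z) = ennreal (n (cmod z))"
    using radial_weight_profile[OF \<nu>] by blast
  note I = nn_integral_radial_weight[OF w ae]
  fix E assume "E \<in> sets (distr (weighted_measure \<nu>) borel (\<lambda>z. cis \<theta> * z))"
  then have E[measurable]: "E \<in> sets borel" by simp
  have rm: "(\<lambda>z. cis \<theta> * z) \<in> measurable (weighted_measure \<nu>) borel"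
    by (simp cong: measurable_cong_sets add: sets_weighted_measure)
  have bm: "(\<lambda>z::complex. cis \<theta> * z) \<in> measurable borel borel" by measurable
  have Eb: "(indicator E :: complex \<Rightarrow> ennreal) \<in> borel_measurable borel" by measurable
  have Erot: "(\<lambda>z. indicator E (cis \<theta> * z) :: ennreal) \<in> borel_measurable borel"
    by (rule measurable_compose[OF bm Eb])
  have "emeasure (distr (weighted_measure \<nu>) borel (\<lambda>z. cis \<theta> * z)) E
     = (\<integral>\<^sup>+z. indicator E z \<partial>distr (weighted_measure \<nu>) borel (\<lambda>z. cis \<theta> * z))" by simp
  also have "\<dots> = (\<integral>\<^sup>+z. indicator E (cis \<theta> * z) \<partial>weighted_measure \<nu>)"
    by (rule nn_integral_distr[OF rm]) simp
  also have "\<dots> = (\<integral>\<^sup>+z. ennreal (1 / pi) * (ennreal (n (cmod z)) * indicator E (cis \<theta> * z)) * indicator unit_disc z \<partial>lborel)"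
    by (rule I[OF Erot])
  also have "\<dots> = (\<integral>\<^sup>+z. ennreal (1 / pi) * (ennreal (n (cmod (cis \<theta> * z))) * indicator E (cis \<theta> * z)) * indicator unit_disc (cis \<theta> * z) \<partial>lborel)"
    by (intro nn_integral_cong) (simp add: norm_mult indicator_def)
  also have "\<dots> = (\<integral>\<^sup>+z. ennreal (1 / pi) * (ennreal (n (cmod z)) * indicator E z) * indicator unit_disc z \<partial>distr lborel borel (\<lambda>z. cis \<theta> * z))"
  proof (rule nn_integral_distr[symmetric])
    have [measurable]: "unit_disc \<in> sets borel" by simp
    show "(\<lambda>z. ennreal (1 / pi) * (ennreal (n (cmod z)) * indicator E z) * indicator unit_disc z) \<in> borel_measurable (distr lborel borel (\<lambda>z. cis \<theta> * z))"
      by (simp cong: measurable_cong_sets, measurable)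
  qed measurable
  also have "\<dots> = (\<integral>\<^sup>+z. indicator E z \<partial>weighted_measure \<nu>)"
    unfolding lborel_complex_distr_rotate by (rule I[OF Eb, symmetric])
  also have "\<dots> = emeasure (weighted_measure \<nu>) E" by (simp add: sets_weighted_measure)
  finally show "emeasure (distr (weighted_measure \<nu>) borel (\<lambda>z. cis \<theta> * z)) E = emeasure (weighted_measure \<nu>) E" .
qed (simp add: sets_weighted_measure)

text \<open>
  In polar coordinates the density of the radius is \<open>2s \<nu>(s)\<close>, with \<open>2r \<le> 2s \<le> 2\<close> on the strip.
\<close>

lemma radial_weight_strip:
  assumes \<nu>: "radial_weight \<nu>" and r: "0 \<le> r" "r < 1"
  shows "measure (weighted_measure \<nu>) {z. r \<le> cmod z \<and> cmod z < 1} \<le> 2 * tail \<nu> r"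
    and "2 * r * tail \<nu> r \<le> measure (weighted_measure \<nu>) {z. r \<le> cmod z \<and> cmod z < 1}"
    and "0 \<le> tail \<nu> r"
proof -
  have w: "weight \<nu>" using \<nu> unfolding radial_weight_def by blast
  interpret finite_measure "weighted_measure \<nu>" by (rule finite_weighted_measure[OF w])
  obtain n where nb[measurable]: "n \<in> borel_measurable borel"
    and ae: "AE z in lborel. z \<in> unit_disc \<longrightarrow> ennreal (\<nu> z) = ennreal (n (cmod z))"
    and tl: "\<And>r. 0 \<le> r \<Longrightarrow> r < 1 \<Longrightarrow> ennreal (tail \<nu> r) = (\<integral>\<^sup>+s\<in>{r..<1}. ennreal (n s) \<partial>lborel)"
    using radial_weight_profile[OF \<nu>] by blast
  show t0: "0 \<le> tail \<nu> r"
    unfolding tail_def set_lebesgue_integral_def using w r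
    by (intro integral_nonneg_AE AE_I2) (auto simp: indicator_def weight_def)
  define V where "V = measure (weighted_measure \<nu>) {z. r \<le> cmod z \<and> cmod z < 1}"
  have "ennreal V = (\<integral>\<^sup>+z. indicator {z. r \<le> cmod z \<and> cmod z < 1} z \<partial>weighted_measure \<nu>)"
    unfolding V_def emeasure_eq_measure[symmetric] by (rule nn_integral_indicator[symmetric]) (simp add: sets_weighted_measure, measurable)
  also have "\<dots> = (\<integral>\<^sup>+z. ennreal (1 / pi) * (ennreal (n (cmod z)) * indicator {z. r \<le> cmod z \<and> cmod z < 1} z) * indicator unit_disc z \<partial>lborel)"
    by (rule nn_integral_radial_weight[OF w ae]) measurable
  also have "\<dots> = (\<integral>\<^sup>+z. (ennreal (1 / pi) * (ennreal (n (cmod z)) * indicator {r..<1} (cmod z))) * indicator unit_disc z \<partial>lborel)"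
    by (intro nn_integral_cong) (simp add: indicator_def)
  also have "\<dots> = (\<integral>\<^sup>+s. (ennreal (1 / pi) * (ennreal (n s) * indicator {r..<1} s)) * ennreal (2 * pi * s) * indicator {0..<1} s \<partial>lborel)"
    by (rule nn_integral_radial_unit_disc) measurable
  also have "\<dots> = (\<integral>\<^sup>+s. ennreal (2 * s) * (ennreal (n s) * indicator {r..<1} s) \<partial>lborel)"
  proof (rule nn_integral_cong)
    fix s :: real
    show "(ennreal (1 / pi) * (ennreal (n s) * indicator {r..<1} s)) * ennreal (2 * pi * s) * indicator {0..<1} s
      = ennreal (2 * s) * (ennreal (n s) * indicator {r..<1} s)"
    proof (cases "s \<in> {r..<1}")
      case True
      then have s: "0 \<le> s" "s < 1" using r by auto
      have "ennreal (1 / pi) * ennreal (2 * pi * s) = ennreal (2 * s)"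
        using s by (subst ennreal_mult'[symmetric]) auto
      then have "ennreal (1 / pi) * ennreal (n s) * ennreal (2 * pi * s) = ennreal (2 * s) * ennreal (n s)"
        by (metis mult.assoc mult.commute)
      then show ?thesis using True s by simp
    qed simp
  qed
  finally have V: "ennreal V = (\<integral>\<^sup>+s. ennreal (2 * s) * (ennreal (n s) * indicator {r..<1} s) \<partial>lborel)" .
  have "ennreal V \<le> (\<integral>\<^sup>+s. ennreal 2 * (ennreal (n s) * indicator {r..<1} s) \<partial>lborel)"
    unfolding V
  proof (rule nn_integral_mono)
    fix s :: real
    show "ennreal (2 * s) * (ennreal (n s) * indicator {r..<1} s) \<le> ennreal 2 * (ennreal (n s) * indicator {r..<1} s)"
    proof (cases "s \<in> {r..<1}")
      case True
      then have "ennreal (2 * s) \<le> ennreal 2" by (intro ennreal_leI) auto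
      then show ?thesis by (rule mult_right_mono) simp
    qed simp
  qed
  also have "\<dots> = ennreal 2 * ennreal (tail \<nu> r)"
    unfolding tl[OF r] by (rule nn_integral_cmult) measurable
  also have "\<dots> = ennreal (2 * tail \<nu> r)" by (rule ennreal_mult'[symmetric]) simp
  finally show "V \<le> 2 * tail \<nu> r" using t0 by (subst (asm) ennreal_le_iff) auto
  have "ennreal (2 * r * tail \<nu> r) = ennreal (2 * r) * ennreal (tail \<nu> r)" using r by (intro ennreal_mult') simp
  also have "\<dots> = (\<integral>\<^sup>+s. ennreal (2 * r) * (ennreal (n s) * indicator {r..<1} s) \<partial>lborel)"
    unfolding tl[OF r] by (rule nn_integral_cmult[symmetric]) measurable
  also have "\<dots> \<le> ennreal V"
    unfolding V by (intro nn_integral_mono) (auto simp: indicator_def intro!: mult_right_mono ennreal_leI)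
  finally show "2 * r * tail \<nu> r \<le> V" unfolding V_def by (subst (asm) ennreal_le_iff) auto
qed

lemma tail_antimono:
  assumes \<nu>: "radial_weight \<nu>" and r: "0 \<le> r" "r \<le> r'" "r' < 1"
  shows "tail \<nu> r' \<le> tail \<nu> r"
proof -
  obtain n where tl: "\<And>r. 0 \<le> r \<Longrightarrow> r < 1 \<Longrightarrow> ennreal (tail \<nu> r) = (\<integral>\<^sup>+s\<in>{r..<1}. ennreal (n s) \<partial>lborel)"
    using radial_weight_profile[OF \<nu>] by blast
  have "ennreal (tail \<nu> r') \<le> ennreal (tail \<nu> r)"
    using r by (subst (1 2) tl) (auto intro!: nn_integral_mono simp: indicator_def)
  then show ?thesis using radial_weight_strip(3)[OF \<nu>, of r] r by (subst (asm) ennreal_le_iff) auto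
qed

text \<open>
  Strips have \<open>\<nu>\<close>-measure comparable to the tails; near the origin, where the lower bound of
  \<open>radial_weight_strip\<close> degenerates, one application of \<open>\<D>\<close>-hat moves away from it. Iterating
  \<open>\<D>\<close>-hat dyadically gives the exponent \<open>\<beta> = log\<^sub>2 C\<close>. Iterating \<open>\<D>\<close>-check makes its constant large
  enough to absorb those of the comparison.
\<close>

lemma D_class_tails:
  assumes \<nu>: "\<nu> \<in> D_class"
  obtains A K \<beta> where "1 \<le> A" "1 < K" "0 \<le> \<beta>"
    "\<And>h. 0 < h \<Longrightarrow> h < 1 \<Longrightarrow> 0 < measure (weighted_measure \<nu>) {z. 1 - h \<le> cmod z \<and> cmod z < 1}"
    "\<And>t h. 0 < t \<Longrightarrow> t \<le> h \<Longrightarrow> h < 1 \<Longrightarrow>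
      measure (weighted_measure \<nu>) {z. 1 - h \<le> cmod z \<and> cmod z < 1}
        \<le> A * (h / t) powr \<beta> * measure (weighted_measure \<nu>) {z. 1 - t \<le> cmod z \<and> cmod z < 1}"
    "\<And>h. 0 < h \<Longrightarrow> h < 1 \<Longrightarrow>
      measure (weighted_measure \<nu>) {z. 1 - h \<le> cmod z \<and> cmod z < 1}
        \<le> A * measure (weighted_measure \<nu>) {z. 1 - h \<le> cmod z \<and> cmod z < 1 - h / K}"
proof -
  have rw: "radial_weight \<nu>" using \<nu> unfolding D_class_def D_hat_def by blast
  then have w: "weight \<nu>" unfolding radial_weight_def by blast
  interpret finite_measure "weighted_measure \<nu>" by (rule finite_weighted_measure[OF w])
  obtain C where C: "1 < C" and hat: "\<And>r. 0 \<le> r \<Longrightarrow> r < 1 \<Longrightarrow> tail \<nu> r \<le> C * tail \<nu> ((1 + r) / 2)"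
    using \<nu> unfolding D_class_def D_hat_def by blast
  obtain L c where L: "1 < L" and c: "1 < c" and check: "\<And>r. 0 \<le> r \<Longrightarrow> r < 1 \<Longrightarrow> c * tail \<nu> (1 - (1 - r) / L) \<le> tail \<nu> r"
    using \<nu> unfolding D_class_def D_check_def by blast
  define T where "T h = tail \<nu> (1 - h)" for h
  define V where "V h = measure (weighted_measure \<nu>) {z. 1 - h \<le> cmod z \<and> cmod z < 1}" for h
  have T0: "0 \<le> T h" if "0 < h" "h \<le> 1" for h
    unfolding T_def using that by (intro radial_weight_strip(3)[OF rw]) auto
  have Tmono: "T h \<le> T h'" if "0 < h" "h \<le> h'" "h' \<le> 1" for h h'
    unfolding T_def using that by (intro tail_antimono[OF rw]) auto
  have That: "T h \<le> C * T (h / 2)" if "0 < h" "h \<le> 1" for h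
    using hat[of "1 - h"] that unfolding T_def by (simp add: field_simps)
  have Tcheck: "c * T (h / L) \<le> T h" if "0 < h" "h \<le> 1" for h
    using check[of "1 - h"] that unfolding T_def by simp
  have V1: "V h \<le> 2 * T h" if "0 < h" "h < 1" for h
    unfolding V_def T_def using that by (intro radial_weight_strip(1)[OF rw]) auto
  have V2: "T h \<le> C * V h" if h: "0 < h" "h < 1" for h
  proof -
    have "T (h / 2) = 1 * T (h / 2)" by simp
    also have "\<dots> \<le> 2 * (1 - h / 2) * T (h / 2)" using h T0[of "h / 2"] by (intro mult_right_mono) auto
    also have "\<dots> \<le> V (h / 2)"
      unfolding V_def T_def using h by (intro radial_weight_strip(2)[OF rw]) auto
    also have "\<dots> \<le> V h" unfolding V_def
      using h by (intro finite_measure_mono) (auto simp: sets_weighted_measure)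
    finally have "C * T (h / 2) \<le> C * V h" using C by (intro mult_left_mono) auto
    then show ?thesis using That[of h] h by linarith
  qed
  have Thatn: "T h \<le> C ^ k * T (h / 2 ^ k)" if h: "0 < h" "h \<le> 1" for h k
  proof (induction k)
    case (Suc k)
    have "h / 2 ^ k \<le> 1" using h by (simp add: divide_le_eq) (meson h(2) le_less_trans less_imp_le two_realpow_ge_one order_trans)
    then have "C ^ k * T (h / 2 ^ k) \<le> C ^ k * (C * T (h / 2 ^ k / 2))"
      using That[of "h / 2 ^ k"] h C by (intro mult_left_mono) auto
    then show ?case using Suc by (simp add: mult_ac)
  qed simp
  have Tcheckn: "c ^ k * T (h / L ^ k) \<le> T h" if h: "0 < h" "h \<le> 1" for h k
  proof (induction k)
    case (Suc k)
    have "1 \<le> L ^ k" using L by simp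
    then have "h / L ^ k \<le> h / 1" using h by (intro frac_le) auto
    then have "h / L ^ k \<le> 1" using h by simp
    then have "c ^ k * (c * T (h / L ^ k / L)) \<le> c ^ k * T (h / L ^ k)"
      using Tcheck[of "h / L ^ k"] h c L by (intro mult_left_mono) auto
    then show ?case using Suc by (simp add: mult_ac)
  qed simp
  (* The factor 4C lets the remaining strip have at most half of the mass, after two passages between strips and tails. *)
  obtain m where m: "4 * C < c ^ m" using real_arch_pow[OF c] by blast
  have m0: "m \<noteq> 0" using m C by (intro notI) simp
  define K where "K = L ^ m"
  have K: "1 < K" unfolding K_def using L m0 by (simp add: one_less_power)
  define \<beta> where "\<beta> = log 2 C"
  have \<beta>: "0 \<le> \<beta>" unfolding \<beta>_def using C by simp
  define A where "A = 2 * C * C"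
  have CC: "1 \<le> C * C" using C by (simp add: less_imp_le mult_ge1_I)
  have A: "2 \<le> A" unfolding A_def using CC by simp
  show ?thesis
  proof (rule that[of A K \<beta>])
    show "1 \<le> A" using A by simp
    show "1 < K" by fact
    show "0 \<le> \<beta>" by fact
    show "0 < measure (weighted_measure \<nu>) {z. 1 - h \<le> cmod z \<and> cmod z < 1}" if h: "0 < h" "h < 1" for h
    proof -
      have "0 < measure (weighted_measure \<nu>) (carleson_box h 0)"
        by (rule weighted_measure_square_pos[OF w box_pt_in[OF h]])
      also have "\<dots> \<le> measure (weighted_measure \<nu>) {z. 1 - h \<le> cmod z \<and> cmod z < 1}"
        using carleson_box_iff[OF h] by (intro finite_measure_mono) (auto simp: sets_weighted_measure)
      finally show ?thesis .
    qed
    show "measure (weighted_measure \<nu>) {z. 1 - h \<le> cmod z \<and> cmod z < 1}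
        \<le> A * (h / t) powr \<beta> * measure (weighted_measure \<nu>) {z. 1 - t \<le> cmod z \<and> cmod z < 1}"
      if t: "0 < t" "t \<le> h" "h < 1" for t h
    proof -
      obtain k where k: "2 ^ k \<le> h / t" "h / t < 2 ^ Suc k"
        using dyadic_scale[of 2 "h / t"] t by auto
      have ht: "h / 2 ^ Suc k \<le> t" using k(2) t by (simp add: field_simps)
      have "V h \<le> 2 * T h" using t by (intro V1) auto
      also have "T h \<le> C ^ Suc k * T (h / 2 ^ Suc k)" using t by (intro Thatn) auto
      also have "T (h / 2 ^ Suc k) \<le> T t" using t ht by (intro Tmono) auto
      also have "T t \<le> C * V t" using t by (intro V2) auto
      also have "C ^ Suc k \<le> C * (h / t) powr \<beta>"
      proof -
        have "C = 2 powr \<beta>" unfolding \<beta>_def using C by simp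
        then have "C ^ k = (2 powr \<beta>) powr real k" using C by (simp add: powr_realpow)
        also have "\<dots> = (2 ^ k) powr \<beta>" by (simp only: powr_powr mult.commute[of \<beta>]) (simp add: powr_powr[symmetric] powr_realpow)
        also have "\<dots> \<le> (h / t) powr \<beta>" using k(1) \<beta> by (intro powr_mono2) auto
        finally show ?thesis using C by simp
      qed
      finally have "V h \<le> 2 * (C * (h / t) powr \<beta> * (C * V t))"
        using C unfolding V_def by (simp add: mult_left_mono mult_right_mono)
      then show ?thesis unfolding V_def A_def by (simp add: mult_ac)
    qed
    show "measure (weighted_measure \<nu>) {z. 1 - h \<le> cmod z \<and> cmod z < 1}
        \<le> A * measure (weighted_measure \<nu>) {z. 1 - h \<le> cmod z \<and> cmod z < 1 - h / K}" if h: "0 < h" "h < 1" for h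
    proof -
      define R where "R = measure (weighted_measure \<nu>) {z. 1 - h \<le> cmod z \<and> cmod z < 1 - h / K}"
      have hK: "0 < h / K" "h / K < h" using h K by (auto simp: divide_less_eq)
      have "{z. 1 - h \<le> cmod z \<and> cmod z < 1} = {z. 1 - h \<le> cmod z \<and> cmod z < 1 - h / K} \<union> {z::complex. 1 - h / K \<le> cmod z \<and> cmod z < 1}"
        using hK by auto
      moreover have "{z. 1 - h \<le> cmod z \<and> cmod z < 1 - h / K} \<inter> {z::complex. 1 - h / K \<le> cmod z \<and> cmod z < 1} = {}"
        by auto
      ultimately have "V h = R + V (h / K)"
        unfolding V_def R_def by (simp add: finite_measure_Union sets_weighted_measure)
      moreover have "V (h / K) \<le> V h / 2"
      proof -
        have "4 * C * T (h / K) \<le> c ^ m * T (h / K)" using m T0[of "h / K"] hK h by (intro mult_right_mono) auto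
        also have "\<dots> \<le> T h" unfolding K_def using h by (intro Tcheckn) auto
        also have "\<dots> \<le> C * V h" by (rule V2[OF h])
        finally have "4 * T (h / K) \<le> V h" using C by simp
        moreover have "V (h / K) \<le> 2 * T (h / K)" using hK h by (intro V1) auto
        ultimately show ?thesis by simp
      qed
      ultimately have "V h \<le> 2 * R" by simp
      also have "\<dots> \<le> A * R" using A unfolding R_def by (intro mult_right_mono) auto
      finally show ?thesis unfolding V_def R_def .
    qed
  qed
qed

lemma B_infinity_D_regular_pair:
  assumes "\<omega> \<in> B_infinity_D"
  obtains \<eta> q A K \<beta> C where "weight \<omega>" "regular_pair (weighted_measure \<omega>) \<eta> q A K \<beta> C"
proof -
  obtain \<nu> q where \<nu>: "\<nu> \<in> D_class" and q: "1 < q" and w: "weight \<omega>" and B: "quotient_in_B q \<nu> \<omega>"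
    using assms unfolding B_infinity_D_def B_infinity_def by auto
  have rw: "radial_weight \<nu>" using \<nu> unfolding D_class_def D_hat_def by blast
  then have nw: "weight \<nu>" unfolding radial_weight_def by blast
  obtain A K \<beta> where tails: "1 \<le> A" "1 < K" "0 \<le> \<beta>"
    "\<And>h. 0 < h \<Longrightarrow> h < 1 \<Longrightarrow> 0 < measure (weighted_measure \<nu>) {z. 1 - h \<le> cmod z \<and> cmod z < 1}"
    "\<And>t h. 0 < t \<Longrightarrow> t \<le> h \<Longrightarrow> h < 1 \<Longrightarrow>
      measure (weighted_measure \<nu>) {z. 1 - h \<le> cmod z \<and> cmod z < 1}
        \<le> A * (h / t) powr \<beta> * measure (weighted_measure \<nu>) {z. 1 - t \<le> cmod z \<and> cmod z < 1}"
    "\<And>h. 0 < h \<Longrightarrow> h < 1 \<Longrightarrow>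
      measure (weighted_measure \<nu>) {z. 1 - h \<le> cmod z \<and> cmod z < 1}
        \<le> A * measure (weighted_measure \<nu>) {z. 1 - h \<le> cmod z \<and> cmod z < 1 - h / K}"
    by (rule D_class_tails[OF \<nu>]) (rule that)
  obtain C where C: "C > 0" and lin: "\<forall>a\<in>unit_disc - {0}. \<forall>F y. F \<in> borel_measurable borel \<and> (\<forall>z. 0 \<le> F z) \<and> 0 < y \<longrightarrow>
      (\<integral>\<^sup>+z\<in>carleson_square a. ennreal (F z) \<partial>weighted_measure \<nu>)
        \<le> ennreal (C * measure (weighted_measure \<nu>) (carleson_square a) * y)
          + ennreal (C * measure (weighted_measure \<nu>) (carleson_square a) * y powr (1 - q) / measure (weighted_measure \<omega>) (carleson_square a))
            * (\<integral>\<^sup>+z\<in>carleson_square a. ennreal (F z powr q) \<partial>weighted_measure \<omega>)"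
    using B_condition_linear[OF q w nw B] by (elim exE conjE) (rule that)
  have "regular_pair (weighted_measure \<omega>) (weighted_measure \<nu>) q A K \<beta> C"
    by (intro regular_pair.intro finite_weighted_measure[OF w] finite_weighted_measure[OF nw] sets_weighted_measure
        weighted_measure_disc[OF w] radial_weight_rotate[OF rw] q tails C weighted_measure_square_pos[OF w];
        (assumption | (rule lin[rule_format]; simp)))
  with w show ?thesis by (rule that)
qed

section \<open>The Littlewood--Paley formula\<close>

text \<open>
  Functions holomorphic in the disc are arbitrary outside it; putting them to \<open>0\<close> there makes them
  Borel functions without changing any derivative inside.
\<close>

definition disc_part :: "(complex \<Rightarrow> complex) \<Rightarrow> complex \<Rightarrow> complex" where
  "disc_part f z = (if z \<in> unit_disc then f z else 0)"

lemma disc_part_holomorphic: "f holomorphic_on unit_disc \<Longrightarrow> disc_part f holomorphic_on unit_disc"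
  by (rule holomorphic_transform) (auto simp: disc_part_def)

lemma disc_part_measurable:
  assumes "f holomorphic_on unit_disc" shows "disc_part f \<in> borel_measurable borel"
proof -
  have "(\<lambda>x. indicator unit_disc x *\<^sub>R f x) \<in> borel_measurable borel"
    using assms by (intro borel_measurable_continuous_on_indicator holomorphic_on_imp_continuous_on) auto
  moreover have "(\<lambda>x. indicator unit_disc x *\<^sub>R f x) = disc_part f"
    by (auto simp: disc_part_def fun_eq_iff)
  ultimately show ?thesis by simp
qed

lemma disc_part_derivative:
  assumes f: "f holomorphic_on unit_disc" and x: "x \<in> unit_disc"
  shows "(disc_part ((deriv ^^ j) f) has_field_derivative disc_part ((deriv ^^ Suc j) f) x) (at x)"
proof -
  have "(deriv ^^ j) f holomorphic_on unit_disc" using f by (intro holomorphic_higher_deriv) auto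
  then have "((deriv ^^ j) f has_field_derivative deriv ((deriv ^^ j) f) x) (at x)"
    using x by (intro holomorphic_derivI) auto
  then have "(disc_part ((deriv ^^ j) f) has_field_derivative deriv ((deriv ^^ j) f) x) (at x)"
    by (rule has_field_derivative_transform_within_open[where S=unit_disc]) (use x in \<open>auto simp: disc_part_def\<close>)
  then show ?thesis using x by (simp add: disc_part_def)
qed

lemma disc_part_higher_deriv:
  assumes f: "f holomorphic_on unit_disc" and z: "z \<in> unit_disc"
  shows "(deriv ^^ k) (disc_part f) z = (deriv ^^ k) f z"
  by (rule higher_deriv_transform_within_open[OF disc_part_holomorphic[OF f] f _ z]) (auto simp: disc_part_def)

theorem theorem1:
  fixes p :: real and k :: nat and \<omega> :: "complex \<Rightarrow> real"
  assumes "0 < p" and "1 \<le> k" and "\<omega> \<in> B_infinity_D"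
  shows "\<exists>C::real. C > 0 \<and> (\<forall>f. f holomorphic_on unit_disc \<longrightarrow>
    (let X = bergman_norm_pow p \<omega> f;
         Y = (\<integral>\<^sup>+ z. ennreal (cmod ((deriv ^^ k) f z) powr p
                 * (1 - cmod z) powr (real k * p) * \<omega> z) \<partial>dA)
             + ennreal (\<Sum>j<k. cmod ((deriv ^^ j) f 0) powr p)
     in ennreal (inverse C) * Y \<le> X \<and> X \<le> ennreal C * Y))"
proof -
  obtain \<eta> q A K \<beta> C0 where w: "weight \<omega>" and rp: "regular_pair (weighted_measure \<omega>) \<eta> q A K \<beta> C0"
    using B_infinity_D_regular_pair[OF assms(3)] .
  interpret regular_pair "weighted_measure \<omega>" \<eta> q A K \<beta> C0 by (rule rp)
  obtain C1 where C1: "0 < C1" and up: "\<forall>F. (\<forall>j. F j holomorphic_on unit_disc \<and> F j \<in> borel_measurable borel \<and>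
      (\<forall>x\<in>unit_disc. (F j has_field_derivative F (Suc j) x) (at x))) \<longrightarrow>
    (\<integral>\<^sup>+z. ennreal (cmod (F 0 z) powr p) \<partial>weighted_measure \<omega>) \<le> ennreal C1 *
      ((\<integral>\<^sup>+z. ennreal (cmod (F k z) powr p * gap z powr (real k * p)) \<partial>weighted_measure \<omega>) + ennreal (\<Sum>j<k. cmod (F j 0) powr p))"
    using integral_le_by_higher_derivative[OF assms(1), of k] by (elim exE conjE) (rule that)
  obtain C2 where C2: "0 < C2" and lo1: "\<forall>f. f holomorphic_on unit_disc \<and> f \<in> borel_measurable borel \<longrightarrow>
      (\<integral>\<^sup>+z. ennreal (cmod ((deriv ^^ k) f z) powr p * gap z powr (real k * p)) \<partial>weighted_measure \<omega>)
        \<le> ennreal C2 * (\<integral>\<^sup>+z. ennreal (cmod (f z) powr p) \<partial>weighted_measure \<omega>)"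
    using higher_derivative_le_integral[OF assms(1), of k] by (elim exE conjE) (rule that)
  obtain C3 where C3: "0 < C3" and lo2: "\<forall>f. f holomorphic_on unit_disc \<and> f \<in> borel_measurable borel \<longrightarrow>
      ennreal (\<Sum>j<k. cmod ((deriv ^^ j) f 0) powr p) \<le> ennreal C3 * (\<integral>\<^sup>+z. ennreal (cmod (f z) powr p) \<partial>weighted_measure \<omega>)"
    using Taylor_coefficients_le_integral[OF assms(1), of k] by (elim exE conjE) (rule that)
  define C where "C = max C1 (C2 + C3)"
  have C: "0 < C" "C1 \<le> C" "C2 + C3 \<le> C" unfolding C_def using C1 by auto
  have wnn: "0 \<le> \<omega> z" if "z \<in> unit_disc" for z using w that unfolding weight_def by blast
  show ?thesis
  proof (intro exI[of _ C] conjI allI impI)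
    show "0 < C" by (rule C(1))
    fix f assume f: "f holomorphic_on unit_disc"
    define F where "F j = disc_part ((deriv ^^ j) f)" for j
    have hd: "(deriv ^^ j) f holomorphic_on unit_disc" for j using f by (intro holomorphic_higher_deriv) auto
    have Fh: "F j holomorphic_on unit_disc" for j unfolding F_def by (rule disc_part_holomorphic[OF hd])
    have Fm[measurable]: "F j \<in> borel_measurable borel" for j unfolding F_def by (rule disc_part_measurable[OF hd])
    have Fd: "(F j has_field_derivative F (Suc j) x) (at x)" if "x \<in> unit_disc" for j x
      unfolding F_def by (rule disc_part_derivative[OF f that])
    have Feq: "F j z = (deriv ^^ j) f z" if "z \<in> unit_disc" for j z
      unfolding F_def disc_part_def using that by simp
    have F0: "(deriv ^^ j) (F 0) z = (deriv ^^ j) f z" if "z \<in> unit_disc" for j z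
      unfolding F_def using disc_part_higher_deriv[OF f that, of j] by simp
    have Fz: "F j 0 = (deriv ^^ j) f 0" for j by (rule Feq) simp
    define X where "X = bergman_norm_pow p \<omega> f"
    define I where "I = (\<integral>\<^sup>+ z. ennreal (cmod ((deriv ^^ k) f z) powr p * (1 - cmod z) powr (real k * p) * \<omega> z) \<partial>dA)"
    define s where "s = (\<Sum>j<k. cmod ((deriv ^^ j) f 0) powr p)"
    have X: "X = (\<integral>\<^sup>+z. ennreal (cmod (F 0 z) powr p) \<partial>weighted_measure \<omega>)"
    proof -
      have "(\<integral>\<^sup>+z. ennreal (cmod (F 0 z) powr p) \<partial>weighted_measure \<omega>) = (\<integral>\<^sup>+z. ennreal (\<omega> z) * ennreal (cmod (F 0 z) powr p) \<partial>dA)"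
        by (rule nn_integral_weighted_measure[OF weight_measurable[OF w]]) measurable
      also have "\<dots> = X" unfolding X_def bergman_norm_pow_def
      proof (rule nn_integral_cong)
        fix z assume "z \<in> space dA"
        then have z: "z \<in> unit_disc" by (simp add: space_dA)
        show "ennreal (\<omega> z) * ennreal (cmod (F 0 z) powr p) = ennreal (cmod (f z) powr p * \<omega> z)"
          using wnn[OF z] Feq[OF z, of 0] by (simp add: ennreal_mult' mult.commute)
      qed
      finally show ?thesis by simp
    qed
    have I: "I = (\<integral>\<^sup>+z. ennreal (cmod (F k z) powr p * gap z powr (real k * p)) \<partial>weighted_measure \<omega>)"
    proof -
      have "(\<integral>\<^sup>+z. ennreal (cmod (F k z) powr p * gap z powr (real k * p)) \<partial>weighted_measure \<omega>)
         = (\<integral>\<^sup>+z. ennreal (\<omega> z) * ennreal (cmod (F k z) powr p * gap z powr (real k * p)) \<partial>dA)"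
        by (rule nn_integral_weighted_measure[OF weight_measurable[OF w]]) measurable
      also have "\<dots> = I" unfolding I_def
      proof (rule nn_integral_cong)
        fix z assume "z \<in> space dA"
        then have z: "z \<in> unit_disc" by (simp add: space_dA)
        show "ennreal (\<omega> z) * ennreal (cmod (F k z) powr p * gap z powr (real k * p))
          = ennreal (cmod ((deriv ^^ k) f z) powr p * (1 - cmod z) powr (real k * p) * \<omega> z)"
          unfolding Feq[OF z] gap_def using wnn[OF z] by (subst ennreal_mult'[symmetric]) (simp_all add: mult_ac)
      qed
      finally show ?thesis by simp
    qed
    have I': "I = (\<integral>\<^sup>+z. ennreal (cmod ((deriv ^^ k) (F 0) z) powr p * gap z powr (real k * p)) \<partial>weighted_measure \<omega>)"
      unfolding I
    proof (rule nn_integral_cong_AE)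
      show "AE z in weighted_measure \<omega>. ennreal (cmod (F k z) powr p * gap z powr (real k * p))
          = ennreal (cmod ((deriv ^^ k) (F 0) z) powr p * gap z powr (real k * p))"
        using mu_disc by eventually_elim (simp only: F0 Feq)
    qed
    have "X \<le> ennreal C1 * (I + ennreal s)"
      using up[rule_format, of F] Fh Fm Fd unfolding X I s_def Fz by blast
    also have "\<dots> \<le> ennreal C * (I + ennreal s)" using C by (intro mult_right_mono ennreal_leI) auto
    finally have upper: "X \<le> ennreal C * (I + ennreal s)" .
    have 1: "I \<le> ennreal C2 * X"
      unfolding I' X using lo1 Fh Fm by blast
    have "ennreal (\<Sum>j<k. cmod ((deriv ^^ j) (F 0) 0) powr p) \<le> ennreal C3 * X"
      unfolding X using lo2 Fh Fm by blast
    then have 2: "ennreal s \<le> ennreal C3 * X" unfolding s_def using F0[of 0] by simp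
    have "I + ennreal s \<le> ennreal C2 * X + ennreal C3 * X" by (rule add_mono[OF 1 2])
    also have "\<dots> = ennreal (C2 + C3) * X" using C2 C3 by (simp add: distrib_right ennreal_plus)
    also have "\<dots> \<le> ennreal C * X" using C by (intro mult_right_mono ennreal_leI) auto
    finally have "ennreal (inverse C) * (I + ennreal s) \<le> ennreal (inverse C) * (ennreal C * X)"
      by (rule mult_left_mono) simp
    also have "\<dots> = ennreal (inverse C * C) * X" using C by (subst ennreal_mult') (auto simp: mult.assoc)
    also have "\<dots> = X" using C by simp
    finally have lower: "ennreal (inverse C) * (I + ennreal s) \<le> X" .
    show "let X = bergman_norm_pow p \<omega> f;
         Y = (\<integral>\<^sup>+ z. ennreal (cmod ((deriv ^^ k) f z) powr p
                 * (1 - cmod z) powr (real k * p) * \<omega> z) \<partial>dA)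
             + ennreal (\<Sum>j<k. cmod ((deriv ^^ j) f 0) powr p)
     in ennreal (inverse C) * Y \<le> X \<and> X \<le> ennreal C * Y"
      unfolding Let_def X_def[symmetric] I_def[symmetric] s_def[symmetric] using lower upper by blast
  qed
qed

end
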